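(* Let $\pi$ be a groupoid, $V$ a $\pi$-graded vector space of finite type over $\mathbb{C}$, $N\ge1$, and $T$ a local dynamical Temperley--Lieb operator on $V$ associated to a map $\bar\kappa:\mathrm{Ob}(\pi)\to\mathbb{C}\setminus\{0\}$, which can be Baxterized by $\check R(x,a)=\mathrm{id}+xT(a)$: there is a nonconstant meromorphic function $f$ on $\mathbb{C}$ with $f(0)=0$ such that for generic $z,z'$ the numbers $x=f(z)$, $x'=f(z')$, $x''=f(z'-z)$ satisfy $x''=\frac{x'-x}{1+\bar\kappa(a)x+xx'}$ and $x''=\frac{x'-x}{1+\bar\kappa(t(\alpha))x+xx'}$ for every object $a$ and every arrow $\alpha$ with source $a$. Let $M(x)\in\Gamma(\pi,\underline{\mathrm{End}}(V^{\otimes N}))$ be the transfer matrix $$M(x)=\mathrm{tr}_V\big(\check R^{(N,N+1)}(x)\cdots\check R^{(2,3)}(x)\,\check R^{(1,2)}(x)\big),$$ and let $H=M(0)^{-1}*M'(x)|_{x=0}$ be its logarithmic derivative at $x=0$. Then, for all $y$, $$H*M(y)=M(y)*H.$$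
   Context: A groupoid $\pi$ is a small category with all arrows invertible; $s,t$ are source and target; $\beta\circ\alpha$ is defined when $t(\alpha)=s(\beta)$. $\pi(a,b)$ is the set of arrows from $a$ to $b$. A $\pi$-graded vector space of finite type over $\mathbb{C}$ is a collection $V=(V_\alpha)_{\alpha\in\pi}$ of finite dimensional spaces such that for each object $a$ only finitely many $\alpha$ with source or target $a$ have $V_\alpha\ne0$. Morphisms are families of linear maps $V_\alpha\to W_\alpha$, and $(V\otimes W)_\gamma=\bigoplus_{\beta\circ\alpha=\gamma}V_\alpha\otimes W_\beta$. A local dynamical Temperley--Lieb operator is a family $T(a)\in\bigoplus_{\alpha\in s^{-1}(a)}\mathrm{End}((V\otimes V)_\alpha)$ with $T(a)^2=\bar\kappa(a)T(a)$, $T^{(12)}(a)T^{(23)}(ah^{(1)})T^{(12)}(a)=T^{(12)}(a)$, $T^{(23)}(ah^{(1)})T^{(12)}(a)T^{(23)}(ah^{(1)})=T^{(23)}(ah^{(1)})$, where on $u\otimes v\otimes w\in V_{\alpha_1}\otimes V_{\alpha_2}\otimes V_{\alpha_3}$ with $s(\alpha_1)=a$: $T^{(12)}(a)(u\otimes v\otimes w)=T(a)(u\otimes v)\otimes w$, $T^{(23)}(ah^{(1)})(u\otimes v\otimes w)=u\otimes T(t(\alpha_1))(v\otimes w)$. Collecting all source fibers, $T$ and $\check R(x)=\mathrm{id}+xT$ are endomorphisms of $V\otimes V$; $\check R^{(i,i+1)}(x)$ acts on the factors $i,i+1$ of $V^{\otimes(N+1)}$ (that is, $\check R^{(i,i+1)}(x)$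 uses $\check R(x,t(\alpha_{i-1}))$ on $V_{\alpha_1}\otimes\cdots\otimes V_{\alpha_{N+1}}$). The product of the $\check R^{(i,i+1)}$ is viewed as a morphism $V\otimes W\to W\otimes V$ with $W=V^{\otimes N}$. For a graded space $W$, $\underline{\mathrm{End}}\,W$ is the $\pi$-graded algebra with $(\underline{\mathrm{End}}\,W)_\alpha=\bigoplus_{\gamma\in\pi(a,a)}\mathrm{Hom}(W_{\alpha\circ\gamma\circ\alpha^{-1}},W_\gamma)$, $a=s(\alpha)$, with product $(\underline{\mathrm{End}}\,W)_\alpha\times(\underline{\mathrm{End}}\,W)_\beta\to(\underline{\mathrm{End}}\,W)_{\beta\circ\alpha}$ given by composition of linear maps and units $1_a=\bigoplus_{\gamma\in\pi(a,a)}\mathrm{id}_{W_\gamma}$. The convolution algebra $\Gamma(\pi,\underline{\mathrm{End}}\,W)$ consists of maps $g$ with $g(\alpha)\in(\underline{\mathrm{End}}\,W)_\alpha$ such that for every object $a$ only finitely many $\alpha\in s^{-1}(a)\cup t^{-1}(a)$ have $g(\alpha)\ne0$, with product $(g*k)(\gamma)=\sum_{\beta\circ\alpha=\gamma}g(\alpha)k(\beta)$. The partial trace over $V$ of a morphism $F:V\otimes W\to W\otimes V$ is the element $\mathrm{tr}_VF\in\Gamma(\pi,\underline{\mathrm{End}}\,W)$ with $(\mathrm{tr}_VF)(\alpha)=\bigoplus_{\gamma\in\pi(a,a)}\sum_i(\mathrm{id}\otimes e_i^* )F(\alpha,\gamma)(e_i\otimes\mathrm{id})$, $a=s(\alpha)$,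 where $F(\alpha,\gamma):V_\alpha\otimes W_{\alpha\gamma\alpha^{-1}}\to W_\gamma\otimes V_\alpha$ is the corresponding component of $F$ and $(e_i)$, $(e_i^* )$ are dual bases of $V_\alpha$ and $V_\alpha^*$. $M(0)^{-1}$ denotes the inverse of $M(0)$ in the convolution algebra ($M(0)$ is a cyclic translation operator), and $M'(x)$ is the componentwise derivative in $x$. *)

theory Defs
  imports "HOL-Complex_Analysis.Complex_Analysis" "HOL-Library.Function_Algebras"
begin

section \<open>Groupoids\<close>

text \<open>A small category with objects \<open>Ob G\<close> and arrows \<open>Arr G\<close>;
  \<open>cmp G \<beta> \<alpha>\<close> is \<open>\<beta> \<circ> \<alpha>\<close>, meaningful only if \<open>tgt G \<alpha> = src G \<beta>\<close>.\<close>

record ('o, 'a) groupoid_data =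
  Ob  :: "'o set"
  Arr :: "'a set"
  src :: "'a \<Rightarrow> 'o"
  tgt :: "'a \<Rightarrow> 'o"
  cmp :: "'a \<Rightarrow> 'a \<Rightarrow> 'a"
  idt :: "'o \<Rightarrow> 'a"
  ivs :: "'a \<Rightarrow> 'a"

locale groupoid =
  fixes G :: "('o, 'a) groupoid_data"
  assumes src_Ob: "\<alpha> \<in> Arr G \<Longrightarrow> src G \<alpha> \<in> Ob G"
    and tgt_Ob: "\<alpha> \<in> Arr G \<Longrightarrow> tgt G \<alpha> \<in> Ob G"
    and cmp_Arr: "\<lbrakk>\<alpha> \<in> Arr G; \<beta> \<in> Arr G; tgt G \<alpha> = src G \<beta>\<rbrakk> \<Longrightarrow> cmp G \<beta> \<alpha> \<in> Arr G"
    and src_cmp: "\<lbrakk>\<alpha> \<in> Arr G; \<beta> \<in> Arr G; tgt G \<alpha> = src G \<beta>\<rbrakk> \<Longrightarrow> src G (cmp G \<beta> \<alpha>) = src G \<alpha>"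
    and tgt_cmp: "\<lbrakk>\<alpha> \<in> Arr G; \<beta> \<in> Arr G; tgt G \<alpha> = src G \<beta>\<rbrakk> \<Longrightarrow> tgt G (cmp G \<beta> \<alpha>) = tgt G \<beta>"
    and cmp_assoc: "\<lbrakk>\<alpha> \<in> Arr G; \<beta> \<in> Arr G; \<gamma> \<in> Arr G; tgt G \<alpha> = src G \<beta>; tgt G \<beta> = src G \<gamma>\<rbrakk>
        \<Longrightarrow> cmp G \<gamma> (cmp G \<beta> \<alpha>) = cmp G (cmp G \<gamma> \<beta>) \<alpha>"
    and idt_Arr: "a \<in> Ob G \<Longrightarrow> idt G a \<in> Arr G"
    and src_idt: "a \<in> Ob G \<Longrightarrow> src G (idt G a) = a"
    and tgt_idt: "a \<in> Ob G \<Longrightarrow> tgt G (idt G a) = a"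
    and cmp_idt_right: "\<alpha> \<in> Arr G \<Longrightarrow> cmp G \<alpha> (idt G (src G \<alpha>)) = \<alpha>"
    and cmp_idt_left: "\<alpha> \<in> Arr G \<Longrightarrow> cmp G (idt G (tgt G \<alpha>)) \<alpha> = \<alpha>"
    and ivs_Arr: "\<alpha> \<in> Arr G \<Longrightarrow> ivs G \<alpha> \<in> Arr G"
    and src_ivs: "\<alpha> \<in> Arr G \<Longrightarrow> src G (ivs G \<alpha>) = tgt G \<alpha>"
    and tgt_ivs: "\<alpha> \<in> Arr G \<Longrightarrow> tgt G (ivs G \<alpha>) = src G \<alpha>"
    and ivs_left: "\<alpha> \<in> Arr G \<Longrightarrow> cmp G (ivs G \<alpha>) \<alpha> = idt G (src G \<alpha>)"
    and ivs_right: "\<alpha> \<in> Arr G \<Longrightarrow> cmp G \<alpha> (ivs G \<alpha>) = idt G (tgt G \<alpha>)"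

definition hom_set :: "('o, 'a) groupoid_data \<Rightarrow> 'o \<Rightarrow> 'o \<Rightarrow> 'a set" where
  "hom_set G a b = {\<alpha> \<in> Arr G. src G \<alpha> = a \<and> tgt G \<alpha> = b}"

definition conj_arr :: "('o, 'a) groupoid_data \<Rightarrow> 'a \<Rightarrow> 'a \<Rightarrow> 'a" where
  "conj_arr G \<alpha> \<gamma> = cmp G (cmp G \<alpha> \<gamma>) (ivs G \<alpha>)"


section \<open>Linear maps and graded spaces\<close>

text \<open>Vector spaces are subspaces of an ambient complex vector space, given by its scalar
  multiplication. A linear map with domain \<open>A\<close> is extended by zero outside \<open>A\<close>, so that equality of
  maps and the zero map have their usual meaning; zero and sums of functions are pointwise.\<close>

definition lin_maps ::
  "(complex \<Rightarrow> 'v \<Rightarrow> 'v) \<Rightarrow> (complex \<Rightarrow> 'w \<Rightarrow> 'w) \<Rightarrow> 'v set \<Rightarrow> 'w set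
    \<Rightarrow> ('v::ab_group_add \<Rightarrow> 'w::ab_group_add) set" where
  "lin_maps sc sc' A B = {f. (\<forall>u\<in>A. f u \<in> B)
     \<and> (\<forall>u\<in>A. \<forall>v\<in>A. f (u + v) = f u + f v)
     \<and> (\<forall>c. \<forall>u\<in>A. f (sc c u) = sc' c (f u))
     \<and> (\<forall>u. u \<notin> A \<longrightarrow> f u = 0)}"

definition dual :: "(complex \<Rightarrow> 'v \<Rightarrow> 'v) \<Rightarrow> 'v::ab_group_add set \<Rightarrow> ('v \<Rightarrow> complex) set" where
  "dual sc A = lin_maps sc (*) A UNIV"

definition graded_finite_type ::
  "('o, 'a) groupoid_data \<Rightarrow> (complex \<Rightarrow> 'v \<Rightarrow> 'v) \<Rightarrow> ('a \<Rightarrow> 'v::ab_group_add set) \<Rightarrow> bool" where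
  "graded_finite_type G sc V \<longleftrightarrow> vector_space sc
     \<and> (\<forall>\<alpha>\<in>Arr G. \<exists>B. finite B \<and> module.span sc B = V \<alpha>)
     \<and> (\<forall>a\<in>Ob G. finite {\<alpha> \<in> Arr G. (src G \<alpha> = a \<or> tgt G \<alpha> = a) \<and> V \<alpha> \<noteq> {0}})"


section \<open>Tensor powers of a graded space\<close>

text \<open>\<open>V\<^sub>1 \<otimes> \<dots> \<otimes> V\<^sub>n\<close>, for finite-dimensional spaces, is realised as the span of the
  functions \<open>(\<phi>\<^sub>1, \<dots>, \<phi>\<^sub>n) \<mapsto> \<phi>\<^sub>1(v\<^sub>1) \<cdots> \<phi>\<^sub>n(v\<^sub>n)\<close> on \<open>V\<^sub>1\<^sup>* \<times> \<dots> \<times> V\<^sub>n\<^sup>*\<close>. In a graded tensor each slot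
  also carries its degree, which makes the sum over all factorisations of \<open>\<gamma>\<close> direct. The
  associativity isomorphisms are identities: \<open>V \<otimes> V\<^bsup>\<otimes>N\<^esup> = V\<^bsup>\<otimes>(N+1)\<^esup> = V\<^bsup>\<otimes>N\<^esup> \<otimes> V\<close>.\<close>

type_synonym ('a, 'v) tensor = "('a \<times> ('v \<Rightarrow> complex)) list \<Rightarrow> complex"

definition tscale :: "complex \<Rightarrow> ('a, 'v) tensor \<Rightarrow> ('a, 'v) tensor" where
  "tscale c t = (\<lambda>\<psi>s. c * t \<psi>s)"

definition pure_tensor ::
  "(complex \<Rightarrow> 'v \<Rightarrow> 'v) \<Rightarrow> ('a \<Rightarrow> 'v::ab_group_add set) \<Rightarrow> ('a \<times> 'v) list \<Rightarrow> ('a, 'v) tensor" where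
  "pure_tensor sc V xs = (\<lambda>\<psi>s.
     if length \<psi>s = length xs
       \<and> (\<forall>i<length xs. fst (\<psi>s ! i) = fst (xs ! i) \<and> snd (\<psi>s ! i) \<in> dual sc (V (fst (xs ! i))))
     then \<Prod>i<length xs. snd (\<psi>s ! i) (snd (xs ! i)) else 0)"

definition tensor_prod :: "nat \<Rightarrow> ('a, 'v) tensor \<Rightarrow> ('a, 'v) tensor \<Rightarrow> ('a, 'v) tensor" where
  \<comment> \<open>\<open>s \<otimes> t\<close> for \<open>s\<close> with \<open>k\<close> factors\<close>
  "tensor_prod k s t = (\<lambda>\<psi>s. s (take k \<psi>s) * t (drop k \<psi>s))"

text \<open>A path \<open>[\<alpha>\<^sub>1, \<dots>, \<alpha>\<^sub>n]\<close> is traversed from left to right and has composite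
  \<open>\<alpha>\<^sub>n \<circ> \<dots> \<circ> \<alpha>\<^sub>1\<close>.\<close>

fun is_path :: "('o, 'a) groupoid_data \<Rightarrow> 'a list \<Rightarrow> bool" where
  "is_path G [] = False"
| "is_path G [\<alpha>] = (\<alpha> \<in> Arr G)"
| "is_path G (\<alpha> # \<beta> # as) = (\<alpha> \<in> Arr G \<and> tgt G \<alpha> = src G \<beta> \<and> is_path G (\<beta> # as))"

fun path_cmp :: "('o, 'a) groupoid_data \<Rightarrow> 'a list \<Rightarrow> 'a" where
  "path_cmp G [] = undefined"
| "path_cmp G [\<alpha>] = \<alpha>"
| "path_cmp G (\<alpha> # \<beta> # as) = cmp G (path_cmp G (\<beta> # as)) \<alpha>"

definition tensor_power ::
  "('o, 'a) groupoid_data \<Rightarrow> (complex \<Rightarrow> 'v \<Rightarrow> 'v) \<Rightarrow> ('a \<Rightarrow> 'v::ab_group_add set)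
    \<Rightarrow> nat \<Rightarrow> 'a \<Rightarrow> ('a, 'v) tensor set" where
  "tensor_power G sc V n \<gamma> = module.span tscale
     {pure_tensor sc V xs | xs. length xs = n \<and> is_path G (map fst xs)
        \<and> path_cmp G (map fst xs) = \<gamma> \<and> (\<forall>(\<alpha>, v)\<in>set xs. v \<in> V \<alpha>)}"

text \<open>Let \<open>A a \<beta>\<close> be the component in degree \<open>\<beta>\<close>, \<open>src G \<beta> = a\<close>, of an operator
  \<open>A(a)\<close> on \<open>V \<otimes> V\<close>. \<open>slot_op G sc V n A i \<gamma>\<close> is the degree \<open>\<gamma>\<close> component of the operator on
  \<open>V\<^bsup>\<otimes>n\<^esup>\<close> applying \<open>A\<close> to the factors number \<open>i\<close> and \<open>i + 1\<close>, counted from \<open>0\<close>: fix the other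
  arguments of the tensor, apply \<open>A\<close> to the resulting element of \<open>V \<otimes> V\<close>, and evaluate. Along a
  path the dynamical parameter \<open>src G (\<alpha> i)\<close> is \<open>tgt G (\<alpha> (i - 1))\<close> if \<open>i > 0\<close>; see also
  \<open>slot_op_tensor_prod\<close>.\<close>

definition slot_op ::
  "('o, 'a) groupoid_data \<Rightarrow> (complex \<Rightarrow> 'v \<Rightarrow> 'v) \<Rightarrow> ('a \<Rightarrow> 'v::ab_group_add set) \<Rightarrow> nat
    \<Rightarrow> ('o \<Rightarrow> 'a \<Rightarrow> ('a, 'v) tensor \<Rightarrow> ('a, 'v) tensor) \<Rightarrow> nat
    \<Rightarrow> 'a \<Rightarrow> ('a, 'v) tensor \<Rightarrow> ('a, 'v) tensor" where
  "slot_op G sc V n A i \<gamma> t = (\<lambda>\<psi>s.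
     if t \<in> tensor_power G sc V n \<gamma> \<and> length \<psi>s = n \<and> is_path G [fst (\<psi>s ! i), fst (\<psi>s ! (i + 1))]
     then A (src G (fst (\<psi>s ! i))) (path_cmp G [fst (\<psi>s ! i), fst (\<psi>s ! (i + 1))])
            (\<lambda>\<chi>s. t (take i \<psi>s @ \<chi>s @ drop (i + 2) \<psi>s)) [\<psi>s ! i, \<psi>s ! (i + 1)]
     else 0)"


section \<open>Local dynamical Temperley--Lieb operators and Baxterization\<close>

definition local_dyn_TL ::
  "('o, 'a) groupoid_data \<Rightarrow> (complex \<Rightarrow> 'v \<Rightarrow> 'v) \<Rightarrow> ('a \<Rightarrow> 'v::ab_group_add set) \<Rightarrow> ('o \<Rightarrow> complex)
    \<Rightarrow> ('o \<Rightarrow> 'a \<Rightarrow> ('a, 'v) tensor \<Rightarrow> ('a, 'v) tensor) \<Rightarrow> bool" where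
  "local_dyn_TL G sc V \<kappa> T \<longleftrightarrow> (\<forall>a\<in>Ob G. \<forall>\<alpha>\<in>Arr G. src G \<alpha> = a \<longrightarrow>
       T a \<alpha> \<in> lin_maps tscale tscale (tensor_power G sc V 2 \<alpha>) (tensor_power G sc V 2 \<alpha>)
     \<and> T a \<alpha> \<circ> T a \<alpha> = (\<lambda>u. tscale (\<kappa> a) (T a \<alpha> u))
     \<and> slot_op G sc V 3 T 0 \<alpha> \<circ> slot_op G sc V 3 T 1 \<alpha> \<circ> slot_op G sc V 3 T 0 \<alpha> = slot_op G sc V 3 T 0 \<alpha>
     \<and> slot_op G sc V 3 T 1 \<alpha> \<circ> slot_op G sc V 3 T 0 \<alpha> \<circ> slot_op G sc V 3 T 1 \<alpha> = slot_op G sc V 3 T 1 \<alpha>)"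

definition R_check ::
  "('o, 'a) groupoid_data \<Rightarrow> (complex \<Rightarrow> 'v \<Rightarrow> 'v) \<Rightarrow> ('a \<Rightarrow> 'v::ab_group_add set)
    \<Rightarrow> ('o \<Rightarrow> 'a \<Rightarrow> ('a, 'v) tensor \<Rightarrow> ('a, 'v) tensor) \<Rightarrow> complex
    \<Rightarrow> 'o \<Rightarrow> 'a \<Rightarrow> ('a, 'v) tensor \<Rightarrow> ('a, 'v) tensor" where
  "R_check G sc V T x a \<alpha> =
     (\<lambda>u. if u \<in> tensor_power G sc V 2 \<alpha> then u + tscale x (T a \<alpha> u) else 0)"

text \<open>``Generic'' means: on an open dense set of pairs \<open>(z, z')\<close>. The values of \<open>f\<close> at poles
  (set to \<open>0\<close> by \<open>nicely_meromorphic_on\<close>) must not be used, hence the conditions on poles,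
  in particular at \<open>0\<close>.\<close>

definition baxterizable :: "('o, 'a) groupoid_data \<Rightarrow> ('o \<Rightarrow> complex) \<Rightarrow> bool" where
  "baxterizable G \<kappa> \<longleftrightarrow> (\<exists>f. f nicely_meromorphic_on UNIV \<and> \<not> f constant_on UNIV
     \<and> \<not> is_pole f 0 \<and> f 0 = 0
     \<and> (\<exists>U. open U \<and> closure U = UNIV \<and> (\<forall>(z, z')\<in>U.
          \<not> is_pole f z \<and> \<not> is_pole f z' \<and> \<not> is_pole f (z' - z)
          \<and> (let x = f z; x' = f z'; x'' = f (z' - z) in
             \<forall>a\<in>Ob G. \<forall>\<alpha>\<in>Arr G. src G \<alpha> = a \<longrightarrow>
               1 + \<kappa> a * x + x * x' \<noteq> 0 \<and> x'' = (x' - x) / (1 + \<kappa> a * x + x * x')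
             \<and> 1 + \<kappa> (tgt G \<alpha>) * x + x * x' \<noteq> 0
             \<and> x'' = (x' - x) / (1 + \<kappa> (tgt G \<alpha>) * x + x * x')))))"


section \<open>The convolution algebra\<close>

text \<open>An element \<open>g\<close> assigns to \<open>\<alpha>\<close> the family \<open>g \<alpha> \<gamma> : W (\<alpha> \<gamma> \<alpha>\<^sup>-\<^sup>1) \<rightarrow> W \<gamma>\<close>,
  where \<open>\<gamma>\<close> runs over the loops at the source of \<open>\<alpha>\<close>; all other entries are zero.\<close>

definition End_comp ::
  "('o, 'a) groupoid_data \<Rightarrow> (complex \<Rightarrow> 'w \<Rightarrow> 'w) \<Rightarrow> ('a \<Rightarrow> 'w::ab_group_add set)
    \<Rightarrow> 'a \<Rightarrow> ('a \<Rightarrow> 'w \<Rightarrow> 'w) set" where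
  "End_comp G sc W \<alpha> = {h.
     (\<forall>\<gamma>\<in>hom_set G (src G \<alpha>) (src G \<alpha>). h \<gamma> \<in> lin_maps sc sc (W (conj_arr G \<alpha> \<gamma>)) (W \<gamma>))
     \<and> (\<forall>\<gamma>. \<gamma> \<notin> hom_set G (src G \<alpha>) (src G \<alpha>) \<longrightarrow> h \<gamma> = 0)
     \<and> finite {\<gamma>. h \<gamma> \<noteq> 0}}"

definition End_mult ::
  "('o, 'a) groupoid_data \<Rightarrow> 'a \<Rightarrow> ('a \<Rightarrow> 'w \<Rightarrow> 'w) \<Rightarrow> ('a \<Rightarrow> 'w \<Rightarrow> 'w)
    \<Rightarrow> 'a \<Rightarrow> 'w::ab_group_add \<Rightarrow> 'w" where
  \<comment> \<open>product of \<open>h\<close> in degree \<open>\<alpha>\<close> with \<open>k\<close>\<close>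
  "End_mult G \<alpha> h k = (\<lambda>\<gamma>. if \<gamma> \<in> hom_set G (src G \<alpha>) (src G \<alpha>)
                          then h \<gamma> \<circ> k (conj_arr G \<alpha> \<gamma>) else 0)"

definition conv_alg ::
  "('o, 'a) groupoid_data \<Rightarrow> (complex \<Rightarrow> 'w \<Rightarrow> 'w) \<Rightarrow> ('a \<Rightarrow> 'w::ab_group_add set)
    \<Rightarrow> ('a \<Rightarrow> 'a \<Rightarrow> 'w \<Rightarrow> 'w) set" where
  "conv_alg G sc W = {g. (\<forall>\<alpha>\<in>Arr G. g \<alpha> \<in> End_comp G sc W \<alpha>) \<and> (\<forall>\<alpha>. \<alpha> \<notin> Arr G \<longrightarrow> g \<alpha> = 0)
     \<and> (\<forall>a\<in>Ob G. finite {\<alpha> \<in> Arr G. (src G \<alpha> = a \<or> tgt G \<alpha> = a) \<and> g \<alpha> \<noteq> 0})}"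

text \<open>The sum runs over the nonzero summands only, since \<open>sum\<close> over an infinite index set is \<open>0\<close>.\<close>

definition conv ::
  "('o, 'a) groupoid_data \<Rightarrow> ('a \<Rightarrow> 'a \<Rightarrow> 'w \<Rightarrow> 'w) \<Rightarrow> ('a \<Rightarrow> 'a \<Rightarrow> 'w \<Rightarrow> 'w)
    \<Rightarrow> 'a \<Rightarrow> 'a \<Rightarrow> 'w::ab_group_add \<Rightarrow> 'w" where
  "conv G g k \<gamma> = (\<Sum>(\<alpha>, \<beta>) \<in> {(\<alpha>, \<beta>). \<alpha> \<in> Arr G \<and> \<beta> \<in> Arr G \<and> tgt G \<alpha> = src G \<beta>
        \<and> cmp G \<beta> \<alpha> = \<gamma> \<and> g \<alpha> \<noteq> 0 \<and> k \<beta> \<noteq> 0}. End_mult G \<alpha> (g \<alpha>) (k \<beta>))"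

definition conv_one ::
  "('o, 'a) groupoid_data \<Rightarrow> ('a \<Rightarrow> 'w::ab_group_add set) \<Rightarrow> 'a \<Rightarrow> 'a \<Rightarrow> 'w \<Rightarrow> 'w" where
  "conv_one G W \<alpha> \<gamma> =
     (\<lambda>w. if \<alpha> \<in> idt G ` Ob G \<and> \<gamma> \<in> hom_set G (src G \<alpha>) (src G \<alpha>) \<and> w \<in> W \<gamma> then w else 0)"

definition is_conv_inverse ::
  "('o, 'a) groupoid_data \<Rightarrow> (complex \<Rightarrow> 'w \<Rightarrow> 'w) \<Rightarrow> ('a \<Rightarrow> 'w::ab_group_add set)
    \<Rightarrow> ('a \<Rightarrow> 'a \<Rightarrow> 'w \<Rightarrow> 'w) \<Rightarrow> ('a \<Rightarrow> 'a \<Rightarrow> 'w \<Rightarrow> 'w) \<Rightarrow> bool" where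
  "is_conv_inverse G sc W g k \<longleftrightarrow> g \<in> conv_alg G sc W \<and> k \<in> conv_alg G sc W
     \<and> conv G g k = conv_one G W \<and> conv G k g = conv_one G W"

definition conv_inverse ::
  "('o, 'a) groupoid_data \<Rightarrow> (complex \<Rightarrow> 'w \<Rightarrow> 'w) \<Rightarrow> ('a \<Rightarrow> 'w::ab_group_add set)
    \<Rightarrow> ('a \<Rightarrow> 'a \<Rightarrow> 'w \<Rightarrow> 'w) \<Rightarrow> 'a \<Rightarrow> 'a \<Rightarrow> 'w \<Rightarrow> 'w" where
  "conv_inverse G sc W g = (THE k. is_conv_inverse G sc W g k)"


section \<open>Partial trace, transfer matrix and Hamiltonian\<close>

definition basis_of :: "(complex \<Rightarrow> 'v \<Rightarrow> 'v) \<Rightarrow> 'v::ab_group_add set \<Rightarrow> 'v set" where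
  "basis_of sc A = (SOME B. \<not> module.dependent sc B \<and> module.span sc B = A)"

text \<open>The functional \<open>v \<mapsto> representation sc B v e\<close> is the element of the basis dual to \<open>B\<close>
  (extended by zero outside \<open>span B\<close>). Evaluating the last slot of a tensor on it is
  \<open>id \<otimes> e\<^sup>*\<close> composed with the projection onto the summand with last factor in degree \<open>\<alpha>\<close>. Note
  \<open>\<alpha> \<circ> \<gamma> = (\<alpha> \<gamma> \<alpha>\<^sup>-\<^sup>1) \<circ> \<alpha>\<close>.\<close>

definition partial_trace ::
  "('o, 'a) groupoid_data \<Rightarrow> (complex \<Rightarrow> 'v \<Rightarrow> 'v) \<Rightarrow> ('a \<Rightarrow> 'v::ab_group_add set) \<Rightarrow> nat
    \<Rightarrow> ('a \<Rightarrow> ('a, 'v) tensor \<Rightarrow> ('a, 'v) tensor)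
    \<Rightarrow> 'a \<Rightarrow> 'a \<Rightarrow> ('a, 'v) tensor \<Rightarrow> ('a, 'v) tensor" where
  "partial_trace G sc V N F \<alpha> \<gamma> w = (\<lambda>\<psi>s.
     if \<alpha> \<in> Arr G \<and> \<gamma> \<in> hom_set G (src G \<alpha>) (src G \<alpha>) \<and> w \<in> tensor_power G sc V N (conj_arr G \<alpha> \<gamma>)
     then \<Sum>e\<in>basis_of sc (V \<alpha>).
        F (cmp G \<alpha> \<gamma>) (tensor_prod 1 (pure_tensor sc V [(\<alpha>, e)]) w)
          (\<psi>s @ [(\<alpha>, \<lambda>v. module.representation sc (basis_of sc (V \<alpha>)) v e)])
     else 0)"

definition monodromy ::
  "('o, 'a) groupoid_data \<Rightarrow> (complex \<Rightarrow> 'v \<Rightarrow> 'v) \<Rightarrow> ('a \<Rightarrow> 'v::ab_group_add set) \<Rightarrow> nat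
    \<Rightarrow> ('o \<Rightarrow> 'a \<Rightarrow> ('a, 'v) tensor \<Rightarrow> ('a, 'v) tensor) \<Rightarrow> complex
    \<Rightarrow> 'a \<Rightarrow> ('a, 'v) tensor \<Rightarrow> ('a, 'v) tensor" where
  \<comment> \<open>\<open>fold\<close> applies the operator on the factors \<open>0, 1\<close> first\<close>
  "monodromy G sc V N T x \<gamma> = fold (\<lambda>i. slot_op G sc V (N + 1) (R_check G sc V T x) i \<gamma>) [0..<N]"

definition transfer_matrix ::
  "('o, 'a) groupoid_data \<Rightarrow> (complex \<Rightarrow> 'v \<Rightarrow> 'v) \<Rightarrow> ('a \<Rightarrow> 'v::ab_group_add set) \<Rightarrow> nat
    \<Rightarrow> ('o \<Rightarrow> 'a \<Rightarrow> ('a, 'v) tensor \<Rightarrow> ('a, 'v) tensor) \<Rightarrow> complex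
    \<Rightarrow> 'a \<Rightarrow> 'a \<Rightarrow> ('a, 'v) tensor \<Rightarrow> ('a, 'v) tensor" where
  "transfer_matrix G sc V N T x = partial_trace G sc V N (monodromy G sc V N T x)"

definition transfer_matrix_deriv ::
  "('o, 'a) groupoid_data \<Rightarrow> (complex \<Rightarrow> 'v \<Rightarrow> 'v) \<Rightarrow> ('a \<Rightarrow> 'v::ab_group_add set) \<Rightarrow> nat
    \<Rightarrow> ('o \<Rightarrow> 'a \<Rightarrow> ('a, 'v) tensor \<Rightarrow> ('a, 'v) tensor) \<Rightarrow> complex
    \<Rightarrow> 'a \<Rightarrow> 'a \<Rightarrow> ('a, 'v) tensor \<Rightarrow> ('a, 'v) tensor" where
  "transfer_matrix_deriv G sc V N T x \<alpha> \<gamma> w =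
     (\<lambda>\<psi>s. deriv (\<lambda>y. transfer_matrix G sc V N T y \<alpha> \<gamma> w \<psi>s) x)"

definition hamiltonian ::
  "('o, 'a) groupoid_data \<Rightarrow> (complex \<Rightarrow> 'v \<Rightarrow> 'v) \<Rightarrow> ('a \<Rightarrow> 'v::ab_group_add set) \<Rightarrow> nat
    \<Rightarrow> ('o \<Rightarrow> 'a \<Rightarrow> ('a, 'v) tensor \<Rightarrow> ('a, 'v) tensor)
    \<Rightarrow> 'a \<Rightarrow> 'a \<Rightarrow> ('a, 'v) tensor \<Rightarrow> ('a, 'v) tensor" where
  "hamiltonian G sc V N T =
     conv G (conv_inverse G tscale (tensor_power G sc V N) (transfer_matrix G sc V N T 0))
            (transfer_matrix_deriv G sc V N T 0)"


section \<open>Consistency of the tensor encoding\<close>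

lemma vector_space_tscale: "vector_space (tscale :: complex \<Rightarrow> ('a, 'v) tensor \<Rightarrow> _)"
  by unfold_locales (auto simp: tscale_def algebra_simps fun_eq_iff)

lemma tensor_power_support:
  fixes G :: "('o, 'a) groupoid_data" and V :: "'a \<Rightarrow> 'v::ab_group_add set"
  assumes "t \<in> tensor_power G sc V n \<gamma>" and "t \<psi>s \<noteq> 0"
  shows "length \<psi>s = n \<and> is_path G (map fst \<psi>s) \<and> path_cmp G (map fst \<psi>s) = \<gamma>"
proof (rule ccontr)
  interpret tv: vector_space "tscale :: complex \<Rightarrow> ('a, 'v) tensor \<Rightarrow> _" by (rule vector_space_tscale)
  assume neg: "\<not> ?thesis"
  have "t \<psi>s = 0" using assms(1) unfolding tensor_power_def
  proof (induction rule: tv.span_induct_alt)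
    case base show ?case by simp
  next
    case (step c p s)
    then obtain xs where xs: "p = pure_tensor sc V xs" "length xs = n" "is_path G (map fst xs)"
      "path_cmp G (map fst xs) = \<gamma>" by auto
    have "pure_tensor sc V xs \<psi>s = 0"
    proof (rule ccontr)
      assume nz: "pure_tensor sc V xs \<psi>s \<noteq> 0"
      then have "length \<psi>s = length xs" "\<forall>i<length xs. fst (\<psi>s ! i) = fst (xs ! i)"
        unfolding pure_tensor_def by (auto split: if_splits)
      then have "map fst \<psi>s = map fst xs" by (auto intro: nth_equalityI)
      with neg xs \<open>length \<psi>s = length xs\<close> show False by auto
    qed
    with step xs show ?case by (simp add: tscale_def)
  qed
  with assms(2) show False by simp
qed

lemma pure_tensor_linear:
  fixes V :: "'a \<Rightarrow> 'v::ab_group_add set"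
  assumes "u \<in> V \<alpha>" "v \<in> V \<alpha>" "sc c u \<in> V \<alpha>"
  shows "pure_tensor sc V (xs @ (\<alpha>, sc c u + v) # ys)
    = tscale c (pure_tensor sc V (xs @ (\<alpha>, u) # ys)) + pure_tensor sc V (xs @ (\<alpha>, v) # ys)"
proof
  fix \<psi>s :: "('a \<times> ('v \<Rightarrow> complex)) list"
  let ?z = "\<lambda>w. xs @ (\<alpha>, w) # ys"
  let ?k = "length xs"
  define n where "n = length (?z u)"
  define C where "C \<longleftrightarrow> length \<psi>s = n \<and>
    (\<forall>i<n. fst (\<psi>s ! i) = fst (?z u ! i) \<and> snd (\<psi>s ! i) \<in> dual sc (V (fst (?z u ! i))))"
  define D where "D = (\<Prod>i\<in>{..<n}-{?k}. snd (\<psi>s ! i) (snd (?z u ! i)))"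
  have k: "?k < n" by (simp add: n_def)
  have len: "length (?z w) = n" for w by (simp add: n_def)
  have fst_eq: "fst (?z w ! i) = fst (?z u ! i)" for w i
    by (simp add: nth_append nth_Cons split: nat.split)
  have p: "pure_tensor sc V (?z w) \<psi>s = (if C then snd (\<psi>s ! ?k) w * D else 0)" for w
  proof -
    have "(\<Prod>i<n. snd (\<psi>s ! i) (snd (?z w ! i)))
      = snd (\<psi>s ! ?k) w * (\<Prod>i\<in>{..<n}-{?k}. snd (\<psi>s ! i) (snd (?z w ! i)))"
      using k by (subst prod.remove[of _ ?k]) auto
    also have "(\<Prod>i\<in>{..<n}-{?k}. snd (\<psi>s ! i) (snd (?z w ! i))) = D"
      unfolding D_def by (rule prod.cong) (auto simp: nth_append nth_Cons split: nat.split)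
    finally show ?thesis unfolding pure_tensor_def len fst_eq[of w] C_def[symmetric] by simp
  qed
  have "snd (\<psi>s ! ?k) (sc c u + v) = c * snd (\<psi>s ! ?k) u + snd (\<psi>s ! ?k) v" if C
  proof -
    have "fst (?z u ! ?k) = \<alpha>" by simp
    then have "snd (\<psi>s ! ?k) \<in> dual sc (V \<alpha>)" using that k unfolding C_def by metis
    with assms show ?thesis unfolding dual_def lin_maps_def by auto
  qed
  then show "pure_tensor sc V (?z (sc c u + v)) \<psi>s
    = (tscale c (pure_tensor sc V (?z u)) + pure_tensor sc V (?z v)) \<psi>s"
    by (auto simp: p tscale_def algebra_simps)
qed

text \<open>\<open>slot_op\<close> is \<open>id \<otimes> A \<otimes> id\<close>.\<close>

lemma slot_op_tensor_prod:
  fixes G :: "('o, 'a) groupoid_data" and V :: "'a \<Rightarrow> 'v::ab_group_add set"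
  assumes u: "u \<in> tensor_power G sc V 2 \<beta>"
    and t: "tensor_prod i p (tensor_prod 2 u q) \<in> tensor_power G sc V n \<gamma>"
    and n: "n = i + 2 + m"
    and p: "\<And>\<psi>s. length \<psi>s \<noteq> i \<Longrightarrow> p \<psi>s = 0" and q: "\<And>\<psi>s. length \<psi>s \<noteq> m \<Longrightarrow> q \<psi>s = 0"
    and A: "\<And>\<alpha>. \<alpha> \<in> Arr G \<Longrightarrow>
      A (src G \<alpha>) \<alpha> \<in> lin_maps tscale tscale (tensor_power G sc V 2 \<alpha>) (tensor_power G sc V 2 \<alpha>)"
    and G: "groupoid G" and \<beta>: "\<beta> \<in> Arr G"
  shows "slot_op G sc V n A i \<gamma> (tensor_prod i p (tensor_prod 2 u q))
    = tensor_prod i p (tensor_prod 2 (A (src G \<beta>) \<beta> u) q)"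
proof
  interpret groupoid G by (rule G)
  interpret tv: vector_space "tscale :: complex \<Rightarrow> ('a, 'v) tensor \<Rightarrow> _" by (rule vector_space_tscale)
  fix \<psi>s :: "('a \<times> ('v \<Rightarrow> complex)) list"
  have Au: "A (src G \<beta>) \<beta> u \<in> tensor_power G sc V 2 \<beta>"
    using A[OF \<beta>] u by (auto simp: lin_maps_def)
  let ?t = "tensor_prod i p (tensor_prod 2 u q)"
  show "slot_op G sc V n A i \<gamma> ?t \<psi>s
    = tensor_prod i p (tensor_prod 2 (A (src G \<beta>) \<beta> u) q) \<psi>s"
  proof (cases "length \<psi>s = n")
    case False
    have "tensor_prod i p (tensor_prod 2 (A (src G \<beta>) \<beta> u) q) \<psi>s = 0"
    proof (cases "length \<psi>s < i + 2")
      case True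
      then have "length (take 2 (drop i \<psi>s)) \<noteq> 2" by simp
      then have "A (src G \<beta>) \<beta> u (take 2 (drop i \<psi>s)) = 0"
        using tensor_power_support[OF Au] by blast
      then show ?thesis by (simp add: tensor_prod_def)
    next
      case F: False
      then have "length (drop 2 (drop i \<psi>s)) \<noteq> m" using False n by auto
      then show ?thesis using q by (simp add: tensor_prod_def)
    qed
    with False show ?thesis by (simp add: slot_op_def)
  next
    case True
    let ?x = "\<psi>s ! i" and ?y = "\<psi>s ! (i + 1)"
    have split: "take 2 (drop i \<psi>s) = [?x, ?y]"
      using True n by (simp add: numeral_2_eq_2 take_Suc_conv_app_nth)
    define c where "c = p (take i \<psi>s) * q (drop (i + 2) \<psi>s)"
    have slice: "(\<lambda>\<chi>s. ?t (take i \<psi>s @ \<chi>s @ drop (i + 2) \<psi>s)) = tscale c u"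
    proof
      fix \<chi>s
      show "?t (take i \<psi>s @ \<chi>s @ drop (i + 2) \<psi>s) = tscale c u \<chi>s"
      proof (cases "length \<chi>s = 2")
        case L: True
        then show ?thesis using True n
          by (simp add: tensor_prod_def tscale_def c_def min_def algebra_simps)
      next
        case L: False
        then have z: "u \<chi>s = 0" using tensor_power_support[OF u] by blast
        have "?t (take i \<psi>s @ \<chi>s @ drop (i + 2) \<psi>s) = 0"
        proof (rule ccontr)
          assume "\<not> ?thesis"
          from tensor_power_support[OF t this] have "length (take i \<psi>s @ \<chi>s @ drop (i + 2) \<psi>s) = n" by simp
          with L True n show False by simp
        qed
        with z show ?thesis by (simp add: tscale_def)
      qed
    qed
    have rhs: "tensor_prod i p (tensor_prod 2 (A (src G \<beta>) \<beta> u) q) \<psi>s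
        = c * A (src G \<beta>) \<beta> u [?x, ?y]"
      using split by (simp add: tensor_prod_def c_def add.commute)
    show ?thesis
    proof (cases "is_path G [fst ?x, fst ?y]")
      case False
      then have "A (src G \<beta>) \<beta> u [?x, ?y] = 0"
        using tensor_power_support[OF Au, of "[?x, ?y]"] by auto
      with False rhs show ?thesis by (auto simp: slot_op_def)
    next
      case path: True
      let ?d = "cmp G (fst ?y) (fst ?x)"
      have d: "?d \<in> Arr G" "src G ?d = src G (fst ?x)"
        using path by (auto intro: cmp_Arr simp: src_cmp)
      have lhs: "slot_op G sc V n A i \<gamma> ?t \<psi>s = A (src G ?d) ?d (tscale c u) [?x, ?y]"
        using t True path d unfolding slot_op_def slice by simp
      show ?thesis
      proof (cases "?d = \<beta>")
        case True
        have "A (src G \<beta>) \<beta> (tscale c u) = tscale c (A (src G \<beta>) \<beta> u)"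
          using A[OF \<beta>] u by (auto simp: lin_maps_def)
        with True lhs rhs show ?thesis by (simp add: tscale_def)
      next
        case ne: False
        have "A (src G \<beta>) \<beta> u [?x, ?y] = 0"
          using tensor_power_support[OF Au, of "[?x, ?y]"] ne by auto
        moreover have "A (src G ?d) ?d (tscale c u) = 0"
        proof (cases "tscale c u \<in> tensor_power G sc V 2 ?d")
          case True
          moreover have "tscale c u \<in> tensor_power G sc V 2 \<beta>"
            using u unfolding tensor_power_def by (rule tv.span_scale)
          ultimately have "tscale c u \<chi>s = 0" for \<chi>s
            using tensor_power_support[of "tscale c u" G sc V 2 ?d \<chi>s]
              tensor_power_support[of "tscale c u" G sc V 2 \<beta> \<chi>s] ne by argo
          then have "tscale c u = 0" by (simp add: fun_eq_iff)
          moreover have "A (src G ?d) ?d (tscale 0 (tscale c u)) = tscale 0 (A (src G ?d) ?d (tscale c u))"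
            using A[OF d(1)] True unfolding lin_maps_def by blast
          ultimately show ?thesis by (simp only: tv.scale_zero_left tv.scale_zero_right)
        next
          case False
          then show ?thesis using A[OF d(1)] by (auto simp: lin_maps_def)
        qed
        ultimately show ?thesis using lhs rhs by simp
      qed
    qed
  qed
qed

end

theory Submission
  imports Defs
begin

text \<open>The Baxterization hypothesis, applied at two objects \<open>a\<close> and \<open>b\<close> with the same generic
  pair \<open>(z, z')\<close>, gives \<open>\<kappa> a * x = \<kappa> b * x\<close> for some \<open>x \<noteq> 0\<close>: the loop weight is a
  constant \<open>k\<close> (\<open>baxterizable_constant\<close>). The relations of \<open>T\<close> are then those of the Temperley--Lieb
  algebra with a scalar loop weight, and expanding products gives the Yang--Baxter equation
  \<open>R\<^sub>i\<^sub>+\<^sub>1(z) R\<^sub>i(x) R\<^sub>i\<^sub>+\<^sub>1(y) = R\<^sub>i(y) R\<^sub>i\<^sub>+\<^sub>1(x) R\<^sub>i(z)\<close>, \<open>R\<^sub>i(x) = id + x T\<^sub>i\<close>, for all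
  scalars with \<open>x = y + z + k y z + x y z\<close> (\<open>yang_baxter\<close>). For given \<open>y\<close> and all but
  finitely many \<open>x\<close> this equation has a solution \<open>z\<close> with \<open>R(z)\<close> invertible.

  The product \<open>M(x) * M(y)\<close> is the trace over two auxiliary factors \<open>V \<otimes> V\<close> of two shifted
  products of the \<open>R\<^sub>i\<close> (\<open>coord_product\<close>). An additional \<open>R(z)\<close> on the auxiliary factors can be moved
  through them, exchanging \<open>x\<close> and \<open>y\<close> (\<open>train_exchange\<close>), and \<open>R(z)\<close> and its inverse cancel in
  the trace by cyclicity (\<open>trace_cyclic\<close>). Since all entries are polynomials in \<open>x\<close>, the finitely many
  exceptional values are covered by continuity, so \<open>M(x) * M(y) = M(y) * M(x)\<close> for all \<open>x\<close> and \<open>y\<close>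
  (\<open>transfer_matrices_commute\<close>). Differentiating at \<open>x = 0\<close>, \<open>M(y)\<close> commutes with \<open>M'(0)\<close>. It
  also commutes with \<open>M(0)\<close>, hence with the inverse of \<open>M(0)\<close>, which exists because \<open>M(0)\<close> moves
  the last tensor factor to the front (\<open>translation_invertible\<close>). So \<open>M(y)\<close> commutes with \<open>H\<close>.

  All computations are done in coordinates. A basis of each \<open>V \<alpha>\<close>, the one chosen in the partial
  trace, identifies a tensor power in degree \<open>\<gamma>\<close> with the functions on a finite set of paths of
  composite \<open>\<gamma>\<close> whose arrows are labelled by basis vectors. An operator on two neighbouring factors
  becomes a finite sum over the paths that differ in two neighbouring places (\<open>coord_slot_op\<close>). That
  formula makes sense for arbitrary functions on lists, so that products, spectator factors and
  traces can be handled without keeping track of degrees.\<close>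

lemma sum_fun_apply: "(\<Sum>i\<in>I. f i) x = (\<Sum>i\<in>I. f i x)"
  for f :: "'i \<Rightarrow> 'x \<Rightarrow> 'y::comm_monoid_add"
  by (induction I rule: infinite_finite_induct) auto


section \<open>Composites of paths in a groupoid\<close>

context groupoid
begin

abbreviation loops :: "'a \<Rightarrow> 'a set" where
  "loops \<alpha> \<equiv> hom_set G (src G \<alpha>) (src G \<alpha>)"

lemma cmp_left_cancel:
  assumes "\<alpha> \<in> Arr G" "\<alpha>' \<in> Arr G" "\<beta> \<in> Arr G" "tgt G \<alpha> = src G \<beta>" "tgt G \<alpha>' = src G \<beta>"
    and "cmp G \<beta> \<alpha> = cmp G \<beta> \<alpha>'"
  shows "\<alpha> = \<alpha>'"
proof -
  have "cmp G (ivs G \<beta>) (cmp G \<beta> \<alpha>) = cmp G (ivs G \<beta>) (cmp G \<beta> \<alpha>')"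
    using assms by simp
  then have "cmp G (cmp G (ivs G \<beta>) \<beta>) \<alpha> = cmp G (cmp G (ivs G \<beta>) \<beta>) \<alpha>'"
    using assms cmp_assoc[of \<alpha> \<beta> "ivs G \<beta>"] cmp_assoc[of \<alpha>' \<beta> "ivs G \<beta>"]
    by (simp add: ivs_Arr src_ivs)
  then show ?thesis
    using assms by (metis cmp_idt_left ivs_left)
qed

lemma cmp_right_cancel:
  assumes "\<alpha> \<in> Arr G" "\<beta> \<in> Arr G" "\<beta>' \<in> Arr G" "tgt G \<alpha> = src G \<beta>" "tgt G \<alpha> = src G \<beta>'"
    and "cmp G \<beta> \<alpha> = cmp G \<beta>' \<alpha>"
  shows "\<beta> = \<beta>'"
proof -
  have "cmp G (cmp G \<beta> \<alpha>) (ivs G \<alpha>) = cmp G (cmp G \<beta>' \<alpha>) (ivs G \<alpha>)"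
    using assms by simp
  then have "cmp G \<beta> (cmp G \<alpha> (ivs G \<alpha>)) = cmp G \<beta>' (cmp G \<alpha> (ivs G \<alpha>))"
    using assms cmp_assoc[of "ivs G \<alpha>" \<alpha> \<beta>] cmp_assoc[of "ivs G \<alpha>" \<alpha> \<beta>']
    by (simp add: ivs_Arr tgt_ivs)
  then show ?thesis
    using assms by (metis cmp_idt_right ivs_right)
qed

lemma is_path_Cons:
  "xs \<noteq> [] \<Longrightarrow> is_path G (\<alpha> # xs) \<longleftrightarrow> \<alpha> \<in> Arr G \<and> tgt G \<alpha> = src G (hd xs) \<and> is_path G xs"
  by (cases xs) auto

lemma path_cmp_Cons: "xs \<noteq> [] \<Longrightarrow> path_cmp G (\<alpha> # xs) = cmp G (path_cmp G xs) \<alpha>"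
  by (cases xs) auto

lemma is_path_append:
  "xs \<noteq> [] \<Longrightarrow> ys \<noteq> [] \<Longrightarrow>
    is_path G (xs @ ys) \<longleftrightarrow> is_path G xs \<and> is_path G ys \<and> tgt G (last xs) = src G (hd ys)"
  by (induction xs) (auto simp: is_path_Cons)

lemma path_cmp_Arr:
  assumes "is_path G xs"
  shows "path_cmp G xs \<in> Arr G" "src G (path_cmp G xs) = src G (hd xs)"
    "tgt G (path_cmp G xs) = tgt G (last xs)"
proof -
  have "path_cmp G xs \<in> Arr G \<and> src G (path_cmp G xs) = src G (hd xs)
      \<and> tgt G (path_cmp G xs) = tgt G (last xs)"
    using assms
  proof (induction xs)
    case (Cons \<alpha> xs)
    then show ?case
      by (cases "xs = []") (auto simp: is_path_Cons path_cmp_Cons cmp_Arr src_cmp tgt_cmp)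
  qed simp
  then show "path_cmp G xs \<in> Arr G" "src G (path_cmp G xs) = src G (hd xs)"
    "tgt G (path_cmp G xs) = tgt G (last xs)" by auto
qed

lemma path_cmp_append:
  assumes "xs \<noteq> []" "ys \<noteq> []" "is_path G (xs @ ys)"
  shows "path_cmp G (xs @ ys) = cmp G (path_cmp G ys) (path_cmp G xs)"
  using assms
proof (induction xs)
  case (Cons \<alpha> xs)
  show ?case
  proof (cases "xs = []")
    case True
    with Cons show ?thesis by (auto simp: path_cmp_Cons)
  next
    case False
    then have p: "is_path G (xs @ ys)" "\<alpha> \<in> Arr G" "tgt G \<alpha> = src G (hd xs)"
      using Cons.prems by (auto simp: is_path_Cons)
    then have q: "is_path G xs" "is_path G ys" "tgt G (last xs) = src G (hd ys)"
      using False Cons.prems(2) by (auto simp: is_path_append)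
    show ?thesis
      using Cons False p q path_cmp_Arr[OF q(1)] path_cmp_Arr[OF q(2)]
      by (simp add: path_cmp_Cons cmp_assoc)
  qed
qed simp

lemma path_nonempty: "is_path G xs \<Longrightarrow> xs \<noteq> []"
  by auto

lemma is_path_infix:
  assumes "is_path G (xs @ ys @ zs)" "ys \<noteq> []"
  shows "is_path G ys"
  using assms by (cases "xs = []"; cases "zs = []") (auto simp: is_path_append)

lemma is_path_replace:
  assumes "is_path G (xs @ ys @ zs)" "is_path G ys'" "ys \<noteq> []" "path_cmp G ys' = path_cmp G ys"
  shows "is_path G (xs @ ys' @ zs)" "path_cmp G (xs @ ys' @ zs) = path_cmp G (xs @ ys @ zs)"
proof -
  have ys: "is_path G ys" and ys': "ys' \<noteq> []"
    using assms is_path_infix path_nonempty by blast+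
  have ends: "src G (hd ys') = src G (hd ys)" "tgt G (last ys') = tgt G (last ys)"
    using path_cmp_Arr[OF ys] path_cmp_Arr[OF assms(2)] assms(4) by auto
  show p: "is_path G (xs @ ys' @ zs)"
    using assms ys' ends by (cases "xs = []"; cases "zs = []") (auto simp: is_path_append)
  have *: "path_cmp G (ys' @ zs) = path_cmp G (ys @ zs)"
  proof (cases "zs = []")
    case False
    then show ?thesis using assms p ys' ys
      by (cases "xs = []") (auto simp: is_path_append path_cmp_append)
  qed (use assms in simp)
  show "path_cmp G (xs @ ys' @ zs) = path_cmp G (xs @ ys @ zs)"
    using * p assms ys' by (cases "xs = []") (auto simp: path_cmp_append)
qed

text \<open>Cancellation in the groupoid: the total composite and the arrows outside an infix determine the
  composite of the infix. This is why fixing all but some consecutive arguments of a homogeneous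
  tensor leaves a homogeneous tensor.\<close>

lemma path_cmp_infix_unique:
  assumes "is_path G (xs @ ys @ zs)" "is_path G (xs @ ys' @ zs)" "ys \<noteq> []" "ys' \<noteq> []"
    and "path_cmp G (xs @ ys' @ zs) = path_cmp G (xs @ ys @ zs)"
  shows "path_cmp G ys' = path_cmp G ys"
proof -
  have *: "is_path G (ys @ zs)" "is_path G (ys' @ zs)"
    using assms by (cases "xs = []", auto simp: is_path_append)+
  have eq: "path_cmp G (ys' @ zs) = path_cmp G (ys @ zs)"
  proof (cases "xs = []")
    case False
    have "cmp G (path_cmp G (ys' @ zs)) (path_cmp G xs) = cmp G (path_cmp G (ys @ zs)) (path_cmp G xs)"
      using assms False by (simp add: path_cmp_append)
    moreover have "is_path G xs" "tgt G (last xs) = src G (hd (ys @ zs))"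
      "tgt G (last xs) = src G (hd (ys' @ zs))"
      using assms False by (auto simp: is_path_append)
    ultimately show ?thesis
      using cmp_right_cancel[of "path_cmp G xs" "path_cmp G (ys' @ zs)" "path_cmp G (ys @ zs)"]
        path_cmp_Arr[of xs] path_cmp_Arr[OF *(1)] path_cmp_Arr[OF *(2)] by auto
  qed (use assms in simp)
  show ?thesis
  proof (cases "zs = []")
    case False
    then have "is_path G ys" "is_path G ys'" "is_path G zs"
      "tgt G (last ys) = src G (hd zs)" "tgt G (last ys') = src G (hd zs)"
      using * assms by (auto simp: is_path_append)
    then show ?thesis
      using cmp_left_cancel[of "path_cmp G ys'" "path_cmp G ys" "path_cmp G zs"] eq *
        path_cmp_Arr[of ys] path_cmp_Arr[of ys'] path_cmp_Arr[of zs] assms False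
      by (simp add: path_cmp_append)
  qed (use eq in simp)
qed

end


section \<open>Coordinates on tensor powers\<close>

locale graded_space = groupoid G for G :: "('o, 'a) groupoid_data" +
  fixes sc :: "complex \<Rightarrow> 'v::ab_group_add \<Rightarrow> 'v" and V :: "'a \<Rightarrow> 'v set"
  assumes finite_type: "graded_finite_type G sc V"
begin

sublocale vs: vector_space sc
  using finite_type by (simp add: graded_finite_type_def)

sublocale tv: vector_space "tscale :: complex \<Rightarrow> ('a, 'v) tensor \<Rightarrow> ('a, 'v) tensor"
  by (rule vector_space_tscale)

abbreviation basis :: "'a \<Rightarrow> 'v set" where "basis \<alpha> \<equiv> basis_of sc (V \<alpha>)"
abbreviation pt :: "('a \<times> 'v) list \<Rightarrow> ('a, 'v) tensor" where "pt \<equiv> pure_tensor sc V"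
abbreviation TP :: "nat \<Rightarrow> 'a \<Rightarrow> ('a, 'v) tensor set" where "TP \<equiv> tensor_power G sc V"

text \<open>The basis dual to \<open>basis \<alpha>\<close>, extended by zero outside \<open>V \<alpha>\<close> exactly as in the partial trace.\<close>

definition coeff :: "'a \<Rightarrow> 'v \<Rightarrow> 'v \<Rightarrow> complex" where
  "coeff \<alpha> e = (\<lambda>v. vs.representation (basis \<alpha>) v e)"

definition basis_arrows :: "('a \<times> 'v) set" where
  "basis_arrows = {(\<alpha>, e). \<alpha> \<in> Arr G \<and> e \<in> basis \<alpha>}"

definition basis_paths :: "nat \<Rightarrow> 'a \<Rightarrow> ('a \<times> 'v) list set" where
  "basis_paths n \<gamma> = {l. length l = n \<and> set l \<subseteq> basis_arrows \<and> is_path G (map fst l)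
      \<and> path_cmp G (map fst l) = \<gamma>}"

definition dual_list :: "('a \<times> 'v) list \<Rightarrow> ('a \<times> ('v \<Rightarrow> complex)) list" where
  "dual_list = map (\<lambda>(\<alpha>, e). (\<alpha>, coeff \<alpha> e))"

text \<open>The value is \<open>0\<close> on lists with entries outside the bases, so that the coordinate function of a
  tensor in degree \<open>\<gamma>\<close> is supported on the basis paths of composite \<open>\<gamma>\<close> and relations
  between coordinates can be stated for all lists.\<close>

definition coord :: "('a, 'v) tensor \<Rightarrow> ('a \<times> 'v) list \<Rightarrow> complex" where
  "coord t l = (if set l \<subseteq> basis_arrows then t (dual_list l) else 0)"

definition of_coord :: "nat \<Rightarrow> 'a \<Rightarrow> (('a \<times> 'v) list \<Rightarrow> complex) \<Rightarrow> ('a, 'v) tensor" where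
  "of_coord n \<gamma> f = (\<Sum>l\<in>basis_paths n \<gamma>. tscale (f l) (pt l))"

lemma dual_list_simps [simp]:
  "dual_list [] = []" "dual_list ((\<alpha>, e) # l) = (\<alpha>, coeff \<alpha> e) # dual_list l"
  "dual_list (l @ l') = dual_list l @ dual_list l'" "length (dual_list l) = length l"
  "map fst (dual_list l) = map fst l"
  by (auto simp: dual_list_def)

lemma of_coord_apply: "of_coord n \<gamma> f \<psi>s = (\<Sum>l\<in>basis_paths n \<gamma>. f l * pt l \<psi>s)"
  by (simp add: of_coord_def sum_fun_apply tscale_def)

lemma basis_props:
  assumes "\<alpha> \<in> Arr G"
  shows "vs.independent (basis \<alpha>)" "vs.span (basis \<alpha>) = V \<alpha>" "finite (basis \<alpha>)"
    "basis \<alpha> \<subseteq> V \<alpha>" "basis \<alpha> = {} \<longleftrightarrow> V \<alpha> = {0}"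
proof -
  obtain F where F: "finite F" "vs.span F = V \<alpha>"
    using finite_type assms by (auto simp: graded_finite_type_def)
  obtain B where B: "B \<subseteq> V \<alpha>" "vs.independent B" "V \<alpha> \<subseteq> vs.span B"
    using vs.maximal_independent_subset by blast
  have "vs.span B = V \<alpha>"
    using B F by (metis subset_antisym vs.span_minimal vs.subspace_span)
  with B have "\<exists>B. vs.independent B \<and> vs.span B = V \<alpha>" by blast
  from someI_ex[OF this] show *: "vs.independent (basis \<alpha>)" "vs.span (basis \<alpha>) = V \<alpha>"
    by (auto simp: basis_of_def)
  show sub: "basis \<alpha> \<subseteq> V \<alpha>" using * vs.span_superset by metis
  show "finite (basis \<alpha>)"
    using vs.independent_span_bound[OF F(1) *(1)] sub F by auto
  show "basis \<alpha> = {} \<longleftrightarrow> V \<alpha> = {0}"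
  proof
    assume V0: "V \<alpha> = {0}"
    have "basis \<alpha> = {} \<or> basis \<alpha> = {0}" using sub unfolding V0 by (rule subset_singletonD)
    then show "basis \<alpha> = {}" using *(1) vs.dependent_zero[of "basis \<alpha>"] by auto
  qed (use *(2) in simp)
qed

lemma coeff_dual:
  assumes "\<alpha> \<in> Arr G"
  shows "coeff \<alpha> e \<in> dual sc (V \<alpha>)"
proof -
  have "v \<notin> V \<alpha> \<Longrightarrow> vs.representation (basis \<alpha>) v e = 0" for v
    using basis_props(2)[OF assms] by (simp add: vs.representation_def)
  then show ?thesis
    using basis_props(1,2)[OF assms]
    by (auto simp: coeff_def dual_def lin_maps_def vs.representation_add vs.representation_scale)
qed

lemma coeff_basis:
  "\<alpha> \<in> Arr G \<Longrightarrow> e' \<in> basis \<alpha> \<Longrightarrow> coeff \<alpha> e e' = (if e = e' then 1 else 0)"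
  using basis_props[of \<alpha>] by (simp add: coeff_def vs.representation_basis)

lemma dual_expand:
  assumes "\<alpha> \<in> Arr G" "\<phi> \<in> dual sc (V \<alpha>)" "v \<in> V \<alpha>"
  shows "\<phi> v = (\<Sum>e\<in>basis \<alpha>. coeff \<alpha> e v * \<phi> e)"
proof -
  note b = basis_props[OF assms(1)]
  have "\<phi> (\<Sum>e\<in>F. sc (c e) e) = (\<Sum>e\<in>F. c e * \<phi> e) \<and> (\<Sum>e\<in>F. sc (c e) e) \<in> V \<alpha>"
    if "finite F" "F \<subseteq> basis \<alpha>" for F c
    using that
  proof (induction F)
    case empty
    have "\<phi> (sc 0 v) = 0 * \<phi> v"
      using assms(2,3) unfolding dual_def lin_maps_def by blast
    moreover have "0 \<in> V \<alpha>" using b(2) vs.span_zero by metis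
    ultimately show ?case by simp
  next
    case (insert e F)
    then have "e \<in> V \<alpha>" using b by auto
    then have "sc (c e) e \<in> V \<alpha>" using b(2) vs.span_scale by metis
    moreover have "sc (c e) e + (\<Sum>e\<in>F. sc (c e) e) \<in> V \<alpha>"
      using calculation insert vs.span_add[of "sc (c e) e" "basis \<alpha>" "\<Sum>e\<in>F. sc (c e) e"] b(2) by auto
    ultimately show ?case
      using insert assms(2) \<open>e \<in> V \<alpha>\<close> by (auto simp: dual_def lin_maps_def)
  qed
  from this[of "basis \<alpha>" "vs.representation (basis \<alpha>) v"]
  show ?thesis
    using b assms(3) vs.sum_representation_eq[of "basis \<alpha>" v "basis \<alpha>"] by (auto simp: coeff_def)
qed

lemma pt_Nil [simp]: "pt [] \<psi>s = (if \<psi>s = [] then 1 else 0)"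
  by (simp add: pure_tensor_def)

lemma pt_Cons_Nil [simp]: "pt (x # xs) [] = 0"
  by (simp add: pure_tensor_def)

lemma pt_Cons [simp]:
  "pt (x # xs) (\<psi> # \<psi>s) =
    (if fst \<psi> = fst x \<and> snd \<psi> \<in> dual sc (V (fst x)) then snd \<psi> (snd x) * pt xs \<psi>s else 0)"
proof -
  have all: "(\<forall>i<Suc n. P i) \<longleftrightarrow> P 0 \<and> (\<forall>i<n. P (Suc i))" for n and P :: "nat \<Rightarrow> bool"
    by (metis less_Suc_eq_0_disj)
  have "(\<Prod>i<length (x # xs). snd ((\<psi> # \<psi>s) ! i) (snd ((x # xs) ! i)))
      = snd \<psi> (snd x) * (\<Prod>i<length xs. snd (\<psi>s ! i) (snd (xs ! i)))"
    by (simp add: prod.lessThan_Suc_shift del: prod.lessThan_Suc)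
  moreover have "(\<forall>i<length (x # xs). fst ((\<psi> # \<psi>s) ! i) = fst ((x # xs) ! i)
        \<and> snd ((\<psi> # \<psi>s) ! i) \<in> dual sc (V (fst ((x # xs) ! i))))
      \<longleftrightarrow> fst \<psi> = fst x \<and> snd \<psi> \<in> dual sc (V (fst x)) \<and> (\<forall>i<length xs. fst (\<psi>s ! i) = fst (xs ! i)
        \<and> snd (\<psi>s ! i) \<in> dual sc (V (fst (xs ! i))))"
    by (simp add: all)
  ultimately show ?thesis unfolding pure_tensor_def by (simp only:) auto
qed

lemma pt_append:
  "length \<psi>s = length xs \<Longrightarrow> pt (xs @ ys) (\<psi>s @ \<chi>s) = pt xs \<psi>s * pt ys \<chi>s"
  by (induction \<psi>s xs rule: list_induct2) auto

lemma pt_nonzero: "pt xs \<psi>s \<noteq> 0 \<Longrightarrow> map fst \<psi>s = map fst xs"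
proof (induction xs arbitrary: \<psi>s)
  case (Cons x xs)
  then show ?case by (cases \<psi>s) (auto split: if_splits)
qed (auto split: if_splits)

lemma pt_dual_list:
  assumes "set l \<subseteq> basis_arrows" "set l' \<subseteq> basis_arrows"
  shows "pt l (dual_list l') = (if l = l' then 1 else 0)"
  using assms
proof (induction l arbitrary: l')
  case (Cons x l)
  then show ?case
    by (cases l') (auto simp: basis_arrows_def coeff_dual coeff_basis split: if_splits)
qed (auto simp: dual_list_def)

text \<open>Multilinearity: each factor is expanded in its basis, and the coefficients are the values of the
  pure tensor on the dual basis.\<close>

lemma pt_expand:
  assumes "\<forall>(\<alpha>, v)\<in>set xs. \<alpha> \<in> Arr G \<and> v \<in> V \<alpha>"
  shows "finite {l. map fst l = map fst xs \<and> set l \<subseteq> basis_arrows} \<and>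
    pt xs \<psi>s = (\<Sum>l | map fst l = map fst xs \<and> set l \<subseteq> basis_arrows. pt xs (dual_list l) * pt l \<psi>s)"
  using assms
proof (induction xs arbitrary: \<psi>s)
  case Nil
  have "{l :: ('a \<times> 'v) list. map fst l = [] \<and> set l \<subseteq> basis_arrows} = {[]}" by auto
  then show ?case by simp
next
  case (Cons x xs)
  obtain \<alpha> v where x: "x = (\<alpha>, v)" "\<alpha> \<in> Arr G" "v \<in> V \<alpha>" using Cons.prems by (cases x) auto
  let ?L = "\<lambda>xs :: ('a \<times> 'v) list. {l. map fst l = map fst xs \<and> set l \<subseteq> basis_arrows}"
  let ?h = "\<lambda>(e, l). (\<alpha>, e) # l"
  have L: "?L (x # xs) = ?h ` (basis \<alpha> \<times> ?L xs)"
    using x by (auto simp: basis_arrows_def image_iff map_eq_Cons_conv)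
  have inj: "inj_on ?h (basis \<alpha> \<times> ?L xs)" by (auto simp: inj_on_def)
  have prems: "\<forall>(\<alpha>, v)\<in>set xs. \<alpha> \<in> Arr G \<and> v \<in> V \<alpha>" using Cons.prems by simp
  have fin: "finite (?L xs)" using Cons.IH[OF prems] by blast
  have IH: "pt xs \<chi>s = (\<Sum>l\<in>?L xs. pt xs (dual_list l) * pt l \<chi>s)" for \<chi>s
    using Cons.IH[OF prems] by blast
  have "pt (x # xs) \<psi>s = (\<Sum>l\<in>?L (x # xs). pt (x # xs) (dual_list l) * pt l \<psi>s)"
  proof (cases \<psi>s)
    case Nil
    then show ?thesis by (auto intro!: sum.neutral simp: map_eq_Cons_conv)
  next
    case (Cons \<psi> \<chi>s)
    have "(\<Sum>l\<in>?L (x # xs). pt (x # xs) (dual_list l) * pt l \<psi>s)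
      = (\<Sum>e\<in>basis \<alpha>. \<Sum>l\<in>?L xs. pt (x # xs) (dual_list ((\<alpha>, e) # l)) * pt ((\<alpha>, e) # l) \<psi>s)"
      unfolding L by (subst sum.reindex[OF inj]) (simp add: sum.cartesian_product split_def)
    also have "\<dots> = (if fst \<psi> = \<alpha> \<and> snd \<psi> \<in> dual sc (V \<alpha>) then
        (\<Sum>e\<in>basis \<alpha>. coeff \<alpha> e v * snd \<psi> e) * (\<Sum>l\<in>?L xs. pt xs (dual_list l) * pt l \<chi>s) else 0)"
      using x Cons by (auto simp: coeff_dual sum_product mult_ac intro!: sum.cong)
    also have "\<dots> = pt (x # xs) \<psi>s"
      using x Cons by (auto simp: dual_expand[symmetric] IH[symmetric])
    finally show ?thesis by simp
  qed
  then show ?case using L fin basis_props(3)[OF x(2)] by simp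
qed

lemma is_path_Arr: "is_path G as \<Longrightarrow> set as \<subseteq> Arr G"
  by (induction as rule: is_path.induct) auto

text \<open>By finite type each endpoint has only finitely many continuations by an arrow with nonzero space,
  and each such space has a finite basis.\<close>

lemma finite_basis_paths_from:
  assumes "a \<in> Ob G"
  shows "finite {l. length l = n \<and> set l \<subseteq> basis_arrows \<and> is_path G (map fst l) \<and> src G (fst (hd l)) = a}"
  using assms
proof (induction n arbitrary: a)
  case (Suc n)
  let ?P = "\<lambda>n a. {l. length l = n \<and> set l \<subseteq> basis_arrows \<and> is_path G (map fst l) \<and> src G (fst (hd l)) = a}"
  let ?A = "Sigma {\<alpha> \<in> Arr G. (src G \<alpha> = a \<or> tgt G \<alpha> = a) \<and> V \<alpha> \<noteq> {0}} basis"
  have fin: "finite ?A"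
    using finite_type Suc.prems basis_props(3) by (auto simp: graded_finite_type_def)
  have "?P (Suc n) a \<subseteq> (\<lambda>x. [x]) ` ?A \<union> (\<Union>x\<in>?A. (#) x ` ?P n (tgt G (fst x)))"
  proof
    fix l assume l: "l \<in> ?P (Suc n) a"
    then obtain \<alpha> e l' where x: "l = (\<alpha>, e) # l'" by (cases l) auto
    then have "\<alpha> \<in> Arr G" "e \<in> basis \<alpha>" "src G \<alpha> = a"
      using l by (auto simp: basis_arrows_def)
    then have xA: "(\<alpha>, e) \<in> ?A" using basis_props(5) by auto
    show "l \<in> (\<lambda>x. [x]) ` ?A \<union> (\<Union>x\<in>?A. (#) x ` ?P n (tgt G (fst x)))"
    proof (cases "l' = []")
      case True
      then show ?thesis using x xA by blast
    next
      case False
      then have "l' \<in> ?P n (tgt G \<alpha>)" using l x by (simp add: is_path_Cons hd_map)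
      then show ?thesis using x xA by force
    qed
  qed
  moreover have "finite (?P n (tgt G (fst x)))" if "x \<in> ?A" for x
    using that by (intro Suc.IH) (auto simp: tgt_Ob)
  ultimately show ?case
    using fin by (elim finite_subset) auto
qed (simp add: conj_commute)

lemma finite_basis_paths [simp]: "finite (basis_paths n \<gamma>)"
proof (cases "\<gamma> \<in> Arr G")
  case True
  have "src G (fst (hd l)) = src G \<gamma>" if "l \<in> basis_paths n \<gamma>" for l
    using that path_cmp_Arr(2)[of "map fst l"] by (cases l) (auto simp: basis_paths_def)
  then show ?thesis
    by (intro finite_subset[OF _ finite_basis_paths_from[OF src_Ob[OF True], of n]])
      (auto simp: basis_paths_def)
next
  case False
  then have "basis_paths n \<gamma> = {}" using path_cmp_Arr(1) by (auto simp: basis_paths_def)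
  then show ?thesis by simp
qed

lemma pt_in_TP:
  assumes "l \<in> basis_paths n \<gamma>"
  shows "pt l \<in> TP n \<gamma>"
proof -
  have "\<forall>(\<alpha>, v)\<in>set l. v \<in> V \<alpha>"
    using assms basis_props(4) unfolding basis_paths_def basis_arrows_def by blast
  then show ?thesis
    using assms unfolding tensor_power_def by (intro tv.span_base) (auto simp: basis_paths_def)
qed

lemma TP_subspace: "tv.subspace (TP n \<gamma>)"
  unfolding tensor_power_def by simp

lemma TP_zero [simp]: "0 \<in> TP n \<gamma>"
  and TP_add: "t \<in> TP n \<gamma> \<Longrightarrow> u \<in> TP n \<gamma> \<Longrightarrow> t + u \<in> TP n \<gamma>"
  and TP_scale: "t \<in> TP n \<gamma> \<Longrightarrow> tscale c t \<in> TP n \<gamma>"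
  and TP_sum: "(\<And>i. i \<in> I \<Longrightarrow> g i \<in> TP n \<gamma>) \<Longrightarrow> sum g I \<in> TP n \<gamma>"
  using TP_subspace tv.subspace_0 tv.subspace_add tv.subspace_scale tv.subspace_sum by blast+

lemma of_coord_TP: "of_coord n \<gamma> f \<in> TP n \<gamma>"
  unfolding of_coord_def by (intro TP_sum TP_scale pt_in_TP)

lemma coord_of_coord: "coord (of_coord n \<gamma> f) l = (if l \<in> basis_paths n \<gamma> then f l else 0)"
proof (cases "set l \<subseteq> basis_arrows")
  case True
  have "coord (of_coord n \<gamma> f) l = (\<Sum>l'\<in>basis_paths n \<gamma>. if l' = l then f l else 0)"
    using True by (auto simp: coord_def of_coord_apply basis_paths_def pt_dual_list intro!: sum.cong)
  then show ?thesis by simp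
qed (auto simp: coord_def basis_paths_def)

lemma coord_outside: "t \<in> TP n \<gamma> \<Longrightarrow> l \<notin> basis_paths n \<gamma> \<Longrightarrow> coord t l = 0"
  using tensor_power_support[of t G sc V n \<gamma> "dual_list l"]
  by (auto simp: coord_def basis_paths_def)

lemma coord_linear [simp]:
  "coord (t + u) = coord t + coord u" "coord (tscale c t) = (\<lambda>l. c * coord t l)" "coord 0 = 0"
  by (auto simp: coord_def tscale_def fun_eq_iff)

lemma coord_sum: "coord (\<Sum>i\<in>I. g i) l = (\<Sum>i\<in>I. coord (g i) l)"
  by (simp add: coord_def sum_fun_apply)

text \<open>By linearity it suffices to consider pure tensors, where this is \<open>pt_expand\<close>; the coordinates of
  a pure tensor vanish off the path of its own arrows.\<close>

theorem of_coord_coord: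
  assumes "t \<in> TP n \<gamma>"
  shows "of_coord n \<gamma> (coord t) = t"
  using assms unfolding tensor_power_def
proof (induction rule: tv.span_induct_alt)
  case base
  show ?case by (auto simp: of_coord_apply coord_def fun_eq_iff)
next
  case (step c p t)
  then obtain xs where xs: "p = pt xs" "length xs = n" "is_path G (map fst xs)"
    "path_cmp G (map fst xs) = \<gamma>" "\<forall>(\<alpha>, v)\<in>set xs. v \<in> V \<alpha>" by auto
  let ?L = "{l. map fst l = map fst xs \<and> set l \<subseteq> basis_arrows}"
  have ex: "\<forall>(\<alpha>, v)\<in>set xs. \<alpha> \<in> Arr G \<and> v \<in> V \<alpha>"
    using xs is_path_Arr[of "map fst xs"] by force
  have sub: "?L \<subseteq> basis_paths n \<gamma>"
    using xs by (auto simp: basis_paths_def) (metis length_map)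
  have zero: "coord (pt xs) l = 0" if "l \<in> basis_paths n \<gamma> - ?L" for l
    using that pt_nonzero[of xs "dual_list l"] by (auto simp: coord_def basis_paths_def)
  have "of_coord n \<gamma> (coord p) = p"
  proof
    fix \<psi>s
    have "of_coord n \<gamma> (coord p) \<psi>s = (\<Sum>l\<in>?L. coord (pt xs) l * pt l \<psi>s)"
      unfolding of_coord_apply xs(1) by (rule sum.mono_neutral_right) (use sub zero in auto)
    also have "\<dots> = p \<psi>s"
      using pt_expand[OF ex, of \<psi>s] xs by (simp add: coord_def)
    finally show "of_coord n \<gamma> (coord p) \<psi>s = p \<psi>s" .
  qed
  moreover have "of_coord n \<gamma> (coord (tscale c p + t)) = tscale c (of_coord n \<gamma> (coord p)) + of_coord n \<gamma> (coord t)"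
    unfolding coord_linear
    by (auto simp: fun_eq_iff of_coord_apply tscale_def algebra_simps sum.distrib sum_distrib_left)
  ultimately have "of_coord n \<gamma> (coord (tscale c p + t)) = tscale c p + t"
    using step by simp
  then show ?case by (simp add: plus_fun_def)
qed

lemma tensor_eqI:
  assumes "t \<in> TP n \<gamma>" "u \<in> TP n \<gamma>" "\<And>l. l \<in> basis_paths n \<gamma> \<Longrightarrow> coord t l = coord u l"
  shows "t = u"
proof -
  have "of_coord n \<gamma> (coord t) = of_coord n \<gamma> (coord u)"
    unfolding of_coord_def using assms(3) by (intro sum.cong) auto
  then show ?thesis using assms of_coord_coord by metis
qed

lemma coord_pt: "l \<in> basis_paths n \<gamma> \<Longrightarrow> coord (pt l) = (\<lambda>l'. if l' = l then 1 else 0)"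
  by (auto simp: coord_def basis_paths_def pt_dual_list fun_eq_iff)

end


section \<open>Operators acting on two neighbouring factors\<close>

context graded_space
begin

lemma basis_paths_length: "l \<in> basis_paths n \<gamma> \<Longrightarrow> length l = n"
  by (simp add: basis_paths_def)

lemma basis_paths_Arr: "l \<in> basis_paths n \<gamma> \<Longrightarrow> \<gamma> \<in> Arr G"
  using path_cmp_Arr(1) by (auto simp: basis_paths_def)

lemma basis_paths_cmp: "l \<in> basis_paths n \<gamma> \<Longrightarrow> path_cmp G (map fst l) = \<gamma>"
  by (simp add: basis_paths_def)

lemma basis_paths_infix:
  assumes "xs @ ys @ zs \<in> basis_paths n \<gamma>" "length ys = k" "0 < k"
  shows "ys \<in> basis_paths k (path_cmp G (map fst ys))"
  using assms is_path_infix[of "map fst xs" "map fst ys" "map fst zs"]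
  by (auto simp: basis_paths_def)

lemma basis_paths_replace:
  assumes "xs @ ys @ zs \<in> basis_paths n \<gamma>" "ys' \<in> basis_paths k (path_cmp G (map fst ys))"
    "length ys = k" "0 < k"
  shows "xs @ ys' @ zs \<in> basis_paths n \<gamma>"
  using assms is_path_replace[of "map fst xs" "map fst ys" "map fst zs" "map fst ys'"]
  by (auto simp: basis_paths_def)

lemma basis_paths_split:
  assumes "l \<in> basis_paths n \<gamma>" "i + k \<le> n"
  obtains xs ys zs where "l = xs @ ys @ zs" "length xs = i" "length ys = k"
proof
  show "l = take i l @ take k (drop i l) @ drop (i + k) l"
    by (metis append_take_drop_id add.commute drop_drop)
qed (use assms in \<open>auto simp: basis_paths_def\<close>)

lemma TP_disjoint:
  assumes "t \<in> TP n \<beta>" "t \<in> TP n \<beta>'" "\<beta> \<noteq> \<beta>'"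
  shows "t = 0"
proof
  fix \<psi>s show "t \<psi>s = 0 \<psi>s"
    using tensor_power_support[OF assms(1), of \<psi>s] tensor_power_support[OF assms(2), of \<psi>s] assms(3)
    by (auto simp: zero_fun_def)
qed

lemma lin_mapsD:
  assumes "F \<in> lin_maps tscale tscale A B"
  shows "u \<in> A \<Longrightarrow> F u \<in> B" "u \<in> A \<Longrightarrow> v \<in> A \<Longrightarrow> F (u + v) = F u + F v"
    "u \<in> A \<Longrightarrow> F (tscale c u) = tscale c (F u)" "u \<notin> A \<Longrightarrow> F u = 0"
  using assms unfolding lin_maps_def by blast+

lemma lin_maps_0:
  fixes F :: "('a, 'v) tensor \<Rightarrow> ('a, 'v) tensor"
  assumes "F \<in> lin_maps tscale tscale (TP n \<beta>) B"
  shows "F 0 = 0"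
proof -
  have "F (tscale 0 0) = tscale 0 (F 0)" using assms by (rule lin_mapsD(3)) simp
  then show ?thesis by simp
qed

text \<open>Different homogeneous components of a tensor power meet only in \<open>0\<close>, and maps are extended by
  zero outside their domain. Hence the component of an operator in degree \<open>\<beta>\<close> can be applied to
  any homogeneous tensor, and remains linear there.\<close>

lemma lin_maps_other_degree:
  fixes F :: "('a, 'v) tensor \<Rightarrow> ('a, 'v) tensor"
  assumes "F \<in> lin_maps tscale tscale (TP n \<beta>) B" "u \<in> TP n \<beta>'" "\<beta>' \<noteq> \<beta>"
  shows "F u = 0"
proof (cases "u \<in> TP n \<beta>")
  case True
  then show ?thesis using lin_maps_0[OF assms(1)] TP_disjoint[OF assms(2) True assms(3)] by simp
qed (rule lin_mapsD(4)[OF assms(1)])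

lemma lin_maps_linear:
  fixes F :: "('a, 'v) tensor \<Rightarrow> ('a, 'v) tensor"
  assumes "F \<in> lin_maps tscale tscale (TP n \<beta>) B" "u \<in> TP n \<beta>'" "v \<in> TP n \<beta>'"
  shows "F (u + v) = F u + F v" "F (tscale c u) = tscale c (F u)"
proof -
  have "F (u + v) = F u + F v \<and> F (tscale c u) = tscale c (F u)"
  proof (cases "\<beta>' = \<beta>")
    case True
    then show ?thesis using lin_mapsD(2,3)[OF assms(1)] assms(2,3) by blast
  next
    case False
    note 0 = lin_maps_other_degree[OF assms(1) _ False]
    show ?thesis using assms(2,3)
      by (simp only: 0 TP_add TP_scale add_0_left tv.scale_zero_right)
  qed
  then show "F (u + v) = F u + F v" "F (tscale c u) = tscale c (F u)" by auto
qed

lemma lin_maps_sum: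
  fixes F :: "('a, 'v) tensor \<Rightarrow> ('a, 'v) tensor"
  assumes "F \<in> lin_maps tscale tscale (TP n \<beta>) B" "\<And>i. i \<in> I \<Longrightarrow> u i \<in> TP n \<beta>'"
  shows "F (\<Sum>i\<in>I. tscale (c i) (u i)) = (\<Sum>i\<in>I. tscale (c i) (F (u i)))"
  using assms(2)
proof (induction I rule: infinite_finite_induct)
  case (insert i I)
  have S: "(\<Sum>i\<in>I. tscale (c i) (u i)) \<in> TP n \<beta>'" and u: "u i \<in> TP n \<beta>'" "tscale (c i) (u i) \<in> TP n \<beta>'"
    using insert by (auto intro: TP_sum TP_scale)
  have "F (tscale (c i) (u i) + (\<Sum>i\<in>I. tscale (c i) (u i)))
      = tscale (c i) (F (u i)) + (\<Sum>i\<in>I. tscale (c i) (F (u i)))"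
    unfolding lin_maps_linear(1)[OF assms(1) u(2) S] lin_maps_linear(2)[OF assms(1) u(1) u(1)]
    using insert by auto
  then show ?case unfolding sum.insert[OF insert.hyps] .
qed (use lin_maps_0[OF assms(1)] in auto)

lemma lin_maps_expand:
  fixes F :: "('a, 'v) tensor \<Rightarrow> ('a, 'v) tensor"
  assumes "F \<in> lin_maps tscale tscale (TP n \<beta>) B" "u \<in> TP n \<beta>'"
  shows "F u = (\<Sum>q\<in>basis_paths n \<beta>. tscale (coord u q) (F (pt q)))"
proof (cases "\<beta>' = \<beta>")
  case True
  then have "F u = F (\<Sum>q\<in>basis_paths n \<beta>. tscale (coord u q) (pt q))"
    using of_coord_coord assms(2) by (simp add: of_coord_def)
  then show ?thesis using lin_maps_sum[OF assms(1) pt_in_TP] by simp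
next
  case False
  have "tscale (coord u q) (F (pt q)) = 0" if "q \<in> basis_paths n \<beta>" for q
    using that False coord_outside[OF assms(2), of q] by (auto simp: basis_paths_def)
  then have "(\<Sum>q\<in>basis_paths n \<beta>. tscale (coord u q) (F (pt q))) = 0"
    by (intro sum.neutral ballI)
  then show ?thesis by (simp only: lin_maps_other_degree[OF assms False])
qed

lemma slice_expand:
  assumes "t \<in> TP n \<gamma>" "n = length xs + k + length zs"
  shows "(\<lambda>\<chi>s. t (xs @ \<chi>s @ zs)) = (\<Sum>l\<in>basis_paths n \<gamma>.
    tscale (coord t l * pt (take (length xs) l) xs * pt (drop (length xs + k) l) zs)
      (pt (take k (drop (length xs) l))))"
proof
  fix \<chi>s
  let ?i = "length xs"
  have "coord t l * pt l (xs @ \<chi>s @ zs)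
      = coord t l * pt (take ?i l) xs * pt (drop (?i + k) l) zs * pt (take k (drop ?i l)) \<chi>s"
    if l: "l \<in> basis_paths n \<gamma>" for l
  proof -
    obtain x y z where xyz: "l = x @ y @ z" "length x = ?i" "length y = k"
      using basis_paths_split[OF l, of ?i k] assms by auto
    have z: "length z = length zs" using xyz assms basis_paths_length[OF l] by simp
    show ?thesis
    proof (cases "length \<chi>s = k")
      case True
      then show ?thesis using xyz z by (simp add: pt_append)
    next
      case False
      then have "pt l (xs @ \<chi>s @ zs) = 0" "pt y \<chi>s = 0"
        using pt_nonzero[of l "xs @ \<chi>s @ zs"] pt_nonzero[of y \<chi>s] xyz z
        by (metis length_append length_map add_left_cancel add_right_cancel)+
      then show ?thesis using xyz by simp
    qed
  qed
  then have "of_coord n \<gamma> (coord t) (xs @ \<chi>s @ zs) = (\<Sum>l\<in>basis_paths n \<gamma>.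
    coord t l * pt (take ?i l) xs * pt (drop (?i + k) l) zs * pt (take k (drop ?i l)) \<chi>s)"
    unfolding of_coord_apply by (intro sum.cong refl)
  then show "t (xs @ \<chi>s @ zs) = (\<Sum>l\<in>basis_paths n \<gamma>.
    tscale (coord t l * pt (take (length xs) l) xs * pt (drop (length xs + k) l) zs)
      (pt (take k (drop (length xs) l)))) \<chi>s"
    using of_coord_coord[OF assms(1)] by (simp add: sum_fun_apply tscale_def)
qed

text \<open>The degree \<open>\<beta>\<close> depends on the fixed arguments only and not on the tensor, so that operators applied to
  slices are linear in the tensor.\<close>

lemma slice_TP:
  assumes "n = length xs + k + length zs" "0 < k"
  shows "\<exists>\<beta>. \<forall>t\<in>TP n \<gamma>. (\<lambda>\<chi>s. t (xs @ \<chi>s @ zs)) \<in> TP k \<beta>"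
proof -
  let ?i = "length xs"
  define P where "P l \<longleftrightarrow> l \<in> basis_paths n \<gamma> \<and> pt (take ?i l) xs \<noteq> 0 \<and> pt (drop (?i + k) l) zs \<noteq> 0" for l
  define m where "m l = take k (drop ?i l)" for l :: "('a \<times> 'v) list"
  \<comment> \<open>If no path fits the fixed arguments, all slices are zero and any degree will do.\<close>
  define \<beta> where "\<beta> = path_cmp G (map fst (m (SOME l. P l)))"
  have split: "l = take ?i l @ m l @ drop (?i + k) l" for l
    unfolding m_def by (metis append_take_drop_id add.commute drop_drop)
  have len: "length (m l) = k" if "P l" for l
    using that assms(1) by (auto simp: m_def P_def basis_paths_def)
  have arrows: "map fst l = map fst xs @ map fst (m l) @ map fst zs" if "P l" for l
    using that pt_nonzero[of "take ?i l" xs] pt_nonzero[of "drop (?i + k) l" zs]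
    by (subst split) (auto simp: P_def)
  have "m l \<in> basis_paths k \<beta>" if l: "P l" for l
  proof -
    let ?l = "SOME l. P l"
    have l': "P ?l" using l by (rule someI)
    have ne: "map fst (m ?l) \<noteq> []" "map fst (m l) \<noteq> []"
      using len[OF l] len[OF l'] assms(2) by auto
    have bp: "?l \<in> basis_paths n \<gamma>" "l \<in> basis_paths n \<gamma>" using l l' by (auto simp: P_def)
    have "path_cmp G (map fst (m l)) = \<beta>" unfolding \<beta>_def
      by (rule path_cmp_infix_unique[of "map fst xs" _ "map fst zs", OF _ _ ne])
        (use bp in \<open>simp_all add: basis_paths_def flip: arrows[OF l] arrows[OF l']\<close>)
    then show ?thesis
      using basis_paths_infix[of "take ?i l" "m l" "drop (?i + k) l" n \<gamma> k] l split[of l] len[OF l] assms(2)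
      by (auto simp: P_def)
  qed
  note m = this
  have "tscale (coord t l * pt (take ?i l) xs * pt (drop (?i + k) l) zs) (pt (m l)) \<in> TP k \<beta>"
    if "l \<in> basis_paths n \<gamma>" for l t
  proof (cases "P l")
    case False
    then have "coord t l * pt (take ?i l) xs * pt (drop (?i + k) l) zs = 0" using that by (auto simp: P_def)
    then show ?thesis by (simp only: tv.scale_zero_left TP_zero)
  qed (intro TP_scale pt_in_TP m)
  then have "(\<lambda>\<chi>s. t (xs @ \<chi>s @ zs)) \<in> TP k \<beta>" if "t \<in> TP n \<gamma>" for t
    unfolding slice_expand[OF that assms(1)] m_def by (intro TP_sum)
  then show ?thesis by blast
qed

definition local_op :: "('o \<Rightarrow> 'a \<Rightarrow> ('a, 'v) tensor \<Rightarrow> ('a, 'v) tensor) \<Rightarrow> bool" where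
  "local_op A \<longleftrightarrow> (\<forall>\<alpha>\<in>Arr G. A (src G \<alpha>) \<alpha> \<in> lin_maps tscale tscale (TP 2 \<alpha>) (TP 2 \<alpha>))"

text \<open>Meant for composable pairs \<open>p\<close> and \<open>q\<close> with the same composite, which is the degree in which \<open>A\<close> acts.\<close>

definition local_mat :: "('o \<Rightarrow> 'a \<Rightarrow> ('a, 'v) tensor \<Rightarrow> ('a, 'v) tensor)
    \<Rightarrow> ('a \<times> 'v) list \<Rightarrow> ('a \<times> 'v) list \<Rightarrow> complex" where
  "local_mat A p q = (let \<beta> = path_cmp G (map fst p) in coord (A (src G \<beta>) \<beta> (pt q)) p)"

definition pair_moves :: "('a \<times> 'v) list \<Rightarrow> ('a \<times> 'v) list set" where
  "pair_moves p = (if set p \<subseteq> basis_arrows \<and> is_path G (map fst p)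
     then basis_paths 2 (path_cmp G (map fst p)) else {})"

text \<open>The operator on functions that applies the matrix \<open>a\<close> to the entries number \<open>i\<close> and \<open>i + 1\<close>.
  The sum runs over the pairs with the same composite as the given pair; it is empty if that pair
  is not composable. It is defined for arbitrary functions on lists.\<close>

definition act :: "(('a \<times> 'v) list \<Rightarrow> ('a \<times> 'v) list \<Rightarrow> complex) \<Rightarrow> nat
    \<Rightarrow> (('a \<times> 'v) list \<Rightarrow> complex) \<Rightarrow> ('a \<times> 'v) list \<Rightarrow> complex" where
  "act a i f l = (if i + 1 < length l then
     \<Sum>q\<in>pair_moves (take 2 (drop i l)). a (take 2 (drop i l)) q * f (take i l @ q @ drop (i + 2) l)
   else 0)"

lemma take2_drop: "i + 1 < length xs \<Longrightarrow> take 2 (drop i xs) = [xs ! i, xs ! (i + 1)]"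
  by (simp add: numeral_2_eq_2 take_Suc_conv_app_nth)

lemma slot_op_eq:
  assumes "local_op A" "t \<in> TP n \<gamma>" "length \<psi>s = n" "i + 1 < n"
  shows "slot_op G sc V n A i \<gamma> t \<psi>s =
    (let p = take 2 (drop i \<psi>s); \<beta> = path_cmp G (map fst p) in
     if is_path G (map fst p)
     then A (src G \<beta>) \<beta> (\<lambda>\<chi>s. t (take i \<psi>s @ \<chi>s @ drop (i + 2) \<psi>s)) p else 0)"
  using assms path_cmp_Arr(2)[of "[fst (\<psi>s ! i), fst (\<psi>s ! (i + 1))]"]
  by (simp add: slot_op_def take2_drop Let_def)

lemma slot_op_outside: "t \<notin> TP n \<gamma> \<Longrightarrow> slot_op G sc V n A i \<gamma> t = 0"
  by (auto simp: slot_op_def fun_eq_iff)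

lemma slot_op_linear:
  assumes "local_op A" "i + 1 < n" "t \<in> TP n \<gamma>" "u \<in> TP n \<gamma>"
  shows "slot_op G sc V n A i \<gamma> (t + u) = slot_op G sc V n A i \<gamma> t + slot_op G sc V n A i \<gamma> u"
    "slot_op G sc V n A i \<gamma> (tscale c t) = tscale c (slot_op G sc V n A i \<gamma> t)"
proof -
  have "slot_op G sc V n A i \<gamma> (t + u) \<psi>s = (slot_op G sc V n A i \<gamma> t + slot_op G sc V n A i \<gamma> u) \<psi>s
    \<and> slot_op G sc V n A i \<gamma> (tscale c t) \<psi>s = tscale c (slot_op G sc V n A i \<gamma> t) \<psi>s" for \<psi>s
  proof (cases "length \<psi>s = n \<and> is_path G (map fst (take 2 (drop i \<psi>s)))")
    case True
    let ?s = "\<lambda>t \<chi>s. t (take i \<psi>s @ \<chi>s @ drop (i + 2) \<psi>s)"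
    define \<beta> where "\<beta> = path_cmp G (map fst (take 2 (drop i \<psi>s)))"
    have "\<beta> \<in> Arr G" using True path_cmp_Arr by (auto simp: \<beta>_def)
    then have A: "A (src G \<beta>) \<beta> \<in> lin_maps tscale tscale (TP 2 \<beta>) (TP 2 \<beta>)"
      using assms(1) by (auto simp: local_op_def)
    have "n = length (take i \<psi>s) + 2 + length (drop (i + 2) \<psi>s)" using True assms(2) by auto
    from slice_TP[OF this, of \<gamma>] obtain \<beta>' where \<beta>': "\<And>t. t \<in> TP n \<gamma> \<Longrightarrow> ?s t \<in> TP 2 \<beta>'"
      by auto
    have "?s (t + u) = ?s t + ?s u" "?s (tscale c t) = tscale c (?s t)"
      by (auto simp: tscale_def fun_eq_iff)
    then show ?thesis
      using lin_maps_linear[OF A \<beta>'[OF assms(3)] \<beta>'[OF assms(4)]] True assms TP_add TP_scale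
      by (auto simp: slot_op_eq Let_def tscale_def simp flip: \<beta>_def)
  next
    case False
    have 0: "slot_op G sc V n A i \<gamma> v \<psi>s = 0" if "v \<in> TP n \<gamma>" for v
    proof (cases "length \<psi>s = n")
      case True
      then show ?thesis using False slot_op_eq[OF assms(1) that True assms(2)] by (simp add: Let_def)
    qed (simp add: slot_op_def)
    have "slot_op G sc V n A i \<gamma> (t + u) \<psi>s = 0" "slot_op G sc V n A i \<gamma> (tscale c t) \<psi>s = 0"
      using assms(3,4) by (auto intro!: 0 TP_add TP_scale)
    then show ?thesis using assms(3,4) by (simp add: 0 tscale_def)
  qed
  then show "slot_op G sc V n A i \<gamma> (t + u) = slot_op G sc V n A i \<gamma> t + slot_op G sc V n A i \<gamma> u"
    "slot_op G sc V n A i \<gamma> (tscale c t) = tscale c (slot_op G sc V n A i \<gamma> t)"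
    by (auto simp only: fun_eq_iff)
qed

lemma pt_append_tensor_prod: "pt (xs @ ys) = tensor_prod (length xs) (pt xs) (pt ys)"
proof
  fix \<psi>s :: "('a \<times> ('v \<Rightarrow> complex)) list"
  show "pt (xs @ ys) \<psi>s = tensor_prod (length xs) (pt xs) (pt ys) \<psi>s"
  proof (cases "length xs \<le> length \<psi>s")
    case True
    then show ?thesis
      using pt_append[of "take (length xs) \<psi>s" xs ys "drop (length xs) \<psi>s"] by (simp add: tensor_prod_def)
  next
    case False
    then have "pt (xs @ ys) \<psi>s = 0" "pt xs \<psi>s = 0"
      using pt_nonzero[of "xs @ ys" \<psi>s] pt_nonzero[of xs \<psi>s]
      by (metis length_append length_map le_add1, metis length_map order_refl)
    then show ?thesis using False by (simp add: tensor_prod_def)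
  qed
qed

lemma pt_length: "length \<psi>s \<noteq> length xs \<Longrightarrow> pt xs \<psi>s = 0"
  using pt_nonzero map_eq_imp_length_eq by blast

text \<open>A pure tensor splits at the two active slots, so \<open>slot_op_tensor_prod\<close> applies.\<close>

lemma slot_op_pt:
  assumes "local_op A" "xs @ ys @ zs \<in> basis_paths n \<gamma>" "length ys = 2"
  defines "\<beta> \<equiv> path_cmp G (map fst ys)"
  shows "slot_op G sc V n A (length xs) \<gamma> (pt (xs @ ys @ zs))
    = (\<Sum>q\<in>basis_paths 2 \<beta>. tscale (coord (A (src G \<beta>) \<beta> (pt ys)) q) (pt (xs @ q @ zs)))"
proof -
  have ys: "ys \<in> basis_paths 2 \<beta>" unfolding \<beta>_def
    by (rule basis_paths_infix[OF assms(2,3)]) simp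
  then have \<beta>: "\<beta> \<in> Arr G" by (rule basis_paths_Arr)
  define u where "u = A (src G \<beta>) \<beta> (pt ys)"
  have u: "u \<in> TP 2 \<beta>"
    using assms(1) \<beta> ys pt_in_TP unfolding u_def local_op_def by (blast intro: lin_mapsD(1))
  have split: "pt (xs @ q @ zs) = tensor_prod (length xs) (pt xs) (tensor_prod 2 (pt q) (pt zs))"
    if "length q = 2" for q using that by (simp add: pt_append_tensor_prod)
  have "slot_op G sc V n A (length xs) \<gamma> (pt (xs @ ys @ zs))
    = tensor_prod (length xs) (pt xs) (tensor_prod 2 u (pt zs))"
    unfolding split[OF assms(3)] u_def
  proof (rule slot_op_tensor_prod[where m = "length zs"])
    show "pt ys \<in> TP 2 \<beta>" using ys by (rule pt_in_TP)
    show "tensor_prod (length xs) (pt xs) (tensor_prod 2 (pt ys) (pt zs)) \<in> TP n \<gamma>"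
      using pt_in_TP[OF assms(2)] split[OF assms(3)] by simp
    show "n = length xs + 2 + length zs" using assms by (auto simp: basis_paths_def)
    show "groupoid G" ..
  qed (use assms(1) \<beta> in \<open>auto simp: local_op_def pt_length\<close>)
  also have "\<dots> = (\<Sum>q\<in>basis_paths 2 \<beta>. tscale (coord u q) (pt (xs @ q @ zs)))"
    by (subst of_coord_coord[OF u, symmetric])
      (auto simp: tensor_prod_def of_coord_apply sum_fun_apply tscale_def split basis_paths_length
        sum_distrib_left sum_distrib_right mult_ac fun_eq_iff intro!: sum.cong)
  finally show ?thesis by (simp add: u_def)
qed

lemma slot_op_TP:
  assumes "local_op A" "i + 1 < n"
  shows "slot_op G sc V n A i \<gamma> t \<in> TP n \<gamma>"
proof (cases "t \<in> TP n \<gamma>")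
  case True
  let ?F = "slot_op G sc V n A i \<gamma>"
  have pt: "?F (pt l) \<in> TP n \<gamma>" if l: "l \<in> basis_paths n \<gamma>" for l
  proof -
    obtain xs ys zs where xyz: "l = xs @ ys @ zs" "length xs = i" "length ys = 2"
      using basis_paths_split[OF l, of i 2] assms(2) by auto
    note l' = l[unfolded xyz(1)]
    show ?thesis
      unfolding xyz(1) slot_op_pt[OF assms(1) l' xyz(3), unfolded xyz(2)]
      by (intro TP_sum TP_scale pt_in_TP basis_paths_replace[OF l' _ xyz(3)]) simp_all
  qed
  have "?F (\<Sum>l\<in>L. tscale (c l) (pt l)) \<in> TP n \<gamma> \<and> (\<Sum>l\<in>L. tscale (c l) (pt l)) \<in> TP n \<gamma>"
    if "finite L" "L \<subseteq> basis_paths n \<gamma>" for L c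
    using that
  proof (induction L)
    case empty
    have "?F (tscale 0 0) = tscale 0 (?F 0)" by (rule slot_op_linear(2)[OF assms TP_zero TP_zero])
    then show ?case unfolding sum.empty using TP_zero by (simp only: tv.scale_zero_left simp_thms)
  next
    case (insert l L)
    let ?S = "\<Sum>l\<in>L. tscale (c l) (pt l)"
    have S: "?F ?S \<in> TP n \<gamma>" "?S \<in> TP n \<gamma>" and l: "pt l \<in> TP n \<gamma>" "?F (pt l) \<in> TP n \<gamma>"
      using insert pt pt_in_TP by auto
    have "?F (tscale (c l) (pt l) + ?S) = tscale (c l) (?F (pt l)) + ?F ?S"
      unfolding slot_op_linear(1)[OF assms TP_scale[OF l(1)] S(2)]
      by (simp only: slot_op_linear(2)[OF assms l(1) l(1)])
    then show ?case
      unfolding sum.insert[OF insert.hyps] using S l by (simp only: TP_add TP_scale simp_thms)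
  qed
  from this[of "basis_paths n \<gamma>" "coord t"] show ?thesis
    using of_coord_coord[OF True] by (simp add: of_coord_def)
qed (simp add: slot_op_outside)

text \<open>The slice to which \<open>A\<close> is applied is homogeneous, but its degree may differ from the composite
  of the pair at which the result is evaluated. In that case both sides are zero: the left side by
  \<open>lin_maps_other_degree\<close>, the right side because the coordinates of \<open>t\<close> vanish on paths of the wrong
  composite.\<close>

theorem coord_slot_op:
  assumes A: "local_op A" and i: "i + 1 < n" and t: "t \<in> TP n \<gamma>"
  shows "coord (slot_op G sc V n A i \<gamma> t) = act (local_mat A) i (coord t)"
proof
  fix l :: "('a \<times> 'v) list"
  let ?p = "take 2 (drop i l)"
  let ?x = "take i l" and ?z = "drop (i + 2) l"
  consider "length l \<noteq> n" | "length l = n" "\<not> set l \<subseteq> basis_arrows"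
    | "length l = n" "set l \<subseteq> basis_arrows" "\<not> is_path G (map fst ?p)"
    | "length l = n" "set l \<subseteq> basis_arrows" "is_path G (map fst ?p)" by blast
  then show "coord (slot_op G sc V n A i \<gamma> t) l = act (local_mat A) i (coord t) l"
  proof cases
    case 1
    then have "coord (slot_op G sc V n A i \<gamma> t) l = 0"
      by (intro coord_outside[OF slot_op_TP[OF A i]]) (auto simp: basis_paths_def)
    moreover have "coord t (?x @ q @ ?z) = 0" if "q \<in> pair_moves ?p" "i + 1 < length l" for q
      using that 1 by (intro coord_outside[OF t]) (auto simp: basis_paths_def pair_moves_def split: if_splits)
    ultimately show ?thesis by (simp add: act_def)
  next
    case 2
    have l: "l = ?x @ ?p @ ?z"
      by (metis append_take_drop_id add.commute drop_drop)
    have "coord t (?x @ q @ ?z) = 0" if "q \<in> pair_moves ?p" for q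
    proof -
      have "set ?p \<subseteq> basis_arrows" using that by (auto simp: pair_moves_def split: if_splits)
      then have "\<not> set (?x @ q @ ?z) \<subseteq> basis_arrows" using 2(2) by (subst (asm) l) auto
      then show ?thesis unfolding coord_def by (simp only: if_False)
    qed
    then show ?thesis using 2 by (simp add: act_def coord_def)
  next
    case 3
    then have "slot_op G sc V n A i \<gamma> t (dual_list l) = 0"
      using slot_op_eq[OF A t, of "dual_list l" i] i
      by (simp add: dual_list_def take_map drop_map Let_def split_def comp_def)
    then show ?thesis using 3 by (simp add: act_def coord_def pair_moves_def)
  next
    case 4
    define \<beta> where "\<beta> = path_cmp G (map fst ?p)"
    let ?u = "\<lambda>\<chi>s. t (dual_list ?x @ \<chi>s @ dual_list ?z)"
    have p: "set ?p \<subseteq> basis_arrows" and xz: "set ?x \<subseteq> basis_arrows" "set ?z \<subseteq> basis_arrows"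
      using 4(2) by (auto dest: in_set_takeD in_set_dropD)
    have \<beta>: "\<beta> \<in> Arr G" using 4 path_cmp_Arr by (auto simp: \<beta>_def)
    have n: "n = length (dual_list ?x) + 2 + length (dual_list ?z)" using 4(1) i by simp
    obtain \<beta>' where u: "?u \<in> TP 2 \<beta>'"
      using slice_TP[OF n, of \<gamma>] t by auto
    have AL: "A (src G \<beta>) \<beta> \<in> lin_maps tscale tscale (TP 2 \<beta>) (TP 2 \<beta>)"
      using A \<beta> by (auto simp: local_op_def)
    have dl: "take k (dual_list m) = dual_list (take k m)" "drop k (dual_list m) = dual_list (drop k m)" for k m
      by (simp_all add: dual_list_def take_map drop_map)
    have "coord (slot_op G sc V n A i \<gamma> t) l = coord (A (src G \<beta>) \<beta> ?u) ?p"
      using slot_op_eq[OF A t, of "dual_list l" i] i 4 p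
      by (simp add: coord_def \<beta>_def Let_def dl)
    also have "\<dots> = (\<Sum>q\<in>basis_paths 2 \<beta>. local_mat A ?p q * coord ?u q)"
      by (subst lin_maps_expand[OF AL u]) (auto simp: coord_sum local_mat_def \<beta>_def Let_def intro!: sum.cong)
    also have "\<dots> = (\<Sum>q\<in>basis_paths 2 \<beta>. local_mat A ?p q * coord t (?x @ q @ ?z))"
      using xz by (intro sum.cong refl) (auto simp: coord_def basis_paths_def)
    also have "\<dots> = act (local_mat A) i (coord t) l"
      using 4 i p by (simp add: act_def pair_moves_def \<beta>_def)
    finally show ?thesis .
  qed
qed

end


section \<open>The Yang--Baxter equation\<close>

context graded_space
begin

lemma pair_moves_length: "q \<in> pair_moves p \<Longrightarrow> length q = 2"
  by (auto simp: pair_moves_def basis_paths_def split: if_splits)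

lemma pair_moves_sym:
  assumes "q \<in> pair_moves p"
  shows "pair_moves q = pair_moves p" "length p = 2 \<Longrightarrow> p \<in> pair_moves q"
  using assms by (auto simp: pair_moves_def basis_paths_def split: if_splits)

lemma pair_moves_replace:
  assumes "xs @ p @ zs \<in> basis_paths n \<gamma>" "q \<in> pair_moves p" "length p = 2"
  shows "xs @ q @ zs \<in> basis_paths n \<gamma>"
proof -
  have "q \<in> basis_paths 2 (path_cmp G (map fst p))"
    using assms(2) by (simp add: pair_moves_def split: if_splits)
  then show ?thesis by (rule basis_paths_replace[OF assms(1) _ assms(3)]) simp
qed

lemma finite_pair_moves [simp]: "finite (pair_moves p)"
  by (simp add: pair_moves_def)

lemma pair_moves_basis_paths: "p \<in> basis_paths 2 \<beta> \<Longrightarrow> pair_moves p = basis_paths 2 \<beta>"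
  by (auto simp: pair_moves_def basis_paths_def)

lemma act_short: "length l \<le> i + 1 \<Longrightarrow> act a i f l = 0"
  by (simp add: act_def)

lemma act_append:
  "length xs = i \<Longrightarrow> length p = 2 \<Longrightarrow>
    act a i f (xs @ p @ zs) = (\<Sum>q\<in>pair_moves p. a p q * f (xs @ q @ zs))"
  by (simp add: act_def)

lemma split_at_pair:
  assumes "i + 1 < length l"
  obtains xs p zs where "l = xs @ p @ zs" "length xs = i" "length p = 2"
proof
  show "l = take i l @ take 2 (drop i l) @ drop (i + 2) l"
    by (metis append_take_drop_id add.commute drop_drop)
qed (use assms in auto)

lemma act_cong:
  assumes "\<And>l'. length l' = length l \<Longrightarrow> f l' = g l'"
  shows "act a i f l = act a i g l"
  using assms by (auto simp: act_def pair_moves_length intro!: sum.cong)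

lemma act_linear:
  "act a i (\<lambda>l. f l + c * g l) = (\<lambda>l. act a i f l + c * act a i g l)"
  by (auto simp: act_def fun_eq_iff distrib_left sum.distrib sum_distrib_left mult_ac intro!: sum.cong)

lemma act_context:
  assumes "i + 1 < length ys"
  shows "act a (length xs + i) f (xs @ ys @ zs) = act a i (\<lambda>l. f (xs @ l @ zs)) ys"
  using assms by (simp add: act_def)

text \<open>The projection to the functions that are coordinates of tensors in degree \<open>\<gamma>\<close>. Relations
  that involve three neighbouring entries hold only along paths; they are stated for
  functions fixed by this projection.\<close>

definition on_paths :: "nat \<Rightarrow> 'a \<Rightarrow> (('a \<times> 'v) list \<Rightarrow> complex) \<Rightarrow> ('a \<times> 'v) list \<Rightarrow> complex" where
  "on_paths n \<gamma> f = (\<lambda>l. if l \<in> basis_paths n \<gamma> then f l else 0)"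

lemma coord_of_coord_on_paths: "coord (of_coord n \<gamma> f) = on_paths n \<gamma> f"
  by (auto simp: coord_of_coord on_paths_def)

lemma on_paths_coord: "t \<in> TP n \<gamma> \<Longrightarrow> on_paths n \<gamma> (coord t) = coord t"
  by (auto simp: on_paths_def coord_outside)

text \<open>Replacing a composable pair by another one with the same composite changes neither the path
  property nor the total composite, in either direction.\<close>

lemma act_on_paths: "act a i (on_paths n \<gamma> f) = on_paths n \<gamma> (act a i f)"
proof
  fix l
  show "act a i (on_paths n \<gamma> f) l = on_paths n \<gamma> (act a i f) l"
  proof (cases "i + 1 < length l")
    case True
    then obtain xs p zs where l: "l = xs @ p @ zs" "length xs = i" "length p = 2"
      by (rule split_at_pair)
    have "xs @ q @ zs \<in> basis_paths n \<gamma> \<longleftrightarrow> l \<in> basis_paths n \<gamma>" if q: "q \<in> pair_moves p" for q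
      unfolding l(1) using pair_moves_replace[OF _ q l(3)]
        pair_moves_replace[OF _ pair_moves_sym(2)[OF q l(3)] pair_moves_length[OF q]] by metis
    then show ?thesis
      unfolding l(1) act_append[OF l(2,3)] on_paths_def by (auto simp: l act_append intro!: sum.cong sum.neutral)
  qed (auto simp: act_short on_paths_def)
qed

text \<open>The two operators change disjoint pairs of entries.\<close>

lemma act_commute:
  assumes "i + 1 < j"
  shows "act a i (act b j f) = act b j (act a i f)"
proof
  fix l
  show "act a i (act b j f) l = act b j (act a i f) l"
  proof (cases "j + 1 < length l")
    case True
    then obtain w q zs where l: "l = w @ q @ zs" "length w = j" "length q = 2"
      by (rule split_at_pair)
    have "i + 1 < length w" using assms l by simp
    then obtain xs p ys where w: "w = xs @ p @ ys" "length xs = i" "length p = 2"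
      by (rule split_at_pair)
    have j: "length (xs @ p' @ ys) = j" if "p' \<in> pair_moves p" for p'
      using w l pair_moves_length[OF that] by simp
    have "act a i (act b j f) l = (\<Sum>p'\<in>pair_moves p. a p p' * act b j f ((xs @ p' @ ys) @ q @ zs))"
      using w l by (simp add: act_append)
    also have "\<dots> = (\<Sum>p'\<in>pair_moves p. \<Sum>q'\<in>pair_moves q. a p p' * (b q q' * f (xs @ p' @ ys @ q' @ zs)))"
      using l(3) by (intro sum.cong refl, subst act_append[OF j]) (auto simp: sum_distrib_left)
    also have "\<dots> = (\<Sum>q'\<in>pair_moves q. \<Sum>p'\<in>pair_moves p. b q q' * (a p p' * f (xs @ p' @ ys @ q' @ zs)))"
      by (subst sum.swap) (simp add: mult_ac)
    also have "\<dots> = (\<Sum>q'\<in>pair_moves q. b q q' * act a i f (w @ q' @ zs))"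
      using w by (simp add: act_append sum_distrib_left)
    also have "\<dots> = act b j (act a i f) l"
      using l by (simp add: act_append)
    finally show ?thesis .
  next
    case False
    then have "act a i (act b j f) l = act a i (\<lambda>l. 0) l"
      by (intro act_cong) (simp add: act_short)
    then show ?thesis using False by (simp add: act_short) (simp add: act_def)
  qed
qed

text \<open>The Baxterized operator \<open>id + x A\<close> in slots \<open>i\<close> and \<open>i + 1\<close>.\<close>

definition bax :: "(('a \<times> 'v) list \<Rightarrow> ('a \<times> 'v) list \<Rightarrow> complex) \<Rightarrow> complex \<Rightarrow> nat
    \<Rightarrow> (('a \<times> 'v) list \<Rightarrow> complex) \<Rightarrow> ('a \<times> 'v) list \<Rightarrow> complex" where
  "bax a x i f = (\<lambda>l. f l + x * act a i f l)"

lemma bax_0 [simp]: "bax a 0 i f = f"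
  by (simp add: bax_def)

lemma bax_on_paths: "bax a x i (on_paths n \<gamma> f) = on_paths n \<gamma> (bax a x i f)"
  unfolding bax_def act_on_paths by (auto simp: on_paths_def)

lemma bax_linear: "bax a x i (\<lambda>l. f l + c * g l) = (\<lambda>l. bax a x i f l + c * bax a x i g l)"
  by (auto simp: bax_def act_linear algebra_simps)

lemma bax_commute: "i + 1 < j \<Longrightarrow> bax a x i (bax a y j f) = bax a y j (bax a x i f)"
  using act_commute[of i j a a f] by (simp add: bax_def act_linear algebra_simps)

lemma R_check_local_op:
  assumes "local_op T"
  shows "local_op (R_check G sc V T x)"
  unfolding local_op_def
proof
  fix \<alpha> assume "\<alpha> \<in> Arr G"
  then have T: "T (src G \<alpha>) \<alpha> \<in> lin_maps tscale tscale (TP 2 \<alpha>) (TP 2 \<alpha>)"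
    using assms by (auto simp: local_op_def)
  show "R_check G sc V T x (src G \<alpha>) \<alpha> \<in> lin_maps tscale tscale (TP 2 \<alpha>) (TP 2 \<alpha>)"
    unfolding lin_maps_def
    using lin_mapsD(1-3)[OF T] TP_add TP_scale
    by (auto simp: R_check_def tv.scale_right_distrib tv.scale_scale mult.commute tv.scale_left_commute)
qed

lemma act_R_check:
  assumes "local_op T" "i + 1 < n"
  shows "act (local_mat (R_check G sc V T x)) i (on_paths n \<gamma> f) = bax (local_mat T) x i (on_paths n \<gamma> f)"
proof
  fix l
  show "act (local_mat (R_check G sc V T x)) i (on_paths n \<gamma> f) l = bax (local_mat T) x i (on_paths n \<gamma> f) l"
  proof (cases "l \<in> basis_paths n \<gamma>")
    case True
    with assms(2) obtain xs p zs where l: "l = xs @ p @ zs" "length xs = i" "length p = 2"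
      using basis_paths_split[OF True, of i 2] by auto
    define \<beta> where "\<beta> = path_cmp G (map fst p)"
    have p: "p \<in> basis_paths 2 \<beta>" unfolding \<beta>_def
      using True l by (intro basis_paths_infix) auto
    have mat: "local_mat (R_check G sc V T x) p q = (if q = p then 1 else 0) + x * local_mat T p q"
      if q: "q \<in> basis_paths 2 \<beta>" for q
      using pt_in_TP[OF q]
      by (auto simp: local_mat_def Let_def R_check_def coord_pt[OF q] simp flip: \<beta>_def)
    let ?f = "on_paths n \<gamma> f"
    have "(\<Sum>q\<in>basis_paths 2 \<beta>. local_mat (R_check G sc V T x) p q * ?f (xs @ q @ zs))
      = (\<Sum>q\<in>basis_paths 2 \<beta>. (if q = p then ?f (xs @ p @ zs) else 0)
          + x * (local_mat T p q * ?f (xs @ q @ zs)))"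
      by (intro sum.cong refl) (auto simp: mat algebra_simps)
    also have "\<dots> = ?f (xs @ p @ zs) + x * (\<Sum>q\<in>basis_paths 2 \<beta>. local_mat T p q * ?f (xs @ q @ zs))"
      using p by (simp add: sum.distrib sum_distrib_left)
    finally show ?thesis
      using l by (simp add: act_append bax_def pair_moves_basis_paths[OF p])
  next
    case False
    then show ?thesis by (simp add: act_on_paths bax_on_paths) (simp add: on_paths_def)
  qed
qed

end

text \<open>The loop weight is a constant \<open>k\<close>; Baxterizable operators are of this kind by
  \<open>baxterizable_constant\<close> below.\<close>

locale tl_space = graded_space +
  fixes T :: "'a \<Rightarrow> 'b \<Rightarrow> ('b, 'c) tensor \<Rightarrow> ('b, 'c) tensor" and k :: complex
  assumes TL: "local_dyn_TL G sc V (\<lambda>_. k) T"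
begin

abbreviation "t \<equiv> local_mat T"

lemma local_op_T: "local_op T"
  using TL src_Ob by (auto simp: local_dyn_TL_def local_op_def)

lemma act_square: "act t i (act t i f) = (\<lambda>l. k * act t i f l)"
proof
  fix l
  show "act t i (act t i f) l = k * act t i f l"
  proof (cases "i + 1 < length l")
    case True
    then obtain xs p zs where l: "l = xs @ p @ zs" "length xs = i" "length p = 2"
      by (rule split_at_pair)
    have mat: "(\<Sum>q\<in>pair_moves p. t p q * t q r) = k * t p r" if r: "r \<in> pair_moves p" for r
    proof -
      define \<beta> where "\<beta> = path_cmp G (map fst p)"
      have p: "pair_moves p = basis_paths 2 \<beta>" "r \<in> basis_paths 2 \<beta>"
        using r by (auto simp: pair_moves_def \<beta>_def split: if_splits)
      then have \<beta>: "\<beta> \<in> Arr G" using basis_paths_Arr by blast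
      let ?A = "T (src G \<beta>) \<beta>"
      have A: "?A \<in> lin_maps tscale tscale (TP 2 \<beta>) (TP 2 \<beta>)" "?A \<circ> ?A = (\<lambda>u. tscale k (?A u))"
        using TL \<beta> src_Ob[OF \<beta>] by (auto simp: local_dyn_TL_def)
      have "?A (pt r) \<in> TP 2 \<beta>" using lin_mapsD(1)[OF A(1) pt_in_TP] p by blast
      then have e: "coord (?A (?A (pt r))) p = (\<Sum>q\<in>basis_paths 2 \<beta>. coord (?A (pt r)) q * coord (?A (pt q)) p)"
        by (subst lin_maps_expand[OF A(1)]) (auto simp: coord_sum)
      have AA: "?A (?A (pt r)) = tscale k (?A (pt r))" using A(2) by (metis comp_apply)
      have tp: "t p s = coord (?A (pt s)) p" for s
        by (simp add: local_mat_def \<beta>_def Let_def)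
      have tq: "t q s = coord (?A (pt s)) q" if "q \<in> basis_paths 2 \<beta>" for q s
        using basis_paths_cmp[OF that] by (simp add: local_mat_def Let_def)
      have "(\<Sum>q\<in>basis_paths 2 \<beta>. t p q * t q r)
          = (\<Sum>q\<in>basis_paths 2 \<beta>. coord (?A (pt r)) q * coord (?A (pt q)) p)"
        by (intro sum.cong refl) (simp only: tp[of _] tq, rule mult.commute)
      also have "\<dots> = k * t p r"
        unfolding e[symmetric] AA tp[of r] coord_linear ..
      finally show ?thesis unfolding p(1) .
    qed
    have "act t i (act t i f) l = (\<Sum>q\<in>pair_moves p. \<Sum>r\<in>pair_moves p. t p q * t q r * f (xs @ r @ zs))"
      unfolding l(1) act_append[OF l(2,3)]
    proof (intro sum.cong refl)
      fix q assume q: "q \<in> pair_moves p"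
      show "t p q * act t i f (xs @ q @ zs) = (\<Sum>r\<in>pair_moves p. t p q * t q r * f (xs @ r @ zs))"
        unfolding act_append[OF l(2) pair_moves_length[OF q]] pair_moves_sym(1)[OF q] sum_distrib_left
        by (simp only: mult.assoc)
    qed
    also have "\<dots> = (\<Sum>r\<in>pair_moves p. (\<Sum>q\<in>pair_moves p. t p q * t q r) * f (xs @ r @ zs))"
      by (subst sum.swap) (simp add: sum_distrib_right)
    also have "\<dots> = k * act t i f l"
      unfolding l(1) act_append[OF l(2,3)] sum_distrib_left by (intro sum.cong refl) (simp add: mat)
    finally show ?thesis .
  qed (simp add: act_short)
qed

lemma act_cubic3:
  assumes "l \<in> basis_paths 3 \<gamma>"
  shows "act t 0 (act t 1 (act t 0 f)) l = act t 0 f l" "act t 1 (act t 0 (act t 1 f)) l = act t 1 f l"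
proof -
  have \<gamma>: "\<gamma> \<in> Arr G" using assms by (rule basis_paths_Arr)
  let ?S = "\<lambda>i. slot_op G sc V 3 T i \<gamma>"
  let ?u = "of_coord 3 \<gamma> f"
  have S: "?S 0 \<circ> ?S 1 \<circ> ?S 0 = ?S 0" "?S 1 \<circ> ?S 0 \<circ> ?S 1 = ?S 1"
    using TL \<gamma> src_Ob[OF \<gamma>] by (auto simp: local_dyn_TL_def)
  have c: "coord (?S i u) = act t i (coord u)" if "u \<in> TP 3 \<gamma>" "i + 1 < 3" for i u
    by (rule coord_slot_op[OF local_op_T that(2,1)])
  have TP: "?S i u \<in> TP 3 \<gamma>" if "i + 1 < 3" for i u
    by (rule slot_op_TP[OF local_op_T that])
  have u: "?u \<in> TP 3 \<gamma>" by (rule of_coord_TP)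
  have "coord (?S 0 (?S 1 (?S 0 ?u))) l = coord (?S 0 ?u) l" "coord (?S 1 (?S 0 (?S 1 ?u))) l = coord (?S 1 ?u) l"
    using S by (metis comp_apply)+
  then have "act t 0 (act t 1 (act t 0 (coord ?u))) l = act t 0 (coord ?u) l"
    "act t 1 (act t 0 (act t 1 (coord ?u))) l = act t 1 (coord ?u) l"
    by (simp_all add: c TP u)
  then show "act t 0 (act t 1 (act t 0 f)) l = act t 0 f l" "act t 1 (act t 0 (act t 1 f)) l = act t 1 f l"
    unfolding coord_of_coord_on_paths act_on_paths using assms by (simp_all add: on_paths_def)
qed

text \<open>By locality the relation reduces to the three entries involved, which form a path, and there it is
  the defining relation of the operator \<open>T\<close>, read in coordinates.\<close>

lemma act_cubic:
  assumes "i + 2 < n" and f: "on_paths n \<gamma> f = f"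
  shows "act t i (act t (i + 1) (act t i f)) = act t i f"
    "act t (i + 1) (act t i (act t (i + 1) f)) = act t (i + 1) f"
proof -
  have "act t i (act t (i + 1) (act t i f)) l = act t i f l
    \<and> act t (i + 1) (act t i (act t (i + 1) f)) l = act t (i + 1) f l" for l
  proof (cases "l \<in> basis_paths n \<gamma>")
    case True
    obtain xs ys zs where l: "l = xs @ ys @ zs" "length xs = i" "length ys = 3"
      using basis_paths_split[OF True, of i 3] assms(1) by auto
    have ys: "ys \<in> basis_paths 3 (path_cmp G (map fst ys))"
      using True l by (intro basis_paths_infix) auto
    \<comment> \<open>The functions \<open>F\<close>, on long lists, and \<open>g\<close>, on lists of length three, agree in the window.\<close>
    define agree where "agree F g \<longleftrightarrow> (\<forall>y. length y = 3 \<longrightarrow> F (xs @ y @ zs) = g y)"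
      for F g :: "('b \<times> 'c) list \<Rightarrow> complex"
    have step: "agree (act t (i + j) F) (act t j g)" if "agree F g" "j < 2" for F g j
      unfolding agree_def
    proof (intro allI impI)
      fix y :: "('b \<times> 'c) list" assume y: "length y = 3"
      then have "act t (i + j) F (xs @ y @ zs) = act t j (\<lambda>y. F (xs @ y @ zs)) y"
        using act_context[of j y t xs F zs] that unfolding l(2) by simp
      also have "\<dots> = act t j g y" using that y by (intro act_cong) (simp add: agree_def)
      finally show "act t (i + j) F (xs @ y @ zs) = act t j g y" .
    qed
    have step0: "agree (act t i F) (act t 0 g)" if "agree F g" for F g
      using step[OF that, of 0] by simp
    have step1: "agree (act t (i + 1) F) (act t 1 g)" if "agree F g" for F g
      by (rule step[OF that]) simp
    define g where "g y = f (xs @ y @ zs)" for y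
    have g: "agree f g" by (simp add: agree_def g_def)
    have "act t i (act t (i + 1) (act t i f)) l = act t 0 (act t 1 (act t 0 g)) ys"
      "act t (i + 1) (act t i (act t (i + 1) f)) l = act t 1 (act t 0 (act t 1 g)) ys"
      "act t i f l = act t 0 g ys" "act t (i + 1) f l = act t 1 g ys"
      using step0[OF step1[OF step0[OF g]]] step1[OF step0[OF step1[OF g]]] step0[OF g] step1[OF g] l
      by (auto simp: agree_def)
    then show ?thesis using act_cubic3[OF ys] by simp
  next
    case False
    have "act t j f l = 0"
      if "on_paths n \<gamma> f = f" for j f
      using act_on_paths[of t j n \<gamma> f] that False by (metis on_paths_def)
    then show ?thesis using f by (metis act_on_paths)
  qed
  then show "act t i (act t (i + 1) (act t i f)) = act t i f"
    "act t (i + 1) (act t i (act t (i + 1) f)) = act t (i + 1) f" by auto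
qed

text \<open>Both sides are expanded with the Temperley--Lieb relations. The terms with two different factors
  agree at once; the coefficients of the single operators agree precisely because of the equation
  that relates \<open>x\<close>, \<open>y\<close> and \<open>z\<close>.\<close>

theorem yang_baxter:
  assumes "i + 2 < n" "on_paths n \<gamma> f = f" and x: "x = y + z + k * y * z + x * y * z"
  shows "bax t z (i + 1) (bax t x i (bax t y (i + 1) f)) = bax t y i (bax t x (i + 1) (bax t z i f))"
proof
  fix l
  let ?A = "act t i" and ?B = "act t (i + 1)"
  \<comment> \<open>The relation between the parameters, multiplied by the value of an operator.\<close>
  have c: "x * c = y * c + z * c + k * y * z * c + x * y * z * c" for c
    using arg_cong[OF x, of "\<lambda>x. x * c"] by (simp add: algebra_simps)
  show "bax t z (i + 1) (bax t x i (bax t y (i + 1) f)) l = bax t y i (bax t x (i + 1) (bax t z i f)) l"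
    unfolding bax_def act_linear act_square act_cubic[OF assms(1,2)]
    using c[of "?A f l"] c[of "?B f l"] by (simp add: algebra_simps)
qed

lemma bax_inverse:
  assumes "y + z + k * y * z = 0"
  shows "bax t y i (bax t z i f) = f"
proof
  fix l
  have "(y + z + k * y * z) * act t i f l = 0" using assms by simp
  then show "bax t y i (bax t z i f) l = f l"
    unfolding bax_def act_linear act_square by (simp add: algebra_simps)
qed

end


section \<open>Commuting traces\<close>

context graded_space
begin

text \<open>The product of \<open>m\<close> Baxterized operators in consecutive slots, starting with slot \<open>k\<close>; it
  carries one tensor factor past \<open>m\<close> others.\<close>

primrec train :: "(('a \<times> 'v) list \<Rightarrow> ('a \<times> 'v) list \<Rightarrow> complex) \<Rightarrow> complex \<Rightarrow> nat \<Rightarrow> nat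
    \<Rightarrow> (('a \<times> 'v) list \<Rightarrow> complex) \<Rightarrow> ('a \<times> 'v) list \<Rightarrow> complex" where
  "train a x k 0 f = f"
| "train a x k (Suc m) f = bax a x (k + m) (train a x k m f)"

lemma train_0 [simp]: "train a 0 k m f = f"
  by (induction m) auto

lemma train_linear: "train a x k m (\<lambda>l. f l + c * g l) = (\<lambda>l. train a x k m f l + c * train a x k m g l)"
  by (induction m) (auto simp: bax_linear)

lemma train_zero: "train a x k m (\<lambda>l. 0) = (\<lambda>l. 0)"
  by (induction m) (auto simp: bax_def act_def)

lemma train_sum:
  "train a x k m (\<lambda>l. \<Sum>i\<in>I. c i * g i l) = (\<lambda>l. \<Sum>i\<in>I. c i * train a x k m (g i) l)"
proof (induction I rule: infinite_finite_induct)
  case (insert i I)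
  then show ?case
    using train_linear[of a x k m "\<lambda>l. \<Sum>i\<in>I. c i * g i l" "c i" "g i"] by (simp add: add.commute)
qed (auto simp: train_zero)

lemma bax_sum: "bax a x i (\<lambda>l. \<Sum>j\<in>I. c j * g j l) = (\<lambda>l. \<Sum>j\<in>I. c j * bax a x i (g j) l)"
  using train_sum[of a x i 1] by simp

lemma train_on_paths: "train a x k m (on_paths n \<gamma> f) = on_paths n \<gamma> (train a x k m f)"
  by (induction m) (auto simp: bax_on_paths)

lemma train_bax_commute:
  "k + m < j \<Longrightarrow> train a x k m (bax a y j f) = bax a y j (train a x k m f)"
proof (induction m)
  case (Suc m)
  then show ?case using bax_commute[of "k + m" j a x y "train a x k m f"] by simp
qed simp

lemma train_holomorphic:
  assumes "c holomorphic_on UNIV" "\<And>l. (\<lambda>x. F x l) holomorphic_on UNIV"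
  shows "(\<lambda>x. train a (c x) k m (F x) l) holomorphic_on UNIV"
proof -
  have bax: "(\<lambda>x. bax a (c x) i (F x) l) holomorphic_on UNIV"
    if "\<And>l. (\<lambda>x. F x l) holomorphic_on UNIV" for F i l
    unfolding bax_def act_def using that assms(1)
    by (cases "i + 1 < length l") (auto intro!: holomorphic_intros)
  show ?thesis
    by (induction m arbitrary: l) (auto intro: assms bax)
qed

text \<open>Tensor multiplication from the left by the basis path \<open>c\<close>, in coordinates.\<close>

definition prepend :: "('a \<times> 'v) list \<Rightarrow> (('a \<times> 'v) list \<Rightarrow> complex) \<Rightarrow> ('a \<times> 'v) list \<Rightarrow> complex" where
  "prepend c f l = (if take (length c) l = c then f (drop (length c) l) else 0)"

lemma prepend_append: "prepend (c @ d) f = prepend c (prepend d f)"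
proof
  fix l :: "('a \<times> 'v) list"
  have "take (length (c @ d)) l = take (length c) l @ take (length d) (drop (length c) l)"
    by (simp add: take_add)
  moreover have "take (length c) l @ take (length d) (drop (length c) l) = c @ d
      \<longleftrightarrow> take (length c) l = c \<and> take (length d) (drop (length c) l) = d"
    by (cases "length c \<le> length l") auto
  ultimately show "prepend (c @ d) f l = prepend c (prepend d f) l"
    by (simp add: prepend_def add.commute)
qed

lemma bax_prepend: "bax a x (Suc i) (prepend [c] f) = prepend [c] (bax a x i f)"
proof
  fix l
  show "bax a x (Suc i) (prepend [c] f) l = prepend [c] (bax a x i f) l"
  proof (cases l)
    case (Cons d l')
    have "act a (Suc i) (prepend [c] f) (d # l') = (if d = c then act a i f l' else 0)"
    proof (cases "i + 1 < length l'")
      case True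
      then have "act a (Suc i) (prepend [c] f) (d # l') = act a i (\<lambda>l. prepend [c] f (d # l)) l'"
        using act_context[of i l' a "[d]" "prepend [c] f" "[]"] by simp
      then show ?thesis by (auto simp: prepend_def act_def)
    qed (auto simp: act_short)
    then show ?thesis using Cons by (simp add: bax_def prepend_def)
  qed (simp add: bax_def prepend_def act_short)
qed

text \<open>A factor in front that is not touched shifts the slots by one.\<close>

lemma train_prepend: "train a x (Suc k) m (prepend [c] f) = prepend [c] (train a x k m f)"
  by (induction m) (auto simp: bax_prepend)

text \<open>A last factor beyond the active slots is a spectator.\<close>

lemma train_snoc:
  "k + m < length l \<Longrightarrow> train a x k m f (l @ [d]) = train a x k m (\<lambda>l. f (l @ [d])) l"
proof (induction m arbitrary: l)
  case (Suc m)
  have "act a (k + m) (train a x k m f) (l @ [d]) = act a (k + m) (\<lambda>l. train a x k m f (l @ [d])) l"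
    using act_context[of "k + m" l a "[]" "train a x k m f" "[d]"] Suc.prems by simp
  also have "\<dots> = act a (k + m) (train a x k m (\<lambda>l. f (l @ [d]))) l"
    using Suc by (intro act_cong) auto
  finally show ?case using Suc by (simp add: bax_def)
qed simp

text \<open>On the two leading factors the operator acts by its matrix.\<close>

lemma act_prepend_pair:
  assumes p: "p \<in> basis_paths 2 \<beta>"
  shows "act a 0 (prepend p h) = (\<lambda>l. \<Sum>q\<in>basis_paths 2 \<beta>. a q p * prepend q h l)"
proof
  fix l
  show "act a 0 (prepend p h) l = (\<Sum>q\<in>basis_paths 2 \<beta>. a q p * prepend q h l)"
  proof (cases "1 < length l")
    case True
    obtain xs p' l' where "l = xs @ p' @ l'" "length xs = 0" "length p' = 2"
      by (rule split_at_pair[of 0 l]) (use True in simp)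
    then have l: "l = p' @ l'" "length p' = 2" by auto
    have moves: "p \<in> pair_moves p' \<longleftrightarrow> p' \<in> basis_paths 2 \<beta>"
      using p pair_moves_sym(2)[of p p'] pair_moves_basis_paths l(2) by auto
    have "act a 0 (prepend p h) l = (\<Sum>q\<in>pair_moves p'. a p' q * prepend p h (q @ l'))"
      using act_append[of "[]" 0 p' a "prepend p h" l'] l by simp
    also have "\<dots> = (\<Sum>q\<in>pair_moves p'. if q = p then a p' p * h l' else 0)"
      using p by (intro sum.cong) (auto simp: prepend_def pair_moves_length basis_paths_length)
    also have "\<dots> = (\<Sum>q\<in>basis_paths 2 \<beta>. if q = p' then a p' p * h l' else 0)"
      by (simp add: moves)
    also have "\<dots> = (\<Sum>q\<in>basis_paths 2 \<beta>. a q p * prepend q h l)"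
      using l by (intro sum.cong) (auto simp: prepend_def basis_paths_length)
    finally show ?thesis .
  next
    case False
    then have "prepend q h l = 0" if "q \<in> basis_paths 2 \<beta>" for q
      using basis_paths_length[OF that] by (auto simp: prepend_def dest: arg_cong[where f = length])
    then show ?thesis using False by (simp add: act_short)
  qed
qed

text \<open>The trace over an auxiliary pair of factors, which enters at the front and leaves at the end, is
  cyclic: an operator on the outgoing pair may be moved to the incoming pair.\<close>

lemma trace_cyclic:
  assumes Y: "\<And>(I :: ('a \<times> 'v) list set) c g. Y (\<lambda>l. \<Sum>i\<in>I. c i * g i l) = (\<lambda>l. \<Sum>i\<in>I. c i * Y (g i) l)"
    and Y': "\<And>f g c. Y (\<lambda>l. f l + c * g l) = (\<lambda>l. Y f l + c * Y g l)"
    and \<psi>: "length \<psi> = m"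
  shows "(\<Sum>p\<in>basis_paths 2 \<beta>. bax a z m (Y (prepend p h)) (\<psi> @ p))
    = (\<Sum>p\<in>basis_paths 2 \<beta>. Y (bax a z 0 (prepend p h)) (\<psi> @ p))"
proof -
  let ?P = "basis_paths 2 \<beta>"
  have "(\<Sum>p\<in>?P. act a m (Y (prepend p h)) (\<psi> @ p)) = (\<Sum>p\<in>?P. \<Sum>q\<in>?P. a p q * Y (prepend p h) (\<psi> @ q))"
    using act_append[OF \<psi>, where zs = "[]"]
    by (intro sum.cong) (auto simp: basis_paths_length pair_moves_basis_paths)
  also have "\<dots> = (\<Sum>q\<in>?P. \<Sum>p\<in>?P. a p q * Y (prepend p h) (\<psi> @ q))"
    by (rule sum.swap)
  also have "\<dots> = (\<Sum>p\<in>?P. Y (act a 0 (prepend p h)) (\<psi> @ p))"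
    by (intro sum.cong refl) (simp add: act_prepend_pair Y)
  finally show ?thesis
    by (simp add: bax_def Y' sum.distrib flip: sum_distrib_left)
qed

end

lemma zero_off_finite:
  fixes \<phi> :: "complex \<Rightarrow> complex"
  assumes "continuous_on UNIV \<phi>" "finite S" "\<And>x. x \<notin> S \<Longrightarrow> \<phi> x = 0"
  shows "\<phi> x = 0"
proof -
  have "closed {x. \<phi> x = 0}"
    using assms(1) continuous_closed_vimage[of "{0}" \<phi>]
    by (simp add: closed_Collect_eq continuous_on_const)
  moreover have "closure (- S) = UNIV"
    using assms(2) by (simp add: closure_complement empty_interior_finite)
  moreover have "- S \<subseteq> {x. \<phi> x = 0}" using assms(3) by auto
  ultimately show ?thesis using closure_minimal by blast
qed

context tl_space
begin

text \<open>Induction on the length. The operators of the two trains that are far apart commute, so the two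
  rows can be multiplied column by column, and \<open>R(z)\<close> passes each column by the Yang--Baxter
  equation.\<close>

lemma train_exchange:
  assumes "m + 1 < n" "on_paths n \<gamma> f = f" and xyz: "x = y + z + k * y * z + x * y * z"
  shows "bax t z m (train t x 0 m (train t y 1 m f)) = train t y 0 m (train t x 1 m (bax t z 0 f))"
  using assms(1)
proof (induction m)
  case (Suc m)
  let ?f = "train t x 0 m (train t y 1 m f)"
  have f: "on_paths n \<gamma> ?f = ?f"
    using assms(2) by (simp flip: train_on_paths)
  have "bax t z (Suc m) (train t x 0 (Suc m) (train t y 1 (Suc m) f))
    = bax t z (m + 1) (bax t x m (bax t y (m + 1) ?f))"
    by (simp add: train_bax_commute)
  also have "\<dots> = bax t y m (bax t x (m + 1) (bax t z m ?f))"
    by (rule yang_baxter[OF _ f xyz]) (use Suc.prems in simp)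
  also have "\<dots> = bax t y m (bax t x (m + 1) (train t y 0 m (train t x 1 m (bax t z 0 f))))"
    using Suc by simp
  also have "\<dots> = train t y 0 (Suc m) (train t x 1 (Suc m) (bax t z 0 f))"
    by (simp add: train_bax_commute)
  finally show ?case .
qed simp

text \<open>The two inequalities say that the intertwiner \<open>R(z)\<close> exists and that it is invertible.\<close>

lemma trace_commute_generic:
  assumes \<psi>: "length \<psi> = m" and h: "\<And>p. p \<in> basis_paths 2 \<beta> \<Longrightarrow> on_paths (m + 2) \<gamma> (prepend p h) = prepend p h"
    and x: "1 + k * y + x * y \<noteq> 0" "1 + k * x + x * y \<noteq> 0"
  shows "(\<Sum>p\<in>basis_paths 2 \<beta>. train t x 0 m (train t y 1 m (prepend p h)) (\<psi> @ p))
    = (\<Sum>p\<in>basis_paths 2 \<beta>. train t y 0 m (train t x 1 m (prepend p h)) (\<psi> @ p))"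
proof -
  \<comment> \<open>The solution of the relation in \<open>yang_baxter\<close>, and the parameter of the inverse of \<open>R(z)\<close>.\<close>
  define z where "z = (x - y) / (1 + k * y + x * y)"
  define z' where "z' = - z / (1 + k * z)"
  have z: "x = y + z + k * y * z + x * y * z"
  proof -
    have "z * (1 + k * y + x * y) = x - y" using x by (simp add: z_def)
    then show ?thesis by (simp add: algebra_simps)
  qed
  have "1 + k * z = (1 + k * x + x * y) / (1 + k * y + x * y)"
    using x by (simp add: z_def field_simps)
  then have "1 + k * z \<noteq> 0" using x by simp
  then have z': "z' + z + k * z' * z = 0" "z + z' + k * z * z' = 0"
    by (simp_all add: z'_def field_simps)
  let ?P = "basis_paths 2 \<beta>"
  let ?W = "\<lambda>f. train t y 0 m (train t x 1 m f)"
  have "(\<Sum>p\<in>?P. train t x 0 m (train t y 1 m (prepend p h)) (\<psi> @ p))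
    = (\<Sum>p\<in>?P. bax t z' m (bax t z m (train t x 0 m (train t y 1 m (prepend p h)))) (\<psi> @ p))"
    by (simp add: bax_inverse[OF z'(1)])
  also have "\<dots> = (\<Sum>p\<in>?P. bax t z' m (?W (bax t z 0 (prepend p h))) (\<psi> @ p))"
    by (intro sum.cong refl, subst train_exchange[OF _ h z]) auto
  also have "\<dots> = (\<Sum>p\<in>?P. ?W (bax t z 0 (bax t z' 0 (prepend p h))) (\<psi> @ p))"
    by (intro trace_cyclic[OF _ _ \<psi>, where Y = "\<lambda>f. ?W (bax t z 0 f)"])
      (simp_all only: train_sum train_linear bax_linear bax_sum)
  also have "\<dots> = (\<Sum>p\<in>?P. ?W (prepend p h) (\<psi> @ p))"
    by (simp add: bax_inverse[OF z'(2)])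
  finally show ?thesis .
qed

text \<open>For fixed \<open>y\<close> only finitely many \<open>x\<close> are not generic, and both sides are continuous in \<open>x\<close>.\<close>

theorem trace_commute:
  assumes \<psi>: "length \<psi> = m" and h: "\<And>p. p \<in> basis_paths 2 \<beta> \<Longrightarrow> on_paths (m + 2) \<gamma> (prepend p h) = prepend p h"
  shows "(\<Sum>p\<in>basis_paths 2 \<beta>. train t x 0 m (train t y 1 m (prepend p h)) (\<psi> @ p))
    = (\<Sum>p\<in>basis_paths 2 \<beta>. train t y 0 m (train t x 1 m (prepend p h)) (\<psi> @ p))"
    (is "?L x = ?R x")
proof -
  define S where "S = {x. 1 + k * y + x * y = 0 \<or> 1 + k * x + x * y = 0}"
  have "S \<subseteq> {- (1 + k * y) / y, - 1 / (k + y)}"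
  proof
    fix x assume "x \<in> S"
    then consider "1 + k * y + x * y = 0" | "1 + (k + y) * x = 0"
      by (auto simp: S_def algebra_simps)
    then show "x \<in> {- (1 + k * y) / y, - 1 / (k + y)}"
    proof cases
      case 1
      then have "y \<noteq> 0" "x * y = - (1 + k * y)" by (auto simp: algebra_simps eq_neg_iff_add_eq_0)
      then show ?thesis by (simp add: field_simps)
    next
      case 2
      then have "k + y \<noteq> 0" "(k + y) * x = - 1" by (auto simp: eq_neg_iff_add_eq_0 add.commute)
      then show ?thesis by (simp add: field_simps)
    qed
  qed
  then have fin: "finite S" by (rule finite_subset) simp
  have "?L holomorphic_on UNIV" "?R holomorphic_on UNIV"
    by (intro holomorphic_intros train_holomorphic)+
  then have "continuous_on UNIV (\<lambda>x. ?L x - ?R x)"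
    by (intro continuous_intros holomorphic_on_imp_continuous_on)
  moreover have "?L x - ?R x = 0" if "x \<notin> S" for x
    using trace_commute_generic[OF \<psi> h, where x = x and y = y] that by (simp add: S_def)
  ultimately have "?L x - ?R x = 0" using fin zero_off_finite by blast
  then show ?thesis by simp
qed

end


section \<open>The convolution algebra\<close>

context groupoid
begin

lemma div_Arr:
  assumes "\<alpha> \<in> Arr G" "\<gamma> \<in> Arr G" "src G \<alpha> = src G \<gamma>"
  shows "cmp G \<gamma> (ivs G \<alpha>) \<in> Arr G" "src G (cmp G \<gamma> (ivs G \<alpha>)) = tgt G \<alpha>"
    "tgt G (cmp G \<gamma> (ivs G \<alpha>)) = tgt G \<gamma>" "cmp G (cmp G \<gamma> (ivs G \<alpha>)) \<alpha> = \<gamma>"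
proof -
  show "cmp G \<gamma> (ivs G \<alpha>) \<in> Arr G" "src G (cmp G \<gamma> (ivs G \<alpha>)) = tgt G \<alpha>"
    "tgt G (cmp G \<gamma> (ivs G \<alpha>)) = tgt G \<gamma>"
    using assms by (simp_all add: cmp_Arr src_cmp tgt_cmp ivs_Arr src_ivs tgt_ivs)
  have "cmp G (cmp G \<gamma> (ivs G \<alpha>)) \<alpha> = cmp G \<gamma> (cmp G (ivs G \<alpha>) \<alpha>)"
    using assms by (intro cmp_assoc[symmetric]) (simp_all add: ivs_Arr src_ivs tgt_ivs)
  then show "cmp G (cmp G \<gamma> (ivs G \<alpha>)) \<alpha> = \<gamma>"
    using assms by (simp add: ivs_left cmp_idt_right)
qed

lemma cmp_div:
  assumes "\<alpha> \<in> Arr G" "\<beta> \<in> Arr G" "tgt G \<alpha> = src G \<beta>"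
  shows "cmp G (cmp G \<beta> \<alpha>) (ivs G \<alpha>) = \<beta>"
proof -
  have "cmp G (cmp G \<beta> \<alpha>) (ivs G \<alpha>) = cmp G \<beta> (cmp G \<alpha> (ivs G \<alpha>))"
    using assms by (intro cmp_assoc[symmetric]) (simp_all add: ivs_Arr src_ivs tgt_ivs)
  then show ?thesis using assms by (simp add: ivs_right cmp_idt_right)
qed

lemma ivs_unique:
  assumes "\<alpha> \<in> Arr G" "\<beta> \<in> Arr G" "tgt G \<alpha> = src G \<beta>" "cmp G \<beta> \<alpha> = idt G (src G \<alpha>)"
  shows "\<beta> = ivs G \<alpha>"
  using cmp_right_cancel[of \<alpha> \<beta> "ivs G \<alpha>"] assms by (simp add: ivs_Arr src_ivs ivs_left)

lemma ivs_cmp: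
  assumes "\<alpha> \<in> Arr G" "\<beta> \<in> Arr G" "tgt G \<alpha> = src G \<beta>"
  shows "ivs G (cmp G \<beta> \<alpha>) = cmp G (ivs G \<alpha>) (ivs G \<beta>)"
proof (rule ivs_unique[symmetric])
  have "cmp G (cmp G (ivs G \<alpha>) (ivs G \<beta>)) (cmp G \<beta> \<alpha>)
      = cmp G (cmp G (cmp G (ivs G \<alpha>) (ivs G \<beta>)) \<beta>) \<alpha>"
    using assms by (intro cmp_assoc) (simp_all add: cmp_Arr src_cmp tgt_cmp ivs_Arr src_ivs tgt_ivs)
  also have "cmp G (cmp G (ivs G \<alpha>) (ivs G \<beta>)) \<beta> = ivs G \<alpha>"
    using div_Arr(4)[of \<beta> "ivs G \<alpha>"] assms by (simp add: ivs_Arr src_ivs)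
  finally show "cmp G (cmp G (ivs G \<alpha>) (ivs G \<beta>)) (cmp G \<beta> \<alpha>) = idt G (src G (cmp G \<beta> \<alpha>))"
    using assms by (simp add: ivs_left src_cmp)
qed (use assms in \<open>simp_all add: cmp_Arr src_cmp tgt_cmp ivs_Arr src_ivs tgt_ivs\<close>)

lemma ivs_ivs: "\<alpha> \<in> Arr G \<Longrightarrow> ivs G (ivs G \<alpha>) = \<alpha>"
  using ivs_unique[of "ivs G \<alpha>" \<alpha>, symmetric] by (simp only: ivs_Arr src_ivs tgt_ivs ivs_right)

lemma conj_arr_hom_set:
  "\<alpha> \<in> Arr G \<Longrightarrow> \<delta> \<in> loops \<alpha> \<Longrightarrow> conj_arr G \<alpha> \<delta> \<in> hom_set G (tgt G \<alpha>) (tgt G \<alpha>)"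
  by (auto simp: hom_set_def conj_arr_def cmp_Arr src_cmp tgt_cmp ivs_Arr src_ivs tgt_ivs)

text \<open>The two ways of decomposing the degree of \<open>V\<^bsub>\<alpha>\<^esub> \<otimes> W\<close> and of \<open>W \<otimes> V\<^bsub>\<alpha>\<^esub>\<close>
  that the partial trace identifies.\<close>

lemma conj_arr_cmp:
  assumes "\<alpha> \<in> Arr G" "\<delta> \<in> loops \<alpha>"
  shows "cmp G (conj_arr G \<alpha> \<delta>) \<alpha> = cmp G \<alpha> \<delta>"
proof -
  have \<delta>: "\<delta> \<in> Arr G" "src G \<delta> = src G \<alpha>" "tgt G \<delta> = src G \<alpha>" using assms by (auto simp: hom_set_def)
  then have "src G \<alpha> = src G (cmp G \<alpha> \<delta>)" using assms src_cmp[of \<delta> \<alpha>] by simp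
  then show ?thesis
    unfolding conj_arr_def using assms \<delta> by (intro div_Arr(4) cmp_Arr)
qed

lemma conj_arr_comp:
  assumes "\<alpha> \<in> Arr G" "\<beta> \<in> Arr G" "tgt G \<alpha> = src G \<beta>" "\<delta> \<in> loops \<alpha>"
  shows "conj_arr G (cmp G \<beta> \<alpha>) \<delta> = conj_arr G \<beta> (conj_arr G \<alpha> \<delta>)"
proof -
  note simps = cmp_Arr src_cmp tgt_cmp ivs_Arr src_ivs tgt_ivs
  have \<delta>: "\<delta> \<in> Arr G" "src G \<delta> = src G \<alpha>" "tgt G \<delta> = src G \<alpha>" using assms by (auto simp: hom_set_def)
  have "conj_arr G (cmp G \<beta> \<alpha>) \<delta> = cmp G (cmp G \<beta> (cmp G \<alpha> \<delta>)) (cmp G (ivs G \<alpha>) (ivs G \<beta>))"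
    using assms \<delta> cmp_assoc[of \<delta> \<alpha> \<beta>] by (simp add: conj_arr_def ivs_cmp)
  also have "\<dots> = cmp G (cmp G (cmp G \<beta> (cmp G \<alpha> \<delta>)) (ivs G \<alpha>)) (ivs G \<beta>)"
    using assms \<delta> by (intro cmp_assoc) (simp_all add: simps)
  also have "cmp G (cmp G \<beta> (cmp G \<alpha> \<delta>)) (ivs G \<alpha>) = cmp G \<beta> (cmp G (cmp G \<alpha> \<delta>) (ivs G \<alpha>))"
    using assms \<delta> by (intro cmp_assoc[symmetric]) (simp_all add: simps)
  finally show ?thesis by (simp add: conj_arr_def)
qed

lemma conj_div:
  assumes "\<gamma> \<in> Arr G" "\<delta> \<in> loops \<gamma>" "\<alpha> \<in> Arr G" "src G \<alpha> = src G \<gamma>"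
  shows "cmp G \<gamma> (ivs G \<alpha>) \<in> Arr G"
    "conj_arr G \<alpha> \<delta> \<in> hom_set G (src G (cmp G \<gamma> (ivs G \<alpha>))) (src G (cmp G \<gamma> (ivs G \<alpha>)))"
    "conj_arr G (cmp G \<gamma> (ivs G \<alpha>)) (conj_arr G \<alpha> \<delta>) = conj_arr G \<gamma> \<delta>"
proof -
  note d = div_Arr[OF assms(3,1,4)]
  have \<delta>: "\<delta> \<in> loops \<alpha>" using assms(2,4) by simp
  show "cmp G \<gamma> (ivs G \<alpha>) \<in> Arr G" by (rule d(1))
  show "conj_arr G \<alpha> \<delta> \<in> hom_set G (src G (cmp G \<gamma> (ivs G \<alpha>))) (src G (cmp G \<gamma> (ivs G \<alpha>)))"
    unfolding d(2) by (rule conj_arr_hom_set[OF assms(3) \<delta>])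
  show "conj_arr G (cmp G \<gamma> (ivs G \<alpha>)) (conj_arr G \<alpha> \<delta>) = conj_arr G \<gamma> \<delta>"
    using conj_arr_comp[OF assms(3) d(1) d(2)[symmetric] \<delta>] unfolding d(4) by simp
qed

lemma ivs_idt: "a \<in> Ob G \<Longrightarrow> ivs G (idt G a) = idt G a"
  using ivs_unique[of "idt G a" "idt G a"] cmp_idt_left[of "idt G a"] by (simp add: idt_Arr src_idt tgt_idt)

lemma conj_arr_idt:
  "\<delta> \<in> hom_set G a a \<Longrightarrow> conj_arr G (idt G a) \<delta> = \<delta>"
  using cmp_idt_left[of \<delta>] cmp_idt_right[of \<delta>] src_Ob[of \<delta>] by (auto simp: conj_arr_def hom_set_def ivs_idt)

end

text \<open>To be instantiated with the tensor powers of a fixed order.\<close>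

locale graded_endo = groupoid G + vw: vector_space scw
  for G :: "('o, 'a) groupoid_data" and scw :: "complex \<Rightarrow> 'w::ab_group_add \<Rightarrow> 'w" +
  fixes W :: "'a \<Rightarrow> 'w set"
  assumes subspace_W: "vw.subspace (W \<gamma>)"
begin

lemma W_0: "0 \<in> W \<gamma>" and W_add: "u \<in> W \<gamma> \<Longrightarrow> v \<in> W \<gamma> \<Longrightarrow> u + v \<in> W \<gamma>"
  using subspace_W vw.subspace_0 vw.subspace_add by blast+

lemma lin_map_0:
  assumes "f \<in> lin_maps scw scw (W \<gamma>) (W \<gamma>')"
  shows "f 0 = 0"
proof -
  have "f (scw 0 0) = scw 0 (f 0)" using assms W_0[of \<gamma>] unfolding lin_maps_def by blast
  then show ?thesis by simp
qed

lemma lin_map_in: "f \<in> lin_maps scw scw (W \<gamma>) (W \<gamma>') \<Longrightarrow> f u \<in> W \<gamma>'"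
  using W_0[of \<gamma>'] by (cases "u \<in> W \<gamma>") (auto simp: lin_maps_def)

lemma lin_map_outside: "f \<in> lin_maps scw scw (W \<gamma>) (W \<gamma>') \<Longrightarrow> u \<notin> W \<gamma> \<Longrightarrow> f u = 0"
  by (simp add: lin_maps_def)

lemma lin_map_sum:
  assumes f: "f \<in> lin_maps scw scw (W \<gamma>) (W \<gamma>')" and "\<And>i. i \<in> I \<Longrightarrow> u i \<in> W \<gamma>"
  shows "f (\<Sum>i\<in>I. u i) = (\<Sum>i\<in>I. f (u i))"
proof -
  have "f (\<Sum>i\<in>I. u i) = (\<Sum>i\<in>I. f (u i)) \<and> (\<Sum>i\<in>I. u i) \<in> W \<gamma>"
    using assms(2)
  proof (induction I rule: infinite_finite_induct)
    case (insert i I)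
    moreover have "f (u i + (\<Sum>i\<in>I. u i)) = f (u i) + f (\<Sum>i\<in>I. u i)"
      using f insert unfolding lin_maps_def by auto
    ultimately show ?case by (auto intro: W_add)
  qed (auto simp: lin_map_0[OF f] W_0)
  then show ?thesis by simp
qed

lemma zero_lin_map: "0 \<in> lin_maps scw scw (W \<gamma>) (W \<gamma>')"
  by (simp add: lin_maps_def W_0)

lemma lin_maps_add:
  assumes "f \<in> lin_maps scw scw (W \<gamma>) (W \<gamma>')" "g \<in> lin_maps scw scw (W \<gamma>) (W \<gamma>')"
  shows "f + g \<in> lin_maps scw scw (W \<gamma>) (W \<gamma>')"
  using assms by (auto simp: lin_maps_def W_add vw.scale_right_distrib)

lemma lin_maps_sum_closed:
  "(\<And>i. i \<in> I \<Longrightarrow> f i \<in> lin_maps scw scw (W \<gamma>) (W \<gamma>')) \<Longrightarrow> (\<Sum>i\<in>I. f i) \<in> lin_maps scw scw (W \<gamma>) (W \<gamma>')"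
  by (induction I rule: infinite_finite_induct) (simp_all add: zero_lin_map lin_maps_add)

lemma lin_maps_comp:
  assumes g: "g \<in> lin_maps scw scw (W \<gamma>') (W \<gamma>'')" and f: "f \<in> lin_maps scw scw (W \<gamma>) (W \<gamma>')"
  shows "g \<circ> f \<in> lin_maps scw scw (W \<gamma>) (W \<gamma>'')"
  using assms lin_map_0[OF g] by (auto simp: lin_maps_def)

abbreviation alg :: "('a \<Rightarrow> 'a \<Rightarrow> 'w \<Rightarrow> 'w) set" where "alg \<equiv> conv_alg G scw W"
abbreviation conv_prod :: "('a \<Rightarrow> 'a \<Rightarrow> 'w \<Rightarrow> 'w) \<Rightarrow> ('a \<Rightarrow> 'a \<Rightarrow> 'w \<Rightarrow> 'w) \<Rightarrow> ('a \<Rightarrow> 'a \<Rightarrow> 'w \<Rightarrow> 'w)"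
  (infixl "\<star>" 70) where "g \<star> h \<equiv> conv G g h"

lemma alg_lin_map:
  "g \<in> alg \<Longrightarrow> \<alpha> \<in> Arr G \<Longrightarrow> \<delta> \<in> loops \<alpha> \<Longrightarrow>
    g \<alpha> \<delta> \<in> lin_maps scw scw (W (conj_arr G \<alpha> \<delta>)) (W \<delta>)"
  by (auto simp: conv_alg_def End_comp_def)

lemma alg_finite:
  assumes "g \<in> alg" "a \<in> Ob G"
  shows "finite {\<alpha> \<in> Arr G. src G \<alpha> = a \<and> g \<alpha> \<noteq> 0}" "finite {\<alpha> \<in> Arr G. tgt G \<alpha> = a \<and> g \<alpha> \<noteq> 0}"
proof -
  have "finite {\<alpha> \<in> Arr G. (src G \<alpha> = a \<or> tgt G \<alpha> = a) \<and> g \<alpha> \<noteq> 0}"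
    using assms by (simp add: conv_alg_def)
  then show "finite {\<alpha> \<in> Arr G. src G \<alpha> = a \<and> g \<alpha> \<noteq> 0}" "finite {\<alpha> \<in> Arr G. tgt G \<alpha> = a \<and> g \<alpha> \<noteq> 0}"
    by (auto elim!: rev_finite_subset)
qed

lemma alg_eqI:
  assumes "g \<in> alg" "h \<in> alg"
    and eq: "\<And>\<gamma> \<delta> w. \<gamma> \<in> Arr G \<Longrightarrow> \<delta> \<in> loops \<gamma> \<Longrightarrow> w \<in> W (conj_arr G \<gamma> \<delta>) \<Longrightarrow>
      g \<gamma> \<delta> w = h \<gamma> \<delta> w"
  shows "g = h"
proof (intro ext)
  fix \<gamma> \<delta> w
  consider "\<gamma> \<notin> Arr G" | "\<gamma> \<in> Arr G" "\<delta> \<notin> loops \<gamma>"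
    | "\<gamma> \<in> Arr G" "\<delta> \<in> loops \<gamma>" by blast
  then show "g \<gamma> \<delta> w = h \<gamma> \<delta> w"
  proof cases
    case 3
    show ?thesis
    proof (cases "w \<in> W (conj_arr G \<gamma> \<delta>)")
      case False
      then show ?thesis
        using lin_map_outside[OF alg_lin_map[OF assms(1) 3]] lin_map_outside[OF alg_lin_map[OF assms(2) 3]]
        by simp
    qed (rule eq[OF 3])
  qed (use assms(1,2) in \<open>auto simp: conv_alg_def End_comp_def\<close>)
qed

lemma conv_outside:
  "\<gamma> \<notin> Arr G \<Longrightarrow> (g \<star> h) \<gamma> = 0" "\<delta> \<notin> loops \<gamma> \<Longrightarrow> (g \<star> h) \<gamma> \<delta> = 0"
proof -
  show "(g \<star> h) \<gamma> = 0" if "\<gamma> \<notin> Arr G"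
    using that cmp_Arr unfolding conv_def by (intro sum.neutral) auto
  show "(g \<star> h) \<gamma> \<delta> = 0" if "\<delta> \<notin> loops \<gamma>"
    using that
    by (subst conv_def, subst sum_fun_apply, intro sum.neutral) (auto simp: End_mult_def src_cmp)
qed

text \<open>A factorisation of \<open>\<gamma>\<close> is determined by its first arrow, which turns the convolution product into a
  sum over any finite set of arrows containing the relevant ones.\<close>

lemma conv_apply:
  assumes \<gamma>: "\<gamma> \<in> Arr G" and \<delta>: "\<delta> \<in> loops \<gamma>"
    and A: "finite A" "A \<subseteq> {\<alpha> \<in> Arr G. src G \<alpha> = src G \<gamma>}"
    and supp: "\<And>\<alpha>. \<alpha> \<in> Arr G \<Longrightarrow> src G \<alpha> = src G \<gamma> \<Longrightarrow> g \<alpha> \<noteq> 0 \<Longrightarrow> h (cmp G \<gamma> (ivs G \<alpha>)) \<noteq> 0 \<Longrightarrow> \<alpha> \<in> A"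
    and g0: "\<And>\<alpha>. \<alpha> \<in> A \<Longrightarrow> g \<alpha> \<delta> 0 = 0"
  shows "(g \<star> h) \<gamma> \<delta> w = (\<Sum>\<alpha>\<in>A. g \<alpha> \<delta> (h (cmp G \<gamma> (ivs G \<alpha>)) (conj_arr G \<alpha> \<delta>) w))"
proof -
  let ?P = "{(\<alpha>, \<beta>). \<alpha> \<in> Arr G \<and> \<beta> \<in> Arr G \<and> tgt G \<alpha> = src G \<beta>
        \<and> cmp G \<beta> \<alpha> = \<gamma> \<and> g \<alpha> \<noteq> 0 \<and> h \<beta> \<noteq> 0}"
  let ?B = "{\<alpha> \<in> Arr G. src G \<alpha> = src G \<gamma> \<and> g \<alpha> \<noteq> 0 \<and> h (cmp G \<gamma> (ivs G \<alpha>)) \<noteq> 0}"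
  let ?p = "\<lambda>\<alpha>. (\<alpha>, cmp G \<gamma> (ivs G \<alpha>))"
  have P: "?P = ?p ` ?B"
  proof (intro equalityI subsetI)
    fix p assume "p \<in> ?P"
    then obtain \<alpha> \<beta> where p: "p = (\<alpha>, \<beta>)" "\<alpha> \<in> Arr G" "\<beta> \<in> Arr G" "tgt G \<alpha> = src G \<beta>"
      "cmp G \<beta> \<alpha> = \<gamma>" "g \<alpha> \<noteq> 0" "h \<beta> \<noteq> 0" by blast
    then have "\<beta> = cmp G \<gamma> (ivs G \<alpha>)" "src G \<alpha> = src G \<gamma>" using cmp_div src_cmp by auto
    then show "p \<in> ?p ` ?B" using p by blast
  next
    fix p assume "p \<in> ?p ` ?B"
    then show "p \<in> ?P" using div_Arr \<gamma> by auto
  qed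
  have "(g \<star> h) \<gamma> \<delta> w = (\<Sum>(\<alpha>, \<beta>)\<in>?P. End_mult G \<alpha> (g \<alpha>) (h \<beta>) \<delta> w)"
    by (simp add: conv_def sum_fun_apply split_def)
  also have "\<dots> = (\<Sum>\<alpha>\<in>?B. End_mult G \<alpha> (g \<alpha>) (h (cmp G \<gamma> (ivs G \<alpha>))) \<delta> w)"
    unfolding P by (subst sum.reindex) (auto simp: inj_on_def)
  also have "\<dots> = (\<Sum>\<alpha>\<in>?B. g \<alpha> \<delta> (h (cmp G \<gamma> (ivs G \<alpha>)) (conj_arr G \<alpha> \<delta>) w))"
    using \<delta> by (intro sum.cong refl) (auto simp: End_mult_def)
  also have "\<dots> = (\<Sum>\<alpha>\<in>A. g \<alpha> \<delta> (h (cmp G \<gamma> (ivs G \<alpha>)) (conj_arr G \<alpha> \<delta>) w))"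
  proof (rule sum.mono_neutral_left[OF A(1)])
    show "?B \<subseteq> A" using supp by blast
    show "\<forall>\<alpha>\<in>A - ?B. g \<alpha> \<delta> (h (cmp G \<gamma> (ivs G \<alpha>)) (conj_arr G \<alpha> \<delta>) w) = 0"
    proof
      fix \<alpha> assume "\<alpha> \<in> A - ?B"
      then have "g \<alpha> = 0 \<or> h (cmp G \<gamma> (ivs G \<alpha>)) = 0" using A(2) by blast
      then show "g \<alpha> \<delta> (h (cmp G \<gamma> (ivs G \<alpha>)) (conj_arr G \<alpha> \<delta>) w) = 0"
        using g0[of \<alpha>] \<open>\<alpha> \<in> A - ?B\<close> by auto
    qed
  qed
  finally show ?thesis .
qed

lemma conv_apply_alg:
  assumes "g \<in> alg" "\<gamma> \<in> Arr G" "\<delta> \<in> loops \<gamma>"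
    and "finite A" "A \<subseteq> {\<alpha> \<in> Arr G. src G \<alpha> = src G \<gamma>}"
    and "\<And>\<alpha>. \<alpha> \<in> Arr G \<Longrightarrow> src G \<alpha> = src G \<gamma> \<Longrightarrow> g \<alpha> \<noteq> 0 \<Longrightarrow> \<alpha> \<in> A"
  shows "(g \<star> h) \<gamma> \<delta> w = (\<Sum>\<alpha>\<in>A. g \<alpha> \<delta> (h (cmp G \<gamma> (ivs G \<alpha>)) (conj_arr G \<alpha> \<delta>) w))"
proof (rule conv_apply)
  show "g \<alpha> \<delta> 0 = 0" if "\<alpha> \<in> A" for \<alpha>
    using that assms(3,5) by (intro lin_map_0[OF alg_lin_map[OF assms(1)]]) auto
qed (use assms in auto)

lemma conv_closed:
  assumes g: "g \<in> alg" and h: "h \<in> alg"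
  shows "g \<star> h \<in> alg"
  unfolding conv_alg_def mem_Collect_eq
proof (intro conjI ballI allI impI)
  fix \<gamma> assume \<gamma>: "\<gamma> \<in> Arr G"
  let ?A = "{\<alpha> \<in> Arr G. src G \<alpha> = src G \<gamma> \<and> g \<alpha> \<noteq> 0}"
  have A: "finite ?A" using alg_finite(1)[OF g src_Ob[OF \<gamma>]] .
  have app: "(g \<star> h) \<gamma> \<delta> = (\<Sum>\<alpha>\<in>?A. g \<alpha> \<delta> \<circ> h (cmp G \<gamma> (ivs G \<alpha>)) (conj_arr G \<alpha> \<delta>))"
    if "\<delta> \<in> loops \<gamma>" for \<delta>
    by (rule ext, subst conv_apply_alg[OF g \<gamma> that A]) (auto simp: sum_fun_apply)
  have lin: "(g \<star> h) \<gamma> \<delta> \<in> lin_maps scw scw (W (conj_arr G \<gamma> \<delta>)) (W \<delta>)"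
    if \<delta>: "\<delta> \<in> loops \<gamma>" for \<delta>
    unfolding app[OF \<delta>]
  proof (rule lin_maps_sum_closed)
    fix \<alpha> assume \<alpha>: "\<alpha> \<in> ?A"
    let ?\<beta> = "cmp G \<gamma> (ivs G \<alpha>)"
    note d = div_Arr[of \<alpha> \<gamma>]
    have \<beta>: "?\<beta> \<in> Arr G" "src G ?\<beta> = tgt G \<alpha>" "cmp G ?\<beta> \<alpha> = \<gamma>" using d \<alpha> \<gamma> by auto
    have "conj_arr G \<alpha> \<delta> \<in> loops ?\<beta>"
      using conj_arr_hom_set[of \<alpha> \<delta>] \<alpha> \<delta> \<beta> by auto
    moreover have "conj_arr G ?\<beta> (conj_arr G \<alpha> \<delta>) = conj_arr G \<gamma> \<delta>"
      using conj_arr_comp[of \<alpha> ?\<beta> \<delta>] \<beta> \<alpha> \<delta> by auto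
    ultimately have "h ?\<beta> (conj_arr G \<alpha> \<delta>) \<in> lin_maps scw scw (W (conj_arr G \<gamma> \<delta>)) (W (conj_arr G \<alpha> \<delta>))"
      using alg_lin_map[OF h \<beta>(1)] by metis
    then show "g \<alpha> \<delta> \<circ> h ?\<beta> (conj_arr G \<alpha> \<delta>) \<in> lin_maps scw scw (W (conj_arr G \<gamma> \<delta>)) (W \<delta>)"
      by (rule lin_maps_comp[rotated]) (use alg_lin_map[OF g] \<alpha> \<delta> in auto)
  qed
  have "finite (\<Union>\<alpha>\<in>?A. {\<delta>. g \<alpha> \<delta> \<noteq> 0})"
    using A g by (auto simp: conv_alg_def End_comp_def)
  moreover have "{\<delta>. (g \<star> h) \<gamma> \<delta> \<noteq> 0} \<subseteq> (\<Union>\<alpha>\<in>?A. {\<delta>. g \<alpha> \<delta> \<noteq> 0})"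
  proof
    fix \<delta> assume d: "\<delta> \<in> {\<delta>. (g \<star> h) \<gamma> \<delta> \<noteq> 0}"
    then have \<delta>: "\<delta> \<in> loops \<gamma>" using conv_outside(2) by blast
    show "\<delta> \<in> (\<Union>\<alpha>\<in>?A. {\<delta>. g \<alpha> \<delta> \<noteq> 0})"
    proof (rule ccontr)
      assume "\<not> ?thesis"
      then have "g \<alpha> \<delta> \<circ> f = 0" if "\<alpha> \<in> ?A" for \<alpha> and f :: "'w \<Rightarrow> 'w" using that by (auto simp: fun_eq_iff)
      then have "(g \<star> h) \<gamma> \<delta> = 0" unfolding app[OF \<delta>] by (intro sum.neutral ballI)
      then show False using d by blast
    qed
  qed
  ultimately show "(g \<star> h) \<gamma> \<in> End_comp G scw W \<gamma>"
    using lin conv_outside(2) finite_subset by (auto simp: End_comp_def)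
next
  fix a assume a: "a \<in> Ob G"
  let ?S = "\<lambda>g a. {\<alpha> \<in> Arr G. src G \<alpha> = a \<and> g \<alpha> \<noteq> 0}"
  let ?T = "\<lambda>g a. {\<alpha> \<in> Arr G. tgt G \<alpha> = a \<and> g \<alpha> \<noteq> 0}"
  have "finite (\<Union>\<alpha>\<in>?S g a. (\<lambda>\<beta>. cmp G \<beta> \<alpha>) ` ?S h (tgt G \<alpha>))"
    "finite (\<Union>\<beta>\<in>?T h a. cmp G \<beta> ` ?T g (src G \<beta>))"
    using alg_finite[OF g] alg_finite[OF h] a by (auto simp: src_Ob tgt_Ob)
  moreover have "{\<gamma> \<in> Arr G. (src G \<gamma> = a \<or> tgt G \<gamma> = a) \<and> (g \<star> h) \<gamma> \<noteq> 0}
    \<subseteq> (\<Union>\<alpha>\<in>?S g a. (\<lambda>\<beta>. cmp G \<beta> \<alpha>) ` ?S h (tgt G \<alpha>)) \<union> (\<Union>\<beta>\<in>?T h a. cmp G \<beta> ` ?T g (src G \<beta>))"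
  proof
    fix \<gamma> assume \<gamma>: "\<gamma> \<in> {\<gamma> \<in> Arr G. (src G \<gamma> = a \<or> tgt G \<gamma> = a) \<and> (g \<star> h) \<gamma> \<noteq> 0}"
    have "\<exists>\<alpha> \<beta>. \<alpha> \<in> Arr G \<and> \<beta> \<in> Arr G \<and> tgt G \<alpha> = src G \<beta> \<and> cmp G \<beta> \<alpha> = \<gamma> \<and> g \<alpha> \<noteq> 0 \<and> h \<beta> \<noteq> 0"
    proof (rule ccontr)
      assume "\<not> ?thesis"
      then have "(g \<star> h) \<gamma> = 0" unfolding conv_def by (intro sum.neutral) blast
      then show False using \<gamma> by blast
    qed
    then obtain \<alpha> \<beta> where "\<alpha> \<in> Arr G" "\<beta> \<in> Arr G" "tgt G \<alpha> = src G \<beta>" "\<gamma> = cmp G \<beta> \<alpha>" "g \<alpha> \<noteq> 0" "h \<beta> \<noteq> 0"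
      by blast
    moreover from this have "src G \<gamma> = src G \<alpha>" "tgt G \<gamma> = tgt G \<beta>" by (auto simp: src_cmp tgt_cmp)
    moreover have "src G \<gamma> = a \<or> tgt G \<gamma> = a" using \<gamma> by blast
    ultimately show "\<gamma> \<in> (\<Union>\<alpha>\<in>?S g a. (\<lambda>\<beta>. cmp G \<beta> \<alpha>) ` ?S h (tgt G \<alpha>)) \<union> (\<Union>\<beta>\<in>?T h a. cmp G \<beta> ` ?T g (src G \<beta>))"
      by auto
  qed
  ultimately show "finite {\<gamma> \<in> Arr G. (src G \<gamma> = a \<or> tgt G \<gamma> = a) \<and> (g \<star> h) \<gamma> \<noteq> 0}"
    by (meson finite_Un finite_subset)
qed (simp add: conv_outside(1))

text \<open>Both sides are the sum over the factorisations of \<open>\<gamma>\<close> into three arrows.\<close>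

lemma conv_assoc:
  assumes g: "g \<in> alg" and k: "k \<in> alg" and h: "h \<in> alg"
  shows "(g \<star> k) \<star> h = g \<star> (k \<star> h)"
proof (rule alg_eqI)
  fix \<gamma> \<delta> w
  assume \<gamma>: "\<gamma> \<in> Arr G" and \<delta>: "\<delta> \<in> loops \<gamma>"
  define A where "A = {\<alpha> \<in> Arr G. src G \<alpha> = src G \<gamma> \<and> g \<alpha> \<noteq> 0}"
  define B where "B \<alpha> = {\<beta> \<in> Arr G. src G \<beta> = tgt G \<alpha> \<and> k \<beta> \<noteq> 0}" for \<alpha>
  \<comment> \<open>A finite set containing the support of \<open>g \<star> k\<close> among the arrows with the source of \<open>\<gamma>\<close>.\<close>
  define C where "C = (\<Union>\<alpha>\<in>A. (\<lambda>\<beta>. cmp G \<beta> \<alpha>) ` B \<alpha>)"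
  have A: "finite A" "A \<subseteq> {\<alpha> \<in> Arr G. src G \<alpha> = src G \<gamma>}"
    using alg_finite(1)[OF g src_Ob[OF \<gamma>]] by (auto simp: A_def)
  have B: "finite (B \<alpha>)" if "\<alpha> \<in> A" for \<alpha>
    using alg_finite(1)[OF k, of "tgt G \<alpha>"] that by (auto simp: A_def B_def tgt_Ob)
  have C: "finite C" "C \<subseteq> {\<alpha> \<in> Arr G. src G \<alpha> = src G \<gamma>}"
    using A(1) B by (auto simp: C_def) (auto simp: A_def B_def cmp_Arr src_cmp)
  define X where "X \<alpha> \<beta> = g \<alpha> \<delta> (k \<beta> (conj_arr G \<alpha> \<delta>)
    (h (cmp G (cmp G \<gamma> (ivs G \<alpha>)) (ivs G \<beta>)) (conj_arr G \<beta> (conj_arr G \<alpha> \<delta>)) w))" for \<alpha> \<beta>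
  have "(g \<star> (k \<star> h)) \<gamma> \<delta> w = (\<Sum>\<alpha>\<in>A. \<Sum>\<beta>\<in>B \<alpha>. X \<alpha> \<beta>)"
    unfolding conv_apply_alg[OF g \<gamma> \<delta> A, of "k \<star> h" w, unfolded A_def, simplified, folded A_def]
  proof (intro sum.cong refl)
    fix \<alpha> assume \<alpha>: "\<alpha> \<in> A"
    let ?\<beta> = "cmp G \<gamma> (ivs G \<alpha>)"
    have \<alpha>': "\<alpha> \<in> Arr G" "src G \<alpha> = src G \<gamma>" using \<alpha> by (auto simp: A_def)
    have \<beta>: "?\<beta> \<in> Arr G" "src G ?\<beta> = tgt G \<alpha>" using div_Arr[OF \<alpha>'(1) \<gamma> \<alpha>'(2)] by auto
    have c: "conj_arr G \<alpha> \<delta> \<in> hom_set G (tgt G \<alpha>) (tgt G \<alpha>)"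
      using conj_arr_hom_set \<alpha>' \<delta> by auto
    have "(k \<star> h) ?\<beta> (conj_arr G \<alpha> \<delta>) w = (\<Sum>\<beta>\<in>B \<alpha>. k \<beta> (conj_arr G \<alpha> \<delta>)
      (h (cmp G ?\<beta> (ivs G \<beta>)) (conj_arr G \<beta> (conj_arr G \<alpha> \<delta>)) w))"
      using B[OF \<alpha>] c \<beta> by (intro conv_apply_alg[OF k \<beta>(1)]) (auto simp: B_def)
    moreover have "k \<beta> (conj_arr G \<alpha> \<delta>) u \<in> W (conj_arr G \<alpha> \<delta>)" if "\<beta> \<in> B \<alpha>" for \<beta> u
      using that c by (intro lin_map_in[OF alg_lin_map[OF k]]) (auto simp: B_def)
    moreover have "g \<alpha> \<delta> \<in> lin_maps scw scw (W (conj_arr G \<alpha> \<delta>)) (W \<delta>)"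
      using alg_lin_map[OF g \<alpha>'(1)] \<alpha>'(2) \<delta> by simp
    ultimately show "g \<alpha> \<delta> ((k \<star> h) ?\<beta> (conj_arr G \<alpha> \<delta>) w) = (\<Sum>\<beta>\<in>B \<alpha>. X \<alpha> \<beta>)"
      by (simp add: lin_map_sum X_def)
  qed
  moreover have "((g \<star> k) \<star> h) \<gamma> \<delta> w = (\<Sum>\<alpha>\<in>A. \<Sum>\<beta>\<in>B \<alpha>. X \<alpha> \<beta>)"
  proof -
    define Y where "Y \<alpha> c = g \<alpha> \<delta> (k (cmp G c (ivs G \<alpha>)) (conj_arr G \<alpha> \<delta>)
      (h (cmp G \<gamma> (ivs G c)) (conj_arr G c \<delta>) w))" for \<alpha> c
    have supp: "c \<in> C" if c: "c \<in> Arr G" "src G c = src G \<gamma>" "(g \<star> k) c \<noteq> 0" for c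
    proof (rule ccontr)
      assume nC: "c \<notin> C"
      have "c \<in> C" if "\<alpha> \<in> Arr G" "\<beta> \<in> Arr G" "tgt G \<alpha> = src G \<beta>" "cmp G \<beta> \<alpha> = c" "g \<alpha> \<noteq> 0" "k \<beta> \<noteq> 0"
        for \<alpha> \<beta>
      proof -
        have "\<alpha> \<in> A" "\<beta> \<in> B \<alpha>" using that c src_cmp by (auto simp: A_def B_def)
        then show ?thesis using that(4) by (auto simp: C_def)
      qed
      then have "{(\<alpha>, \<beta>). \<alpha> \<in> Arr G \<and> \<beta> \<in> Arr G \<and> tgt G \<alpha> = src G \<beta>
        \<and> cmp G \<beta> \<alpha> = c \<and> g \<alpha> \<noteq> 0 \<and> k \<beta> \<noteq> 0} = {}"
        using nC by blast
      then have "(g \<star> k) c = 0" unfolding conv_def by (simp only: sum.empty)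
      then show False using c(3) by blast
    qed
    have "((g \<star> k) \<star> h) \<gamma> \<delta> w = (\<Sum>c\<in>C. (g \<star> k) c \<delta> (h (cmp G \<gamma> (ivs G c)) (conj_arr G c \<delta>) w))"
      using supp by (intro conv_apply_alg[OF conv_closed[OF g k] \<gamma> \<delta> C]) auto
    also have "\<dots> = (\<Sum>c\<in>C. \<Sum>\<alpha>\<in>A. Y \<alpha> c)"
    proof (intro sum.cong refl)
      fix c assume "c \<in> C"
      then have c: "c \<in> Arr G" "src G c = src G \<gamma>" using C by auto
      show "(g \<star> k) c \<delta> (h (cmp G \<gamma> (ivs G c)) (conj_arr G c \<delta>) w) = (\<Sum>\<alpha>\<in>A. Y \<alpha> c)"
        unfolding Y_def using A c \<delta> by (intro conv_apply_alg[OF g c(1)]) (auto simp: A_def)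
    qed
    also have "\<dots> = (\<Sum>\<alpha>\<in>A. \<Sum>c\<in>C. Y \<alpha> c)"
      by (rule sum.swap)
    also have "\<dots> = (\<Sum>\<alpha>\<in>A. \<Sum>\<beta>\<in>B \<alpha>. X \<alpha> \<beta>)"
    proof (rule sum.cong[OF refl])
      fix \<alpha> assume \<alpha>: "\<alpha> \<in> A"
      have \<alpha>': "\<alpha> \<in> Arr G" "src G \<alpha> = src G \<gamma>" using \<alpha> by (auto simp: A_def)
      let ?h = "\<lambda>\<beta>. cmp G \<beta> \<alpha>"
      have g\<alpha>: "g \<alpha> \<delta> 0 = 0" using lin_map_0[OF alg_lin_map[OF g \<alpha>'(1)]] \<alpha>'(2) \<delta> by simp
      have "(\<Sum>c\<in>C. Y \<alpha> c) = (\<Sum>c\<in>?h ` B \<alpha>. Y \<alpha> c)"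
      proof (rule sum.mono_neutral_right[OF C(1)])
        show "?h ` B \<alpha> \<subseteq> C" using \<alpha> by (auto simp: C_def)
        show "\<forall>c\<in>C - ?h ` B \<alpha>. Y \<alpha> c = 0"
        proof
          fix c assume c: "c \<in> C - ?h ` B \<alpha>"
          then have cA: "c \<in> Arr G" "src G c = src G \<gamma>" using C by auto
          have "k (cmp G c (ivs G \<alpha>)) = 0"
            using c div_Arr[OF \<alpha>'(1) cA(1)] \<alpha>'(2) cA(2) by (auto simp: B_def image_iff)
          then show "Y \<alpha> c = 0" by (simp add: Y_def g\<alpha>)
        qed
      qed
      also have "\<dots> = (\<Sum>\<beta>\<in>B \<alpha>. Y \<alpha> (?h \<beta>))"
      proof (rule sum.reindex_cong[OF _ refl refl])
        show "inj_on ?h (B \<alpha>)"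
          using cmp_right_cancel[OF \<alpha>'(1)] by (auto simp: inj_on_def B_def)
      qed
      also have "\<dots> = (\<Sum>\<beta>\<in>B \<alpha>. X \<alpha> \<beta>)"
      proof (intro sum.cong refl)
        fix \<beta> assume "\<beta> \<in> B \<alpha>"
        then have \<beta>: "\<beta> \<in> Arr G" "tgt G \<alpha> = src G \<beta>" by (auto simp: B_def)
        have "cmp G \<gamma> (cmp G (ivs G \<alpha>) (ivs G \<beta>)) = cmp G (cmp G \<gamma> (ivs G \<alpha>)) (ivs G \<beta>)"
          using \<alpha>' \<beta> \<gamma> by (intro cmp_assoc) (simp_all add: ivs_Arr src_ivs tgt_ivs)
        then show "Y \<alpha> (?h \<beta>) = X \<alpha> \<beta>"
          using \<alpha>' \<beta> \<delta> by (simp add: X_def Y_def cmp_div ivs_cmp conj_arr_comp)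
      qed
      finally show "(\<Sum>c\<in>C. Y \<alpha> c) = (\<Sum>\<beta>\<in>B \<alpha>. X \<alpha> \<beta>)" .
    qed
    finally show ?thesis .
  qed
  ultimately show "((g \<star> k) \<star> h) \<gamma> \<delta> w = (g \<star> (k \<star> h)) \<gamma> \<delta> w" by simp
qed (use g k h in \<open>auto intro: conv_closed\<close>)

lemma conv_one_left:
  assumes g: "g \<in> alg"
  shows "conv_one G W \<star> g = g"
proof (intro ext)
  fix \<gamma> \<delta> w
  consider "\<gamma> \<notin> Arr G" | "\<gamma> \<in> Arr G" "\<delta> \<notin> loops \<gamma>"
    | "\<gamma> \<in> Arr G" "\<delta> \<in> loops \<gamma>" by blast
  then show "(conv_one G W \<star> g) \<gamma> \<delta> w = g \<gamma> \<delta> w"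
  proof cases
    case 3
    let ?a = "src G \<gamma>"
    have a: "?a \<in> Ob G" using 3 src_Ob by auto
    have "(conv_one G W \<star> g) \<gamma> \<delta> w
      = (\<Sum>\<alpha>\<in>{idt G ?a}. conv_one G W \<alpha> \<delta> (g (cmp G \<gamma> (ivs G \<alpha>)) (conj_arr G \<alpha> \<delta>) w))"
      by (rule conv_apply[OF 3])
        (use a in \<open>auto simp: conv_one_def idt_Arr src_idt fun_eq_iff split: if_splits\<close>)
    also have "\<dots> = conv_one G W (idt G ?a) \<delta> (g \<gamma> \<delta> w)"
      using 3 a by (simp add: ivs_idt conj_arr_idt cmp_idt_right)
    also have "\<dots> = g \<gamma> \<delta> w"
      using 3 a lin_map_in[OF alg_lin_map[OF g 3]] by (simp add: conv_one_def src_idt)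
    finally show ?thesis .
  qed (use g in \<open>auto simp: conv_outside conv_alg_def End_comp_def\<close>)
qed

lemma conv_one_right:
  assumes g: "g \<in> alg"
  shows "g \<star> conv_one G W = g"
proof (intro ext)
  fix \<gamma> \<delta> w
  consider "\<gamma> \<notin> Arr G" | "\<gamma> \<in> Arr G" "\<delta> \<notin> loops \<gamma>"
    | "\<gamma> \<in> Arr G" "\<delta> \<in> loops \<gamma>" by blast
  then show "(g \<star> conv_one G W) \<gamma> \<delta> w = g \<gamma> \<delta> w"
  proof cases
    case 3
    note lin = alg_lin_map[OF g 3]
    have b: "tgt G \<gamma> \<in> Ob G" using 3 tgt_Ob by auto
    have supp: "\<alpha> \<in> {\<gamma>}" if \<alpha>: "\<alpha> \<in> Arr G" "src G \<alpha> = src G \<gamma>"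
      "conv_one G W (cmp G \<gamma> (ivs G \<alpha>)) \<noteq> 0" for \<alpha>
    proof -
      let ?\<beta> = "cmp G \<gamma> (ivs G \<alpha>)"
      note d = div_Arr[OF \<alpha>(1) 3(1) \<alpha>(2)]
      obtain c where c: "c \<in> Ob G" "?\<beta> = idt G c"
        using \<alpha>(3) by (auto simp: conv_one_def fun_eq_iff split: if_splits)
      then have "c = tgt G \<alpha>" using d(2) src_idt[OF c(1)] by metis
      then have "cmp G ?\<beta> \<alpha> = \<alpha>" using cmp_idt_left[OF \<alpha>(1)] c(2) by metis
      then show ?thesis using d(4) by (metis singletonI)
    qed
    have "(g \<star> conv_one G W) \<gamma> \<delta> w
      = (\<Sum>\<alpha>\<in>{\<gamma>}. g \<alpha> \<delta> (conv_one G W (cmp G \<gamma> (ivs G \<alpha>)) (conj_arr G \<alpha> \<delta>) w))"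
      using 3 supp lin_map_0[OF lin] by (intro conv_apply[OF 3]) auto
    also have "\<dots> = g \<gamma> \<delta> (conv_one G W (idt G (tgt G \<gamma>)) (conj_arr G \<gamma> \<delta>) w)"
      using 3 by (simp add: ivs_right)
    also have "\<dots> = g \<gamma> \<delta> w"
      using b conj_arr_hom_set[OF 3] lin_map_0[OF lin] lin_map_outside[OF lin]
      by (auto simp: conv_one_def src_idt)
    finally show ?thesis .
  qed (use g in \<open>auto simp: conv_outside conv_alg_def End_comp_def\<close>)
qed

text \<open>The unit is concentrated on identity arrows, whose conjugation action is trivial.\<close>

lemma conv_eq_one:
  assumes g: "g \<in> alg" and h: "h \<in> alg"
    and eq: "\<And>\<gamma> \<delta> w. \<gamma> \<in> Arr G \<Longrightarrow> \<delta> \<in> loops \<gamma> \<Longrightarrow> w \<in> W (conj_arr G \<gamma> \<delta>) \<Longrightarrow>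
      (g \<star> h) \<gamma> \<delta> w = (if \<gamma> = idt G (src G \<gamma>) then w else 0)"
  shows "g \<star> h = conv_one G W"
proof (intro ext)
  fix \<gamma> \<delta> w
  consider "\<gamma> \<notin> Arr G" | "\<gamma> \<in> Arr G" "\<delta> \<notin> loops \<gamma>"
    | "\<gamma> \<in> Arr G" "\<delta> \<in> loops \<gamma>" by blast
  then show "(g \<star> h) \<gamma> \<delta> w = conv_one G W \<gamma> \<delta> w"
  proof cases
    case 1
    then have "\<gamma> \<notin> idt G ` Ob G" using idt_Arr by blast
    then show ?thesis using 1 by (simp add: conv_outside conv_one_def)
  next
    case 2
    then show ?thesis by (simp add: conv_outside conv_one_def)
  next
    case 3
    have id: "\<gamma> \<in> idt G ` Ob G \<longleftrightarrow> \<gamma> = idt G (src G \<gamma>)"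
      using 3 src_Ob src_idt by auto
    have conj: "conj_arr G \<gamma> \<delta> = \<delta>" if "\<gamma> = idt G (src G \<gamma>)"
      using conj_arr_idt[OF 3(2)] that by simp
    show ?thesis
    proof (cases "w \<in> W (conj_arr G \<gamma> \<delta>)")
      case True
      then show ?thesis using eq[OF 3 True] conj 3(2) by (auto simp: conv_one_def id)
    next
      case False
      then have "(g \<star> h) \<gamma> \<delta> w = 0"
        using lin_map_outside[OF alg_lin_map[OF conv_closed[OF g h] 3]] by blast
      then show ?thesis using False conj by (auto simp: conv_one_def id)
    qed
  qed
qed

lemma conv_inverse_eq:
  assumes "is_conv_inverse G scw W g k"
  shows "conv_inverse G scw W g = k"
  unfolding conv_inverse_def
proof (rule the_equality)
  fix k' assume k': "is_conv_inverse G scw W g k'"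
  have alg: "g \<in> alg" "k \<in> alg" "k' \<in> alg" and gk: "g \<star> k = conv_one G W" and kg: "k' \<star> g = conv_one G W"
    using assms k' by (auto simp: is_conv_inverse_def)
  have "k' = k' \<star> (g \<star> k)" using alg gk by (simp add: conv_one_right)
  also have "\<dots> = (k' \<star> g) \<star> k" using alg by (simp add: conv_assoc)
  also have "\<dots> = k" using alg kg by (simp add: conv_one_left)
  finally show "k' = k" .
qed (rule assms)

text \<open>An element that commutes with \<open>g\<close> commutes with the inverse of \<open>g\<close>.\<close>

lemma log_derivative_commutes:
  assumes inv: "is_conv_inverse G scw W g k" and d: "d \<in> alg" and m: "m \<in> alg"
    and gm: "g \<star> m = m \<star> g" and dm: "d \<star> m = m \<star> d"
  shows "(k \<star> d) \<star> m = m \<star> (k \<star> d)"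
proof -
  have g: "g \<in> alg" and k: "k \<in> alg" and gk: "g \<star> k = conv_one G W" and kg: "k \<star> g = conv_one G W"
    using inv by (auto simp: is_conv_inverse_def)
  have "k \<star> m = (k \<star> m) \<star> (g \<star> k)"
    using k m conv_closed gk conv_one_right by metis
  also have "\<dots> = (k \<star> (m \<star> g)) \<star> k"
    using k m g conv_closed by (simp add: conv_assoc)
  also have "\<dots> = ((k \<star> g) \<star> m) \<star> k"
    using k m g by (simp add: conv_assoc flip: gm)
  also have "\<dots> = m \<star> k"
    using kg m conv_one_left by simp
  finally have km: "k \<star> m = m \<star> k" .
  have "(k \<star> d) \<star> m = k \<star> (m \<star> d)" using k d m by (simp add: conv_assoc dm)
  also have "\<dots> = (m \<star> k) \<star> d" using k d m by (simp add: conv_assoc flip: km)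
  also have "\<dots> = m \<star> (k \<star> d)" using k d m by (simp add: conv_assoc)
  finally show ?thesis .
qed

end


section \<open>The transfer matrix in coordinates\<close>

context graded_space
begin

lemma prepend_zero [simp]: "prepend c f [] = (if c = [] then f [] else 0)"
  by (auto simp: prepend_def)

lemma prepend_Cons [simp]: "prepend [c] f (d # l) = (if d = c then f l else 0)"
  by (simp add: prepend_def)

lemma prepend_linear: "prepend p (\<lambda>l. f l + c * g l) = (\<lambda>l. prepend p f l + c * prepend p g l)"
  by (auto simp: prepend_def)

lemma prepend_sum: "prepend p (\<lambda>l. \<Sum>i\<in>I. g i l) = (\<lambda>l. \<Sum>i\<in>I. prepend p (g i) l)"
  by (auto simp: prepend_def)

lemma basis_paths_append:
  assumes "p \<in> basis_paths m \<gamma>" "l \<in> basis_paths n \<eta>" "tgt G \<gamma> = src G \<eta>"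
  shows "p @ l \<in> basis_paths (m + n) (cmp G \<eta> \<gamma>)"
proof -
  have p: "is_path G (map fst p)" "path_cmp G (map fst p) = \<gamma>"
    and l: "is_path G (map fst l)" "path_cmp G (map fst l) = \<eta>"
    using assms(1,2) by (auto simp: basis_paths_def)
  have ne: "map fst p \<noteq> []" "map fst l \<noteq> []" using p(1) l(1) path_nonempty by blast+
  have "is_path G (map fst p @ map fst l)"
    using is_path_append[OF ne] p l path_cmp_Arr[OF p(1)] path_cmp_Arr[OF l(1)] assms(3) by simp
  then show ?thesis
    using assms(1,2) path_cmp_append[OF ne] p l by (simp add: basis_paths_def)
qed

lemma prepend_on_paths:
  assumes "p \<in> basis_paths m \<gamma>" "on_paths n \<eta> h = h" "tgt G \<gamma> = src G \<eta>"
  shows "on_paths (m + n) (cmp G \<eta> \<gamma>) (prepend p h) = prepend p h"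
proof
  fix l
  show "on_paths (m + n) (cmp G \<eta> \<gamma>) (prepend p h) l = prepend p h l"
  proof (cases "prepend p h l = 0")
    case False
    then have l: "take (length p) l = p" "h (drop (length p) l) \<noteq> 0"
      by (auto simp: prepend_def split: if_splits)
    have "on_paths n \<eta> h (drop (length p) l) \<noteq> 0" using l(2) assms(2) by simp
    then have "drop (length p) l \<in> basis_paths n \<eta>" by (auto simp: on_paths_def split: if_splits)
    then have "take (length p) l @ drop (length p) l \<in> basis_paths (m + n) (cmp G \<eta> \<gamma>)"
      using basis_paths_append[OF assms(1) _ assms(3)] l(1) by simp
    then show ?thesis by (simp add: on_paths_def)
  qed (simp add: on_paths_def)
qed

lemma basis_arrow_path: "\<alpha> \<in> Arr G \<Longrightarrow> e \<in> basis \<alpha> \<Longrightarrow> [(\<alpha>, e)] \<in> basis_paths 1 \<alpha>"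
  by (simp add: basis_paths_def basis_arrows_def)

text \<open>The argument of the monodromy in the partial trace.\<close>

lemma prepend_tensor:
  assumes "\<alpha> \<in> Arr G" "e \<in> basis \<alpha>" "w \<in> TP n \<eta>" "\<eta> \<in> Arr G" "src G \<eta> = tgt G \<alpha>"
  shows "tensor_prod 1 (pt [(\<alpha>, e)]) w \<in> TP (Suc n) (cmp G \<eta> \<alpha>)"
    "coord (tensor_prod 1 (pt [(\<alpha>, e)]) w) = prepend [(\<alpha>, e)] (coord w)"
proof -
  let ?c = "(\<alpha>, e)"
  have w: "w \<chi>s = (\<Sum>l\<in>basis_paths n \<eta>. coord w l * pt l \<chi>s)" for \<chi>s
    using of_coord_apply[of n \<eta> "coord w" \<chi>s] of_coord_coord[OF assms(3)] by simp
  have "tensor_prod 1 (pt [?c]) w = (\<Sum>l\<in>basis_paths n \<eta>. tscale (coord w l) (pt (?c # l)))"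
  proof
    fix \<psi>s
    have "tensor_prod 1 (pt [?c]) w \<psi>s
      = pt [?c] (take 1 \<psi>s) * (\<Sum>l\<in>basis_paths n \<eta>. coord w l * pt l (drop 1 \<psi>s))"
      unfolding tensor_prod_def by (rule arg_cong[where f = "(*) (pt [?c] (take 1 \<psi>s))", OF w])
    also have "\<dots> = (\<Sum>l\<in>basis_paths n \<eta>. coord w l * (pt [?c] (take 1 \<psi>s) * pt l (drop 1 \<psi>s)))"
      unfolding sum_distrib_left by (rule sum.cong[OF refl], rule mult.left_commute)
    also have "\<dots> = (\<Sum>l\<in>basis_paths n \<eta>. coord w l * pt (?c # l) \<psi>s)"
    proof (rule sum.cong[OF refl])
      fix l
      have "pt (?c # l) \<psi>s = pt [?c] (take 1 \<psi>s) * pt l (drop 1 \<psi>s)"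
        using fun_cong[OF pt_append_tensor_prod[of "[?c]" l], of \<psi>s]
        unfolding tensor_prod_def append_Cons append_Nil list.size by simp
      then show "coord w l * (pt [?c] (take 1 \<psi>s) * pt l (drop 1 \<psi>s)) = coord w l * pt (?c # l) \<psi>s"
        by (simp only:)
    qed
    finally show "tensor_prod 1 (pt [?c]) w \<psi>s = (\<Sum>l\<in>basis_paths n \<eta>. tscale (coord w l) (pt (?c # l))) \<psi>s"
      by (simp add: sum_fun_apply tscale_def)
  qed
  then show "tensor_prod 1 (pt [?c]) w \<in> TP (Suc n) (cmp G \<eta> \<alpha>)"
    using basis_paths_append[OF basis_arrow_path[OF assms(1,2)], of _ n \<eta>] assms
    by (auto intro!: TP_sum TP_scale pt_in_TP)
  show "coord (tensor_prod 1 (pt [?c]) w) = prepend [?c] (coord w)"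
  proof
    fix l
    show "coord (tensor_prod 1 (pt [?c]) w) l = prepend [?c] (coord w) l"
    proof (cases l)
      case (Cons d l')
      show ?thesis
      proof (cases "set l \<subseteq> basis_arrows")
        case True
        have "pt [?c] (dual_list [d]) = (if [?c] = [d] then 1 else 0)"
          using assms True Cons by (intro pt_dual_list) (auto simp: basis_arrows_def)
        then show ?thesis
          using True Cons by (cases d) (auto simp: coord_def tensor_prod_def)
      next
        case False
        then show ?thesis using Cons assms by (auto simp: coord_def basis_arrows_def)
      qed
    qed (simp add: coord_def tensor_prod_def)
  qed
qed

text \<open>Only summands whose last arrow is \<open>\<alpha>\<close> survive, and for them the composite of the remaining
  arrows is \<open>\<delta>\<close> by cancellation.\<close>

lemma evaluate_last_slot:
  assumes t: "t \<in> TP (Suc n) (cmp G \<alpha> \<delta>)" and \<alpha>: "\<alpha> \<in> Arr G" and \<delta>: "\<delta> \<in> Arr G" "tgt G \<delta> = src G \<alpha>"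
    and n: "n \<ge> 1"
  shows "(\<lambda>\<psi>s. t (\<psi>s @ [(\<alpha>, \<phi>)])) \<in> TP n \<delta>"
proof -
  have len: "Suc n = length ([] :: ('a \<times> ('v \<Rightarrow> complex)) list) + n + length [(\<alpha>, \<phi>)]" by simp
  have "tscale (coord t l * pt (take 0 l) [] * pt (drop (0 + n) l) [(\<alpha>, \<phi>)]) (pt (take n (drop 0 l))) \<in> TP n \<delta>"
    if l: "l \<in> basis_paths (Suc n) (cmp G \<alpha> \<delta>)" for l
  proof (cases "pt (drop n l) [(\<alpha>, \<phi>)] = 0")
    case False
    then have d: "map fst (drop n l) = [\<alpha>]" using pt_nonzero[of "drop n l" "[(\<alpha>, \<phi>)]"] by simp
    have l': "length l = Suc n" "set l \<subseteq> basis_arrows" "is_path G (map fst l)" "path_cmp G (map fst l) = cmp G \<alpha> \<delta>"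
      using l by (auto simp: basis_paths_def)
    have eq: "map fst l = map fst (take n l) @ [\<alpha>]"
      using d by (metis append_take_drop_id map_append)
    have ne: "map fst (take n l) \<noteq> []" using l' n by auto
    have p: "is_path G (map fst (take n l))" "tgt G (last (map fst (take n l))) = src G \<alpha>"
      using l'(3) is_path_append[OF ne, of "[\<alpha>]"] unfolding eq by auto
    have "cmp G \<alpha> (path_cmp G (map fst (take n l))) = cmp G \<alpha> \<delta>"
      using l'(3,4) path_cmp_append[OF ne, of "[\<alpha>]"] unfolding eq by simp
    then have "path_cmp G (map fst (take n l)) = \<delta>"
      using cmp_left_cancel[of "path_cmp G (map fst (take n l))" \<delta> \<alpha>] path_cmp_Arr[OF p(1)] p(2) \<alpha> \<delta> by simp
    then have "take n l \<in> basis_paths n \<delta>"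
      using l' p(1) set_take_subset[of n l] by (auto simp: basis_paths_def)
    then show ?thesis by (auto intro!: TP_scale pt_in_TP)
  next
    case True
    then have "coord t l * pt (take 0 l) [] * pt (drop (0 + n) l) [(\<alpha>, \<phi>)] = 0" by simp
    then show ?thesis by (simp only: tv.scale_zero_left TP_zero)
  qed
  then have "(\<lambda>\<psi>s. t ([] @ \<psi>s @ [(\<alpha>, \<phi>)])) \<in> TP n \<delta>"
    unfolding slice_expand[OF t len] list.size by (intro TP_sum)
  then show ?thesis by simp
qed

lemma coord_slot_words:
  assumes "local_op T" "m \<le> n" "u \<in> TP (Suc n) \<gamma>"
  shows "fold (\<lambda>i. slot_op G sc V (Suc n) (R_check G sc V T x) i \<gamma>) [0..<m] u \<in> TP (Suc n) \<gamma> \<and>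
    coord (fold (\<lambda>i. slot_op G sc V (Suc n) (R_check G sc V T x) i \<gamma>) [0..<m] u) = train (local_mat T) x 0 m (coord u)"
  using assms(2)
proof (induction m)
  case (Suc m)
  let ?S = "\<lambda>i. slot_op G sc V (Suc n) (R_check G sc V T x) i \<gamma>"
  let ?u = "fold ?S [0..<m] u"
  have IH: "?u \<in> TP (Suc n) \<gamma>" "coord ?u = train (local_mat T) x 0 m (coord u)"
    using Suc by auto
  have m: "m + 1 < Suc n" using Suc.prems by simp
  note R = R_check_local_op[OF assms(1), of x]
  have "coord (?S m ?u) = act (local_mat (R_check G sc V T x)) m (on_paths (Suc n) \<gamma> (coord ?u))"
    using coord_slot_op[OF R m IH(1)] on_paths_coord[OF IH(1)] by simp
  also have "\<dots> = bax (local_mat T) x m (coord ?u)"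
    using act_R_check[OF assms(1) m, of x \<gamma> "coord ?u"] on_paths_coord[OF IH(1)] by simp
  finally show ?case using IH(2) slot_op_TP[OF R m] by simp
qed (use assms(3) in simp)

sublocale tp: graded_endo G tscale "TP n" for n
  by unfold_locales (rule TP_subspace)

text \<open>The finiteness conditions of the convolution algebra follow from finite type. The spaces at both
  \<open>\<alpha>\<close> and \<open>ivs G \<alpha>\<close> are allowed as supports, because the transfer matrix lives on the arrows with
  nonzero space and the inverse of its value at \<open>0\<close> on their inverses.\<close>

lemma alg_intro:
  assumes N: "N \<ge> 1"
    and lin: "\<And>\<alpha> \<delta>. \<alpha> \<in> Arr G \<Longrightarrow> \<delta> \<in> loops \<alpha> \<Longrightarrow>
      g \<alpha> \<delta> \<in> lin_maps tscale tscale (TP N (conj_arr G \<alpha> \<delta>)) (TP N \<delta>)"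
    and out: "\<And>\<alpha> \<delta>. \<delta> \<notin> loops \<alpha> \<Longrightarrow> g \<alpha> \<delta> = 0" "\<And>\<alpha>. \<alpha> \<notin> Arr G \<Longrightarrow> g \<alpha> = 0"
    and supp: "\<And>\<alpha>. \<alpha> \<in> Arr G \<Longrightarrow> V \<alpha> = {0} \<Longrightarrow> V (ivs G \<alpha>) = {0} \<Longrightarrow> g \<alpha> = 0"
  shows "g \<in> tp.alg N"
  unfolding conv_alg_def mem_Collect_eq
proof (intro conjI ballI allI impI)
  fix \<alpha> assume \<alpha>: "\<alpha> \<in> Arr G"
  let ?L = "{l. length l = N \<and> set l \<subseteq> basis_arrows \<and> is_path G (map fst l) \<and> src G (fst (hd l)) = src G \<alpha>}"
  have "{\<delta>. g \<alpha> \<delta> \<noteq> 0} \<subseteq> (\<lambda>l. path_cmp G (map fst l)) ` ?L"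
  proof
    fix \<delta> assume d: "\<delta> \<in> {\<delta>. g \<alpha> \<delta> \<noteq> 0}"
    then have \<delta>: "\<delta> \<in> loops \<alpha>" using out(1) by blast
    have "basis_paths N \<delta> \<noteq> {}"
    proof
      assume "basis_paths N \<delta> = {}"
      then have "of_coord N \<delta> f = 0" for f by (simp add: of_coord_def)
      then have "u = 0" if "u \<in> TP N \<delta>" for u using of_coord_coord[OF that] by metis
      then have "g \<alpha> \<delta> u = 0" for u using tp.lin_map_in[OF lin[OF \<alpha> \<delta>]] by blast
      then show False using d by (auto simp: fun_eq_iff)
    qed
    then obtain l where l: "l \<in> basis_paths N \<delta>" by blast
    then have p: "is_path G (map fst l)" "path_cmp G (map fst l) = \<delta>" by (auto simp: basis_paths_def)
    have "l \<noteq> []" using p path_nonempty by auto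
    then have "src G (fst (hd l)) = src G \<alpha>"
      using path_cmp_Arr(2)[OF p(1)] p(2) \<delta> by (simp add: hd_map hom_set_def)
    then show "\<delta> \<in> (\<lambda>l. path_cmp G (map fst l)) ` ?L" using l by (auto simp: basis_paths_def)
  qed
  then have "finite {\<delta>. g \<alpha> \<delta> \<noteq> 0}"
    using finite_basis_paths_from[OF src_Ob[OF \<alpha>], of N] finite_surj by blast
  then show "g \<alpha> \<in> End_comp G tscale (TP N) \<alpha>"
    using lin[OF \<alpha>] out(1) by (auto simp: End_comp_def)
next
  fix a assume a: "a \<in> Ob G"
  let ?F = "{\<alpha> \<in> Arr G. (src G \<alpha> = a \<or> tgt G \<alpha> = a) \<and> V \<alpha> \<noteq> {0}}"
  have "finite (?F \<union> ivs G ` ?F)" using finite_type a by (auto simp: graded_finite_type_def)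
  moreover have "{\<alpha> \<in> Arr G. (src G \<alpha> = a \<or> tgt G \<alpha> = a) \<and> g \<alpha> \<noteq> 0} \<subseteq> ?F \<union> ivs G ` ?F"
  proof
    fix \<alpha> assume \<alpha>: "\<alpha> \<in> {\<alpha> \<in> Arr G. (src G \<alpha> = a \<or> tgt G \<alpha> = a) \<and> g \<alpha> \<noteq> 0}"
    then have \<alpha>': "\<alpha> \<in> Arr G" "g \<alpha> \<noteq> 0" by simp_all
    have "V \<alpha> \<noteq> {0} \<or> V (ivs G \<alpha>) \<noteq> {0}"
    proof (rule ccontr)
      assume "\<not> ?thesis"
      then have "g \<alpha> = 0" by (intro supp[OF \<alpha>'(1)]) simp_all
      with \<alpha>'(2) show False by (rule notE)
    qed
    then consider "V \<alpha> \<noteq> {0}" | "V (ivs G \<alpha>) \<noteq> {0}" by (rule disjE)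
    then show "\<alpha> \<in> ?F \<union> ivs G ` ?F"
    proof cases
      case 2
      then have "ivs G \<alpha> \<in> ?F" using \<alpha> ivs_Arr src_ivs tgt_ivs by auto
      moreover have "\<alpha> = ivs G (ivs G \<alpha>)" using \<alpha> ivs_ivs by simp
      ultimately show ?thesis by blast
    qed (use \<alpha> in blast)
  qed
  ultimately show "finite {\<alpha> \<in> Arr G. (src G \<alpha> = a \<or> tgt G \<alpha> = a) \<and> g \<alpha> \<noteq> 0}"
    by (rule rev_finite_subset)
qed (rule out(2))

lemma lin_maps_coordI:
  assumes "\<And>u. u \<in> TP n \<gamma> \<Longrightarrow> f u \<in> TP n' \<gamma>'" "\<And>u. u \<notin> TP n \<gamma> \<Longrightarrow> f u = 0"
    and lin: "\<And>u v c l. u \<in> TP n \<gamma> \<Longrightarrow> v \<in> TP n \<gamma> \<Longrightarrow>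
      coord (f (u + tscale c v)) l = coord (f u) l + c * coord (f v) l"
  shows "f \<in> lin_maps tscale tscale (TP n \<gamma>) (TP n' \<gamma>')"
proof -
  have *: "f (u + tscale c v) = f u + tscale c (f v)" if "u \<in> TP n \<gamma>" "v \<in> TP n \<gamma>" for u v c
    using that assms(1) lin by (intro tensor_eqI[of _ n' \<gamma>']) (auto intro: TP_add TP_scale)
  have 1: "f (u + v) = f u + f v" if "u \<in> TP n \<gamma>" "v \<in> TP n \<gamma>" for u v
    using *[OF that, of 1] by (simp only: tv.scale_one)
  have "f 0 = f 0 + f 0" using 1[OF TP_zero TP_zero] by (simp only: add_0_left)
  then have 0: "f 0 = 0" by (metis add_cancel_right_right)
  have "f (tscale c v) = tscale c (f v)" if "v \<in> TP n \<gamma>" for c v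
    using *[OF TP_zero that, of c] by (simp only: 0 add_0_left)
  then show ?thesis using assms(1,2) 1 unfolding lin_maps_def by blast
qed

end

context tl_space
begin

abbreviation M :: "nat \<Rightarrow> complex \<Rightarrow> 'b \<Rightarrow> 'b \<Rightarrow> ('b, 'c) tensor \<Rightarrow> ('b, 'c) tensor" where
  "M N \<equiv> transfer_matrix G sc V N T"

lemma transfer_matrix_expand:
  assumes "\<alpha> \<in> Arr G" "\<delta> \<in> loops \<alpha>" "w \<in> TP N (conj_arr G \<alpha> \<delta>)" "N \<ge> 1"
  shows "M N x \<alpha> \<delta> w \<in> TP N \<delta>" (is ?in)
    "coord (M N x \<alpha> \<delta> w) =
      (\<lambda>l. \<Sum>e\<in>basis \<alpha>. train t x 0 N (prepend [(\<alpha>, e)] (coord w)) (l @ [(\<alpha>, e)]))" (is ?coord)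
proof -
  let ?\<eta> = "cmp G \<alpha> \<delta>"
  let ?w = "\<lambda>e. tensor_prod 1 (pt [(\<alpha>, e)]) w"
  let ?m = "\<lambda>e. monodromy G sc V N T x ?\<eta> (?w e)"
  have \<delta>: "\<delta> \<in> Arr G" "tgt G \<delta> = src G \<alpha>" using assms(2) by (auto simp: hom_set_def)
  have c: "conj_arr G \<alpha> \<delta> \<in> Arr G" "src G (conj_arr G \<alpha> \<delta>) = tgt G \<alpha>"
    using conj_arr_hom_set[OF assms(1,2)] by (auto simp: hom_set_def)
  have w: "?w e \<in> TP (Suc N) ?\<eta>" "coord (?w e) = prepend [(\<alpha>, e)] (coord w)" if "e \<in> basis \<alpha>" for e
    using prepend_tensor[OF assms(1) that assms(3) c] by (simp_all add: conj_arr_cmp[OF assms(1,2)])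
  have m: "?m e \<in> TP (Suc N) ?\<eta>" "coord (?m e) = train t x 0 N (prepend [(\<alpha>, e)] (coord w))"
    if "e \<in> basis \<alpha>" for e
    using coord_slot_words[OF local_op_T le_refl w(1)[OF that], of x] w(2)[OF that]
    by (simp_all add: monodromy_def)
  have M: "M N x \<alpha> \<delta> w = (\<Sum>e\<in>basis \<alpha>. (\<lambda>\<psi>s. ?m e (\<psi>s @ [(\<alpha>, coeff \<alpha> e)])))"
    using assms by (auto simp: transfer_matrix_def partial_trace_def fun_eq_iff sum_fun_apply coeff_def)
  show ?in unfolding M using m(1) assms \<delta> by (intro TP_sum evaluate_last_slot) auto
  show ?coord
  proof
    fix l
    show "coord (M N x \<alpha> \<delta> w) l
      = (\<Sum>e\<in>basis \<alpha>. train t x 0 N (prepend [(\<alpha>, e)] (coord w)) (l @ [(\<alpha>, e)]))"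
    proof (cases "set l \<subseteq> basis_arrows")
      case True
      have "coord (M N x \<alpha> \<delta> w) l = (\<Sum>e\<in>basis \<alpha>. coord (?m e) (l @ [(\<alpha>, e)]))"
        unfolding M using True assms(1)
        by (auto simp: coord_def sum_fun_apply basis_arrows_def intro!: sum.cong)
      then show ?thesis using m(2) by simp
    next
      case False
      then have "train t x 0 N (prepend [(\<alpha>, e)] (coord w)) (l @ [(\<alpha>, e)]) = 0" if "e \<in> basis \<alpha>" for e
        using m(2)[OF that, symmetric] by (simp add: coord_def)
      then show ?thesis using False by (simp add: coord_def)
    qed
  qed
qed

lemma transfer_matrix_outside:
  "\<alpha> \<notin> Arr G \<Longrightarrow> M N x \<alpha> = 0" "\<delta> \<notin> loops \<alpha> \<Longrightarrow> M N x \<alpha> \<delta> = 0"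
  "w \<notin> TP N (conj_arr G \<alpha> \<delta>) \<Longrightarrow> M N x \<alpha> \<delta> w = 0"
  by (auto simp: transfer_matrix_def partial_trace_def fun_eq_iff)

lemma transfer_matrix_no_basis: "\<alpha> \<in> Arr G \<Longrightarrow> V \<alpha> = {0} \<Longrightarrow> M N x \<alpha> = 0"
  using basis_props(5)[of \<alpha>] by (auto simp: transfer_matrix_def partial_trace_def fun_eq_iff)

lemma transfer_matrix_alg:
  assumes "N \<ge> 1"
  shows "M N x \<in> tp.alg N"
proof (rule alg_intro[OF assms])
  fix \<alpha> \<delta> assume a: "\<alpha> \<in> Arr G" "\<delta> \<in> loops \<alpha>"
  show "M N x \<alpha> \<delta> \<in> lin_maps tscale tscale (TP N (conj_arr G \<alpha> \<delta>)) (TP N \<delta>)"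
  proof (rule lin_maps_coordI)
    fix u v c l assume uv: "u \<in> TP N (conj_arr G \<alpha> \<delta>)" "v \<in> TP N (conj_arr G \<alpha> \<delta>)"
    have lin: "coord (u + tscale c v) = (\<lambda>l. coord u l + c * coord v l)"
      unfolding coord_linear by (auto simp: fun_eq_iff)
    show "coord (M N x \<alpha> \<delta> (u + tscale c v)) l = coord (M N x \<alpha> \<delta> u) l + c * coord (M N x \<alpha> \<delta> v) l"
      unfolding transfer_matrix_expand(2)[OF a uv(1) assms] transfer_matrix_expand(2)[OF a uv(2) assms]
        transfer_matrix_expand(2)[OF a TP_add[OF uv(1) TP_scale[OF uv(2)]] assms]
        lin prepend_linear train_linear
      by (simp add: sum.distrib sum_distrib_left)
  qed (use transfer_matrix_expand(1)[OF a _ assms] transfer_matrix_outside in auto)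
qed (use transfer_matrix_outside transfer_matrix_no_basis in auto)

end


section \<open>Commuting transfer matrices\<close>

context graded_space
begin

lemma train_Nil: "train a x k m f [] = f []"
  by (induction m) (auto simp: bax_def act_short)

text \<open>The first auxiliary factor \<open>c\<close> is a spectator in front of the inner row, and the second one, \<open>d\<close>, is a
  spectator behind the outer row.\<close>

lemma train_two_rows:
  assumes "length l = m"
  shows "train a x 0 m (prepend [c] (\<lambda>\<xi>. \<Sum>d\<in>D. train a y 0 m (prepend [d] h) (\<xi> @ [d]))) (l @ [c])
    = (\<Sum>d\<in>D. train a x 0 m (train a y 1 m (prepend [c, d] h)) (l @ [c, d]))"
proof -
  let ?g = "\<lambda>d. train a y 0 m (prepend [d] h)"
  have snoc: "prepend [c] (\<lambda>\<xi>. ?g d (\<xi> @ [d])) = (\<lambda>\<xi>. train a y 1 m (prepend [c, d] h) (\<xi> @ [d]))" for d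
  proof
    fix \<xi> :: "('a \<times> 'v) list"
    have "train a y 1 m (prepend [c, d] h) = prepend [c] (?g d)"
      using prepend_append[of "[c]" "[d]" h] train_prepend[of a y 0 m c "prepend [d] h"] by simp
    then show "prepend [c] (\<lambda>\<xi>. ?g d (\<xi> @ [d])) \<xi> = train a y 1 m (prepend [c, d] h) (\<xi> @ [d])"
      by (cases \<xi>) (auto simp: train_Nil)
  qed
  have "train a x 0 m (prepend [c] (\<lambda>\<xi>. \<Sum>d\<in>D. ?g d (\<xi> @ [d]))) (l @ [c])
    = (\<Sum>d\<in>D. train a x 0 m (\<lambda>\<xi>. train a y 1 m (prepend [c, d] h) (\<xi> @ [d])) (l @ [c]))"
    unfolding prepend_sum snoc
    using train_sum[where c = "\<lambda>_. 1" and I = D and g = "\<lambda>d \<xi>. train a y 1 m (prepend [c, d] h) (\<xi> @ [d])"]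
    by simp
  also have "\<dots> = (\<Sum>d\<in>D. train a x 0 m (train a y 1 m (prepend [c, d] h)) ((l @ [c]) @ [d]))"
    using assms by (intro sum.cong refl train_snoc[symmetric]) simp
  finally show ?thesis by simp
qed

text \<open>The sum over factorisations in the convolution product and the sums over bases in the two partial
  traces combine to one sum over a basis of \<open>(V \<otimes> V)\<^bsub>\<gamma>\<^esub>\<close>.\<close>

lemma sum_basis_paths_2:
  assumes \<gamma>: "\<gamma> \<in> Arr G" and A: "finite A" "A \<subseteq> {\<alpha> \<in> Arr G. src G \<alpha> = src G \<gamma>}"
    and supp: "\<And>\<alpha>. \<alpha> \<in> Arr G \<Longrightarrow> src G \<alpha> = src G \<gamma> \<Longrightarrow> basis \<alpha> \<noteq> {} \<Longrightarrow> \<alpha> \<in> A"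
  shows "(\<Sum>\<alpha>\<in>A. \<Sum>e\<in>basis \<alpha>. \<Sum>f\<in>basis (cmp G \<gamma> (ivs G \<alpha>)). \<Phi> [(\<alpha>, e), (cmp G \<gamma> (ivs G \<alpha>), f)])
    = (\<Sum>p\<in>basis_paths 2 \<gamma>. \<Phi> p)"
proof -
  let ?S = "SIGMA \<alpha>:A. basis \<alpha> \<times> basis (cmp G \<gamma> (ivs G \<alpha>))"
  let ?p = "\<lambda>(\<alpha>, e, f). [(\<alpha>, e), (cmp G \<gamma> (ivs G \<alpha>), f)]"
  have d: "cmp G \<gamma> (ivs G \<alpha>) \<in> Arr G" "src G (cmp G \<gamma> (ivs G \<alpha>)) = tgt G \<alpha>"
    "cmp G (cmp G \<gamma> (ivs G \<alpha>)) \<alpha> = \<gamma>" "\<alpha> \<in> Arr G" if "\<alpha> \<in> A" for \<alpha>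
    using that A(2) div_Arr[OF _ \<gamma>, of \<alpha>] by auto
  have fin: "finite (basis \<alpha>)" "finite (basis (cmp G \<gamma> (ivs G \<alpha>)))" if "\<alpha> \<in> A" for \<alpha>
    using d[OF that] basis_props(3) by auto
  have "(\<Sum>\<alpha>\<in>A. \<Sum>e\<in>basis \<alpha>. \<Sum>f\<in>basis (cmp G \<gamma> (ivs G \<alpha>)). \<Phi> [(\<alpha>, e), (cmp G \<gamma> (ivs G \<alpha>), f)])
    = (\<Sum>z\<in>?S. \<Phi> (?p z))"
    using A(1) fin by (simp add: sum.cartesian_product sum.Sigma split_def)
  also have "\<dots> = (\<Sum>p\<in>basis_paths 2 \<gamma>. \<Phi> p)"
  proof (rule sum.reindex_bij_betw)
    show "bij_betw ?p ?S (basis_paths 2 \<gamma>)"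
      unfolding bij_betw_def
    proof (intro conjI equalityI subsetI)
      show "inj_on ?p ?S" by (auto simp: inj_on_def)
    next
      fix p assume "p \<in> ?p ` ?S"
      then obtain \<alpha> e f where p: "\<alpha> \<in> A" "e \<in> basis \<alpha>" "f \<in> basis (cmp G \<gamma> (ivs G \<alpha>))"
        "p = [(\<alpha>, e), (cmp G \<gamma> (ivs G \<alpha>), f)]" by auto
      then show "p \<in> basis_paths 2 \<gamma>"
        using d[OF p(1)] by (simp add: basis_paths_def basis_arrows_def)
    next
      fix p assume p: "p \<in> basis_paths 2 \<gamma>"
      then have "length p = 2" by (rule basis_paths_length)
      then obtain \<alpha> e \<beta> f where pe: "p = [(\<alpha>, e), (\<beta>, f)]"
        by (auto simp: numeral_2_eq_2 length_Suc_conv)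
      have q: "\<alpha> \<in> Arr G" "\<beta> \<in> Arr G" "e \<in> basis \<alpha>" "f \<in> basis \<beta>" "tgt G \<alpha> = src G \<beta>" "cmp G \<beta> \<alpha> = \<gamma>"
        using p by (auto simp: pe basis_paths_def basis_arrows_def)
      then have "\<beta> = cmp G \<gamma> (ivs G \<alpha>)" "src G \<alpha> = src G \<gamma>"
        using cmp_div[OF q(1,2,5)] src_cmp[OF q(1,2,5)] by auto
      moreover from this have "\<alpha> \<in> A" using q by (intro supp) auto
      ultimately have "(\<alpha>, e, f) \<in> ?S" "p = ?p (\<alpha>, e, f)" using q pe by auto
      then show "p \<in> ?p ` ?S" by (rule rev_image_eqI)
    qed
  qed
  finally show ?thesis .
qed

definition arrows_from :: "'o \<Rightarrow> 'a set" where
  "arrows_from a = {\<alpha> \<in> Arr G. src G \<alpha> = a \<and> V \<alpha> \<noteq> {0}}"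

lemma arrows_from: "a \<in> Ob G \<Longrightarrow> finite (arrows_from a)" "arrows_from a \<subseteq> {\<alpha> \<in> Arr G. src G \<alpha> = a}"
proof -
  assume "a \<in> Ob G"
  then have "finite {\<alpha> \<in> Arr G. (src G \<alpha> = a \<or> tgt G \<alpha> = a) \<and> V \<alpha> \<noteq> {0}}"
    using finite_type by (auto simp: graded_finite_type_def)
  then show "finite (arrows_from a)" by (rule rev_finite_subset) (auto simp: arrows_from_def)
qed (auto simp: arrows_from_def)

end

context tl_space
begin

lemma conv_transfer_matrix:
  assumes "\<gamma> \<in> Arr G" "\<delta> \<in> loops \<gamma>" "N \<ge> 1"
  shows "conv G (M N x) h \<gamma> \<delta> w
    = (\<Sum>\<alpha>\<in>arrows_from (src G \<gamma>). M N x \<alpha> \<delta> (h (cmp G \<gamma> (ivs G \<alpha>)) (conj_arr G \<alpha> \<delta>) w))"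
  by (rule tp.conv_apply_alg[OF transfer_matrix_alg[OF assms(3)] assms(1,2)])
    (use arrows_from src_Ob[OF assms(1)] transfer_matrix_no_basis in \<open>auto simp: arrows_from_def\<close>)

text \<open>The product of two partial traces is one trace over both auxiliary factors.\<close>

lemma coord_product:
  assumes \<gamma>: "\<gamma> \<in> Arr G" and \<delta>: "\<delta> \<in> loops \<gamma>" and w: "w \<in> TP N (conj_arr G \<gamma> \<delta>)"
    and N: "N \<ge> 1" and l: "length l = N"
  shows "coord (conv G (M N x) (M N y) \<gamma> \<delta> w) l
    = (\<Sum>p\<in>basis_paths 2 \<gamma>. train t x 0 N (train t y 1 N (prepend p (coord w))) (l @ p))"
proof -
  let ?A = "arrows_from (src G \<gamma>)" and ?\<beta> = "\<lambda>\<alpha>. cmp G \<gamma> (ivs G \<alpha>)"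
  define \<Phi> where "\<Phi> p = train t x 0 N (train t y 1 N (prepend p (coord w))) (l @ p)" for p
  have "coord (M N x \<alpha> \<delta> (M N y (?\<beta> \<alpha>) (conj_arr G \<alpha> \<delta>) w)) l
    = (\<Sum>e\<in>basis \<alpha>. \<Sum>f\<in>basis (?\<beta> \<alpha>). \<Phi> [(\<alpha>, e), (?\<beta> \<alpha>, f)])" if \<alpha>: "\<alpha> \<in> ?A" for \<alpha>
  proof -
    have \<alpha>: "\<alpha> \<in> Arr G" "src G \<alpha> = src G \<gamma>" "\<delta> \<in> loops \<alpha>"
      using \<alpha> \<delta> by (auto simp: arrows_from_def)
    note d = conj_div[OF \<gamma> \<delta> \<alpha>(1,2)]
    let ?u = "M N y (?\<beta> \<alpha>) (conj_arr G \<alpha> \<delta>) w"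
    have w': "w \<in> TP N (conj_arr G (?\<beta> \<alpha>) (conj_arr G \<alpha> \<delta>))" using w d(3) by simp
    note u = transfer_matrix_expand[OF d(1,2) w' N, of y]
    have "coord (M N x \<alpha> \<delta> ?u) l
      = (\<Sum>e\<in>basis \<alpha>. train t x 0 N (prepend [(\<alpha>, e)]
          (\<lambda>\<xi>. \<Sum>f\<in>basis (?\<beta> \<alpha>). train t y 0 N (prepend [(?\<beta> \<alpha>, f)] (coord w)) (\<xi> @ [(?\<beta> \<alpha>, f)])))
          (l @ [(\<alpha>, e)]))"
      unfolding transfer_matrix_expand(2)[OF \<alpha>(1,3) u(1) N] u(2) ..
    also have "\<dots> = (\<Sum>e\<in>basis \<alpha>. \<Sum>d\<in>Pair (?\<beta> \<alpha>) ` basis (?\<beta> \<alpha>). \<Phi> [(\<alpha>, e), d])"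
    proof (rule sum.cong[OF refl])
      fix e
      have "(\<lambda>\<xi>. \<Sum>f\<in>basis (?\<beta> \<alpha>). train t y 0 N (prepend [(?\<beta> \<alpha>, f)] (coord w)) (\<xi> @ [(?\<beta> \<alpha>, f)]))
        = (\<lambda>\<xi>. \<Sum>d\<in>Pair (?\<beta> \<alpha>) ` basis (?\<beta> \<alpha>). train t y 0 N (prepend [d] (coord w)) (\<xi> @ [d]))"
        by (simp add: sum.reindex inj_on_def)
      then show "train t x 0 N (prepend [(\<alpha>, e)]
          (\<lambda>\<xi>. \<Sum>f\<in>basis (?\<beta> \<alpha>). train t y 0 N (prepend [(?\<beta> \<alpha>, f)] (coord w)) (\<xi> @ [(?\<beta> \<alpha>, f)])))
          (l @ [(\<alpha>, e)]) = (\<Sum>d\<in>Pair (?\<beta> \<alpha>) ` basis (?\<beta> \<alpha>). \<Phi> [(\<alpha>, e), d])"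
        unfolding \<Phi>_def by (simp only: train_two_rows[OF l])
    qed
    finally show ?thesis by (simp add: sum.reindex inj_on_def)
  qed
  then have "coord (conv G (M N x) (M N y) \<gamma> \<delta> w) l
    = (\<Sum>\<alpha>\<in>?A. \<Sum>e\<in>basis \<alpha>. \<Sum>f\<in>basis (?\<beta> \<alpha>). \<Phi> [(\<alpha>, e), (?\<beta> \<alpha>, f)])"
    unfolding conv_transfer_matrix[OF \<gamma> \<delta> N] coord_sum by (rule sum.cong[OF refl])
  also have "\<dots> = (\<Sum>p\<in>basis_paths 2 \<gamma>. \<Phi> p)"
    using arrows_from[of "src G \<gamma>"] src_Ob[OF \<gamma>] basis_props(5)
    by (intro sum_basis_paths_2[OF \<gamma>]) (auto simp: arrows_from_def)
  finally show ?thesis by (simp only: \<Phi>_def)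
qed

theorem transfer_matrices_commute:
  assumes N: "N \<ge> 1"
  shows "conv G (M N x) (M N y) = conv G (M N y) (M N x)"
proof (rule tp.alg_eqI[of _ N])
  note alg = transfer_matrix_alg[OF N]
  show closed: "conv G (M N x) (M N y) \<in> tp.alg N" "conv G (M N y) (M N x) \<in> tp.alg N"
    by (intro tp.conv_closed alg)+
  fix \<gamma> \<delta> w
  assume \<gamma>: "\<gamma> \<in> Arr G" and \<delta>: "\<delta> \<in> loops \<gamma>" and w: "w \<in> TP N (conj_arr G \<gamma> \<delta>)"
  show "conv G (M N x) (M N y) \<gamma> \<delta> w = conv G (M N y) (M N x) \<gamma> \<delta> w"
  proof (rule tensor_eqI)
    show "conv G (M N x) (M N y) \<gamma> \<delta> w \<in> TP N \<delta>" "conv G (M N y) (M N x) \<gamma> \<delta> w \<in> TP N \<delta>"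
      by (rule tp.lin_map_in[OF tp.alg_lin_map[OF closed(1) \<gamma> \<delta>]],
          rule tp.lin_map_in[OF tp.alg_lin_map[OF closed(2) \<gamma> \<delta>]])
    fix l assume "l \<in> basis_paths N \<delta>"
    then have l: "length l = N" by (rule basis_paths_length)
    have c: "src G (conj_arr G \<gamma> \<delta>) = tgt G \<gamma>"
      using conj_arr_hom_set[OF \<gamma> \<delta>] by (simp add: hom_set_def)
    have h: "on_paths (N + 2) (cmp G (conj_arr G \<gamma> \<delta>) \<gamma>) (prepend p (coord w)) = prepend p (coord w)"
      if "p \<in> basis_paths 2 \<gamma>" for p
      using prepend_on_paths[OF that on_paths_coord[OF w] c[symmetric]] by (simp add: add.commute)
    show "coord (conv G (M N x) (M N y) \<gamma> \<delta> w) l = coord (conv G (M N y) (M N x) \<gamma> \<delta> w) l"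
      unfolding coord_product[OF \<gamma> \<delta> w N l] by (rule trace_commute[OF l h])
  qed
qed


section \<open>The derivative of the transfer matrix\<close>

lemma transfer_matrix_zero_arg:
  "M N x \<alpha> \<delta> w = 0" if "\<not> (\<alpha> \<in> Arr G \<and> \<delta> \<in> loops \<alpha> \<and> w \<in> TP N (conj_arr G \<alpha> \<delta>))"
  using that transfer_matrix_outside by auto

abbreviation M' :: "nat \<Rightarrow> complex \<Rightarrow> 'b \<Rightarrow> 'b \<Rightarrow> ('b, 'c) tensor \<Rightarrow> ('b, 'c) tensor" where
  "M' N \<equiv> transfer_matrix_deriv G sc V N T"

lemma coord_transfer_matrix_holomorphic:
  assumes "N \<ge> 1"
  shows "(\<lambda>x. coord (M N x \<alpha> \<delta> w) l) holomorphic_on UNIV"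
proof (cases "\<alpha> \<in> Arr G \<and> \<delta> \<in> loops \<alpha> \<and> w \<in> TP N (conj_arr G \<alpha> \<delta>)")
  case True
  then show ?thesis
    using assms by (simp add: transfer_matrix_expand(2)) (intro holomorphic_intros train_holomorphic)
next
  case False
  then show ?thesis by (simp add: transfer_matrix_zero_arg)
qed

text \<open>Only finitely many coordinates occur, so the derivative can be taken coordinate by coordinate;
  in particular it stays in the tensor power.\<close>

lemma transfer_matrix_deriv_expand:
  assumes "\<alpha> \<in> Arr G" "\<delta> \<in> loops \<alpha>" "N \<ge> 1"
  shows "M' N x \<alpha> \<delta> w = of_coord N \<delta> (\<lambda>l. deriv (\<lambda>x. coord (M N x \<alpha> \<delta> w) l) x)"
proof
  fix \<psi>s
  have TP: "M N x \<alpha> \<delta> w \<in> TP N \<delta>" for x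
    by (rule tp.lin_map_in[OF tp.alg_lin_map[OF transfer_matrix_alg[OF assms(3)] assms(1,2)]])
  have "((\<lambda>x. coord (M N x \<alpha> \<delta> w) l) has_field_derivative deriv (\<lambda>x. coord (M N x \<alpha> \<delta> w) l) x) (at x)" for l
    using coord_transfer_matrix_holomorphic[OF assms(3)] by (intro holomorphic_derivI[where S = UNIV]) auto
  then have "((\<lambda>x. \<Sum>l\<in>basis_paths N \<delta>. coord (M N x \<alpha> \<delta> w) l * pt l \<psi>s) has_field_derivative
    (\<Sum>l\<in>basis_paths N \<delta>. deriv (\<lambda>x. coord (M N x \<alpha> \<delta> w) l) x * pt l \<psi>s)) (at x)"
    by (intro DERIV_sum DERIV_cmult_right)
  moreover have "(\<lambda>x. \<Sum>l\<in>basis_paths N \<delta>. coord (M N x \<alpha> \<delta> w) l * pt l \<psi>s) = (\<lambda>x. M N x \<alpha> \<delta> w \<psi>s)"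
    using of_coord_apply of_coord_coord[OF TP] by metis
  ultimately show "M' N x \<alpha> \<delta> w \<psi>s = of_coord N \<delta> (\<lambda>l. deriv (\<lambda>x. coord (M N x \<alpha> \<delta> w) l) x) \<psi>s"
    unfolding of_coord_apply transfer_matrix_deriv_def by (simp only: DERIV_imp_deriv)
qed

lemma DERIV_coord_transfer_matrix:
  assumes "\<alpha> \<in> Arr G" "\<delta> \<in> loops \<alpha>" "N \<ge> 1"
  shows "((\<lambda>x. coord (M N x \<alpha> \<delta> w) l) has_field_derivative coord (M' N x \<alpha> \<delta> w) l) (at x)"
proof -
  have TP: "M N x \<alpha> \<delta> w \<in> TP N \<delta>" for x
    by (rule tp.lin_map_in[OF tp.alg_lin_map[OF transfer_matrix_alg[OF assms(3)] assms(1,2)]])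
  have D: "((\<lambda>x. coord (M N x \<alpha> \<delta> w) l) has_field_derivative deriv (\<lambda>x. coord (M N x \<alpha> \<delta> w) l) x) (at x)"
    using coord_transfer_matrix_holomorphic[OF assms(3)] by (intro holomorphic_derivI[where S = UNIV]) auto
  have "deriv (\<lambda>x. coord (M N x \<alpha> \<delta> w) l) x = 0" if "l \<notin> basis_paths N \<delta>"
    using coord_outside[OF TP that] by simp
  then show ?thesis using D by (auto simp: transfer_matrix_deriv_expand[OF assms] coord_of_coord)
qed

lemma transfer_matrix_deriv_zero: "M' N x \<alpha> \<delta> w = 0" if "\<And>y. M N y \<alpha> \<delta> w = 0"
  using that by (simp add: transfer_matrix_deriv_def fun_eq_iff)

lemma transfer_matrix_deriv_no_basis: "\<alpha> \<in> Arr G \<Longrightarrow> V \<alpha> = {0} \<Longrightarrow> M' N x \<alpha> = 0"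
  using transfer_matrix_no_basis[of \<alpha> N] by (auto simp: fun_eq_iff transfer_matrix_deriv_zero)

lemma transfer_matrix_deriv_alg:
  assumes N: "N \<ge> 1"
  shows "M' N x \<in> tp.alg N"
proof (rule alg_intro[OF N])
  fix \<alpha> \<delta> assume a: "\<alpha> \<in> Arr G" "\<delta> \<in> loops \<alpha>"
  show "M' N x \<alpha> \<delta> \<in> lin_maps tscale tscale (TP N (conj_arr G \<alpha> \<delta>)) (TP N \<delta>)"
  proof (rule lin_maps_coordI)
    show "M' N x \<alpha> \<delta> u \<in> TP N \<delta>" for u
      unfolding transfer_matrix_deriv_expand[OF a N] by (rule of_coord_TP)
    show "M' N x \<alpha> \<delta> u = 0" if "u \<notin> TP N (conj_arr G \<alpha> \<delta>)" for u
      using that by (intro transfer_matrix_deriv_zero transfer_matrix_outside(3))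
    fix u v c l assume uv: "u \<in> TP N (conj_arr G \<alpha> \<delta>)" "v \<in> TP N (conj_arr G \<alpha> \<delta>)"
    note L = tp.alg_lin_map[OF transfer_matrix_alg[OF N] a]
    have "coord (M N y \<alpha> \<delta> (u + tscale c v)) l = coord (M N y \<alpha> \<delta> u) l + c * coord (M N y \<alpha> \<delta> v) l" for y
    proof -
      have "M N y \<alpha> \<delta> (u + tscale c v) = M N y \<alpha> \<delta> u + tscale c (M N y \<alpha> \<delta> v)"
        using lin_mapsD(2)[OF L uv(1) TP_scale[OF uv(2)]] lin_mapsD(3)[OF L uv(2)] by metis
      then show ?thesis by (simp only: coord_linear plus_fun_apply)
    qed
    then have "((\<lambda>y. coord (M N y \<alpha> \<delta> (u + tscale c v)) l) has_field_derivative
        coord (M' N x \<alpha> \<delta> u) l + c * coord (M' N x \<alpha> \<delta> v) l) (at x)"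
      by (simp only:) (intro DERIV_add DERIV_cmult DERIV_coord_transfer_matrix a N)
    then show "coord (M' N x \<alpha> \<delta> (u + tscale c v)) l = coord (M' N x \<alpha> \<delta> u) l + c * coord (M' N x \<alpha> \<delta> v) l"
      using DERIV_coord_transfer_matrix[OF a N] DERIV_unique by blast
  qed
next
  show "M' N x \<alpha> \<delta> = 0" if "\<delta> \<notin> loops \<alpha>" for \<alpha> \<delta>
    by (rule ext) (simp add: transfer_matrix_deriv_zero transfer_matrix_outside(2)[OF that])
  show "M' N x \<alpha> = 0" if "\<alpha> \<notin> Arr G" for \<alpha>
    by (intro ext) (simp add: transfer_matrix_deriv_def transfer_matrix_outside(1)[OF that])
qed (rule transfer_matrix_deriv_no_basis)

lemma conv_transfer_matrix_deriv:
  assumes "\<gamma> \<in> Arr G" "\<delta> \<in> loops \<gamma>" "N \<ge> 1"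
  shows "conv G (M' N x) h \<gamma> \<delta> w
    = (\<Sum>\<alpha>\<in>arrows_from (src G \<gamma>). M' N x \<alpha> \<delta> (h (cmp G \<gamma> (ivs G \<alpha>)) (conj_arr G \<alpha> \<delta>) w))"
  by (rule tp.conv_apply_alg[OF transfer_matrix_deriv_alg[OF assms(3)] assms(1,2)])
    (use arrows_from src_Ob[OF assms(1)] transfer_matrix_deriv_no_basis in \<open>auto simp: arrows_from_def\<close>)

text \<open>The identity \<open>M(x) * M(y) = M(y) * M(x)\<close> is differentiated in \<open>x\<close>. On the right this uses that
  a linear map on a finite-dimensional space commutes with the derivative.\<close>

theorem transfer_matrix_deriv_commutes:
  assumes N: "N \<ge> 1"
  shows "conv G (M' N x) (M N y) = conv G (M N y) (M' N x)"
proof (rule tp.alg_eqI[of _ N])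
  note alg = transfer_matrix_alg[OF N] and alg' = transfer_matrix_deriv_alg[OF N]
  show closed: "conv G (M' N x) (M N y) \<in> tp.alg N" "conv G (M N y) (M' N x) \<in> tp.alg N"
    by (intro tp.conv_closed alg alg')+
  fix \<gamma> \<delta> w
  assume \<gamma>: "\<gamma> \<in> Arr G" and \<delta>: "\<delta> \<in> loops \<gamma>" and w: "w \<in> TP N (conj_arr G \<gamma> \<delta>)"
  let ?A = "arrows_from (src G \<gamma>)" and ?\<beta> = "\<lambda>\<alpha>. cmp G \<gamma> (ivs G \<alpha>)"
  have \<alpha>: "\<alpha> \<in> Arr G" "src G \<alpha> = src G \<gamma>" "\<delta> \<in> loops \<alpha>" if "\<alpha> \<in> ?A" for \<alpha>
    using that \<delta> by (auto simp: arrows_from_def)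
  show "conv G (M' N x) (M N y) \<gamma> \<delta> w = conv G (M N y) (M' N x) \<gamma> \<delta> w"
  proof (rule tensor_eqI)
    show "conv G (M' N x) (M N y) \<gamma> \<delta> w \<in> TP N \<delta>" "conv G (M N y) (M' N x) \<gamma> \<delta> w \<in> TP N \<delta>"
      by (rule tp.lin_map_in[OF tp.alg_lin_map[OF closed(1) \<gamma> \<delta>]],
          rule tp.lin_map_in[OF tp.alg_lin_map[OF closed(2) \<gamma> \<delta>]])
    fix l
    have "((\<lambda>x. coord (conv G (M N x) (M N y) \<gamma> \<delta> w) l) has_field_derivative
      coord (conv G (M' N x) (M N y) \<gamma> \<delta> w) l) (at x)"
      unfolding conv_transfer_matrix[OF \<gamma> \<delta> N] conv_transfer_matrix_deriv[OF \<gamma> \<delta> N] coord_sum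
      using \<alpha> by (intro DERIV_sum DERIV_coord_transfer_matrix N) auto
    moreover have "((\<lambda>x. coord (conv G (M N y) (M N x) \<gamma> \<delta> w) l) has_field_derivative
      coord (conv G (M N y) (M' N x) \<gamma> \<delta> w) l) (at x)"
    proof -
      have "((\<lambda>x. coord (M N y \<alpha> \<delta> (M N x (?\<beta> \<alpha>) (conj_arr G \<alpha> \<delta>) w)) l) has_field_derivative
        coord (M N y \<alpha> \<delta> (M' N x (?\<beta> \<alpha>) (conj_arr G \<alpha> \<delta>) w)) l) (at x)" if A: "\<alpha> \<in> ?A" for \<alpha>
      proof -
        note d = conj_div[OF \<gamma> \<delta> \<alpha>(1,2)[OF A]]
        note L = tp.alg_lin_map[OF alg \<alpha>(1,3)[OF A], of y]
        let ?B = "basis_paths N (conj_arr G \<alpha> \<delta>)"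
        have ex: "coord (M N y \<alpha> \<delta> u) l = (\<Sum>q\<in>?B. coord u q * coord (M N y \<alpha> \<delta> (pt q)) l)"
          if u: "u \<in> TP N (conj_arr G \<alpha> \<delta>)" for u
          unfolding lin_maps_expand[OF L u] coord_sum by (simp only: coord_linear)
        have in': "M N z (?\<beta> \<alpha>) (conj_arr G \<alpha> \<delta>) w \<in> TP N (conj_arr G \<alpha> \<delta>)"
          "M' N z (?\<beta> \<alpha>) (conj_arr G \<alpha> \<delta>) w \<in> TP N (conj_arr G \<alpha> \<delta>)" for z
          by (rule tp.lin_map_in[OF tp.alg_lin_map[OF alg d(1,2)]],
              rule tp.lin_map_in[OF tp.alg_lin_map[OF alg' d(1,2)]])
        show ?thesis
          unfolding ex[OF in'(1)] ex[OF in'(2)]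
          by (intro DERIV_sum DERIV_cmult_right DERIV_coord_transfer_matrix d N)
      qed
      then show ?thesis
        unfolding conv_transfer_matrix[OF \<gamma> \<delta> N] coord_sum by (intro DERIV_sum)
    qed
    ultimately show "coord (conv G (M' N x) (M N y) \<gamma> \<delta> w) l = coord (conv G (M N y) (M' N x) \<gamma> \<delta> w) l"
      unfolding transfer_matrices_commute[OF N, of _ y] by (rule DERIV_unique)
  qed
qed

end


section \<open>The inverse of the cyclic translation\<close>

context tl_space
begin

text \<open>At \<open>x = 0\<close> the monodromy is the identity, and tracing out the auxiliary factor leaves a rotation of
  the path.\<close>

lemma coord_translation:
  assumes "\<alpha> \<in> Arr G" "\<delta> \<in> loops \<alpha>" "w \<in> TP N (conj_arr G \<alpha> \<delta>)" "N \<ge> 1"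
    and c: "c \<in> basis_arrows"
  shows "coord (M N 0 \<alpha> \<delta> w) (c # l) = (if fst c = \<alpha> then coord w (l @ [c]) else 0)"
proof -
  have "coord (M N 0 \<alpha> \<delta> w) (c # l) = (\<Sum>e\<in>basis \<alpha>. if c = (\<alpha>, e) then coord w (l @ [(\<alpha>, e)]) else 0)"
    unfolding transfer_matrix_expand(2)[OF assms(1-4)] by simp
  also have "\<dots> = (\<Sum>e\<in>basis \<alpha>. if e = snd c then (if fst c = \<alpha> then coord w (l @ [c]) else 0) else 0)"
    by (intro sum.cong refl) (cases c, auto)
  also have "\<dots> = (if fst c = \<alpha> then coord w (l @ [c]) else 0)"
    using c basis_props(3)[OF assms(1)] by (auto simp: basis_arrows_def)
  finally show ?thesis .
qed

text \<open>Rotating a closed path conjugates its composite by the rotated arrow.\<close>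

lemma rotate_basis_path:
  assumes l: "c # l \<in> basis_paths N \<delta>" and \<delta>: "\<delta> \<in> hom_set G a a"
  shows "l @ [c] \<in> basis_paths N (conj_arr G (fst c) \<delta>)"
proof -
  let ?\<alpha> = "fst c"
  have p: "is_path G (?\<alpha> # map fst l)" "path_cmp G (?\<alpha> # map fst l) = \<delta>" "set (c # l) \<subseteq> basis_arrows"
    "length (c # l) = N"
    using l by (auto simp: basis_paths_def)
  have \<alpha>: "?\<alpha> \<in> Arr G" using is_path_Arr[OF p(1)] by simp
  show ?thesis
  proof (cases "l = []")
    case True
    then have "\<delta> = ?\<alpha>" using p(2) by simp
    moreover have "tgt G ?\<alpha> = src G ?\<alpha>" using \<delta> calculation by (auto simp: hom_set_def)
    ultimately have "conj_arr G ?\<alpha> \<delta> = ?\<alpha>" using cmp_div[OF \<alpha> \<alpha>] by (simp add: conj_arr_def)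
    then show ?thesis using p True \<alpha> by (simp add: basis_paths_def)
  next
    case False
    let ?\<eta> = "path_cmp G (map fst l)"
    have ne: "map fst l \<noteq> []" using False by simp
    have q: "is_path G (map fst l)" "tgt G ?\<alpha> = src G (hd (map fst l))"
      using p(1) is_path_Cons[OF ne] by auto
    note \<eta> = path_cmp_Arr[OF q(1)]
    have \<delta>': "\<delta> = cmp G ?\<eta> ?\<alpha>" using p(2) path_cmp_Cons[OF ne] by simp
    have s: "src G \<delta> = src G ?\<alpha>" "tgt G \<delta> = tgt G ?\<eta>"
      unfolding \<delta>' using \<alpha> \<eta> q(2) src_cmp[of ?\<alpha> ?\<eta>] tgt_cmp[of ?\<alpha> ?\<eta>] by auto
    have close: "tgt G ?\<eta> = src G ?\<alpha>" using \<delta> s by (auto simp: hom_set_def)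
    have path: "is_path G (map fst l @ [?\<alpha>])"
      using is_path_append[OF ne, of "[?\<alpha>]"] q(1) \<alpha> close \<eta>(3) by simp
    have "conj_arr G ?\<alpha> \<delta> = cmp G (cmp G (cmp G ?\<alpha> ?\<eta>) ?\<alpha>) (ivs G ?\<alpha>)"
      unfolding conj_arr_def \<delta>' using cmp_assoc[of ?\<alpha> ?\<eta> ?\<alpha>] \<alpha> \<eta> q(2) close by simp
    also have "\<dots> = cmp G ?\<alpha> ?\<eta>"
      using \<alpha> \<eta> q(2) close by (intro cmp_div) (simp_all add: cmp_Arr src_cmp)
    also have "\<dots> = path_cmp G (map fst l @ [?\<alpha>])"
      using path_cmp_append[OF ne _ path] by simp
    finally show ?thesis using p path by (simp add: basis_paths_def)
  qed
qed

text \<open>Moves the first factor, which has to be of degree \<open>ivs G \<alpha>\<close>, to the end.\<close>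

definition translation_inverse :: "nat \<Rightarrow> 'b \<Rightarrow> 'b \<Rightarrow> ('b, 'c) tensor \<Rightarrow> ('b, 'c) tensor" where
  "translation_inverse N \<alpha> \<delta> w =
     (if \<alpha> \<in> Arr G \<and> \<delta> \<in> loops \<alpha> \<and> w \<in> TP N (conj_arr G \<alpha> \<delta>)
      then of_coord N \<delta> (\<lambda>l. if fst (last l) = ivs G \<alpha> then coord w (last l # butlast l) else 0) else 0)"

lemma coord_translation_inverse:
  assumes "\<alpha> \<in> Arr G" "\<delta> \<in> loops \<alpha>" "w \<in> TP N (conj_arr G \<alpha> \<delta>)" "l @ [c] \<in> basis_paths N \<delta>"
  shows "coord (translation_inverse N \<alpha> \<delta> w) (l @ [c]) = (if fst c = ivs G \<alpha> then coord w (c # l) else 0)"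
  using assms by (simp add: translation_inverse_def coord_of_coord)

lemma translation_inverse_no_basis:
  assumes "\<alpha> \<in> Arr G" "V (ivs G \<alpha>) = {0}" "N \<ge> 1"
  shows "translation_inverse N \<alpha> = 0"
proof (intro ext)
  fix \<delta> w \<psi>s
  have no: "fst (last l) \<noteq> ivs G \<alpha>" if "l \<in> basis_paths N \<delta>" for l
  proof
    assume eq: "fst (last l) = ivs G \<alpha>"
    have "l \<noteq> []" "set l \<subseteq> basis_arrows" using that assms(3) by (auto simp: basis_paths_def)
    then have "last l \<in> basis_arrows" using last_in_set by blast
    then have "snd (last l) \<in> basis (ivs G \<alpha>)" using eq by (auto simp: basis_arrows_def)
    moreover have "basis (ivs G \<alpha>) = {}" using basis_props(5)[OF ivs_Arr[OF assms(1)]] assms(2) by blast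
    ultimately show False by blast
  qed
  have "of_coord N \<delta> (\<lambda>l. if fst (last l) = ivs G \<alpha> then coord w (last l # butlast l) else 0) \<psi>s = 0"
    unfolding of_coord_apply using no by (intro sum.neutral ballI) simp
  then show "translation_inverse N \<alpha> \<delta> w \<psi>s = 0 \<delta> w \<psi>s"
    by (simp add: translation_inverse_def)
qed

lemma translation_inverse_alg:
  assumes N: "N \<ge> 1"
  shows "translation_inverse N \<in> tp.alg N"
proof (rule alg_intro[OF N])
  fix \<alpha> \<delta> assume a: "\<alpha> \<in> Arr G" "\<delta> \<in> loops \<alpha>"
  show "translation_inverse N \<alpha> \<delta> \<in> lin_maps tscale tscale (TP N (conj_arr G \<alpha> \<delta>)) (TP N \<delta>)"
  proof (rule lin_maps_coordI)
    fix u v c l assume uv: "u \<in> TP N (conj_arr G \<alpha> \<delta>)" "v \<in> TP N (conj_arr G \<alpha> \<delta>)"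
    have eq: "coord (u + tscale c v) l = coord u l + c * coord v l" for l
      unfolding coord_linear by simp
    have K: "coord (translation_inverse N \<alpha> \<delta> z) l = (if l \<in> basis_paths N \<delta> \<and> fst (last l) = ivs G \<alpha>
      then coord z (last l # butlast l) else 0)" if "z \<in> TP N (conj_arr G \<alpha> \<delta>)" for z
      using a that by (auto simp: translation_inverse_def coord_of_coord)
    show "coord (translation_inverse N \<alpha> \<delta> (u + tscale c v)) l
      = coord (translation_inverse N \<alpha> \<delta> u) l + c * coord (translation_inverse N \<alpha> \<delta> v) l"
      unfolding K[OF uv(1)] K[OF uv(2)] K[OF TP_add[OF uv(1) TP_scale[OF uv(2)]]] eq by simp
  qed (use a in \<open>auto simp: translation_inverse_def of_coord_TP\<close>)
qed (use translation_inverse_no_basis N in \<open>auto simp: translation_inverse_def fun_eq_iff\<close>)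

text \<open>Both products rotate a path back and forth by one step. Only one term of the convolution product
  contributes to each coordinate, the one whose arrow matches the rotated entry, and the
  second factor is nonzero only if the total degree is an identity.\<close>

theorem translation_invertible:
  assumes N: "N \<ge> 1"
  shows "is_conv_inverse G tscale (TP N) (M N 0) (translation_inverse N)"
proof -
  let ?K = "translation_inverse N"
  note M = transfer_matrix_alg[OF N, of 0] and K = translation_inverse_alg[OF N]
  have idt: "cmp G \<gamma> \<alpha> = \<alpha> \<longleftrightarrow> \<gamma> = idt G (src G \<gamma>)" if "\<alpha> \<in> Arr G" "\<gamma> \<in> Arr G" "tgt G \<alpha> = src G \<gamma>" for \<alpha> \<gamma>
  proof
    assume "cmp G \<gamma> \<alpha> = \<alpha>"
    then have "cmp G \<gamma> \<alpha> = cmp G (idt G (tgt G \<alpha>)) \<alpha>" using cmp_idt_left[OF that(1)] by simp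
    then show "\<gamma> = idt G (src G \<gamma>)"
      using cmp_right_cancel[OF that(1,2), of "idt G (tgt G \<alpha>)"] that(3)
        idt_Arr[OF tgt_Ob[OF that(1)]] src_idt[OF tgt_Ob[OF that(1)]] by simp
  next
    assume "\<gamma> = idt G (src G \<gamma>)"
    then show "cmp G \<gamma> \<alpha> = \<alpha>" using cmp_idt_left[OF that(1)] that(3) by simp
  qed
  have "conv G (M N 0) ?K = conv_one G (TP N)"
  proof (rule tp.conv_eq_one[OF M K])
    fix \<gamma> \<delta> w
    assume \<gamma>: "\<gamma> \<in> Arr G" and \<delta>: "\<delta> \<in> loops \<gamma>" and w: "w \<in> TP N (conj_arr G \<gamma> \<delta>)"
    let ?\<beta> = "\<lambda>\<alpha>. cmp G \<gamma> (ivs G \<alpha>)"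
    show "conv G (M N 0) ?K \<gamma> \<delta> w = (if \<gamma> = idt G (src G \<gamma>) then w else 0)"
    proof (rule tensor_eqI)
      show "conv G (M N 0) ?K \<gamma> \<delta> w \<in> TP N \<delta>"
        by (rule tp.lin_map_in[OF tp.alg_lin_map[OF tp.conv_closed[OF M K] \<gamma> \<delta>]])
      show "(if \<gamma> = idt G (src G \<gamma>) then w else 0) \<in> TP N \<delta>"
        using w conj_arr_idt[OF \<delta>] by (metis TP_zero)
      fix l assume l: "l \<in> basis_paths N \<delta>"
      obtain c l' where l': "l = c # l'" using basis_paths_length[OF l] N by (cases l) auto
      define \<alpha> where "\<alpha> = fst c"
      have c: "c \<in> basis_arrows" "\<alpha> \<in> Arr G" using l l' by (auto simp: basis_paths_def basis_arrows_def \<alpha>_def)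
      have p: "is_path G (map fst l)" "path_cmp G (map fst l) = \<delta>" using l by (auto simp: basis_paths_def)
      have src: "src G \<alpha> = src G \<gamma>"
        using path_cmp_Arr(2)[OF p(1)] p(2) \<delta> l' by (simp add: hom_set_def \<alpha>_def)
      have "V \<alpha> \<noteq> {0}" using c basis_props(5)[OF c(2)] by (auto simp: basis_arrows_def \<alpha>_def)
      then have A: "\<alpha> \<in> arrows_from (src G \<gamma>)" using c src by (simp add: arrows_from_def)
      note d = conj_div[OF \<gamma> \<delta> c(2) src]
      have w': "w \<in> TP N (conj_arr G (?\<beta> \<alpha>) (conj_arr G \<alpha> \<delta>))" using w d(3) by simp
      have rot: "l' @ [c] \<in> basis_paths N (conj_arr G \<alpha> \<delta>)"
        using rotate_basis_path[OF l[unfolded l'] \<delta>] by (simp add: \<alpha>_def)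
      have coord: "coord (M N 0 \<alpha>' \<delta> (?K (?\<beta> \<alpha>') (conj_arr G \<alpha>' \<delta>) w)) l
        = (if \<alpha>' = \<alpha> then coord (?K (?\<beta> \<alpha>) (conj_arr G \<alpha> \<delta>) w) (l' @ [c]) else 0)"
        if A': "\<alpha>' \<in> arrows_from (src G \<gamma>)" for \<alpha>'
      proof -
        have \<alpha>': "\<alpha>' \<in> Arr G" "src G \<alpha>' = src G \<gamma>" "\<delta> \<in> loops \<alpha>'"
          using A' \<delta> by (auto simp: arrows_from_def)
        note d' = conj_div[OF \<gamma> \<delta> \<alpha>'(1,2)]
        show ?thesis
          unfolding l' coord_translation[OF \<alpha>'(1,3) tp.lin_map_in[OF tp.alg_lin_map[OF K d'(1,2)]] N c(1)]
          by (auto simp: \<alpha>_def)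
      qed
      have "coord (conv G (M N 0) ?K \<gamma> \<delta> w) l = (\<Sum>\<alpha>'\<in>arrows_from (src G \<gamma>).
          if \<alpha>' = \<alpha> then coord (?K (?\<beta> \<alpha>) (conj_arr G \<alpha> \<delta>) w) (l' @ [c]) else 0)"
        unfolding conv_transfer_matrix[OF \<gamma> \<delta> N] coord_sum by (rule sum.cong[OF refl coord])
      also have "\<dots> = coord (?K (?\<beta> \<alpha>) (conj_arr G \<alpha> \<delta>) w) (l' @ [c])"
        unfolding sum.delta[OF arrows_from(1)[OF src_Ob[OF \<gamma>]]] using A by (rule if_P)
      also have "\<dots> = (if \<alpha> = ivs G (?\<beta> \<alpha>) then coord w l else 0)"
        using coord_translation_inverse[OF d(1,2) w' rot] by (simp add: \<alpha>_def l')
      also have "\<alpha> = ivs G (?\<beta> \<alpha>) \<longleftrightarrow> \<gamma> = idt G (src G \<gamma>)"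
      proof -
        have "\<alpha> = ivs G (?\<beta> \<alpha>) \<longleftrightarrow> ?\<beta> \<alpha> = ivs G \<alpha>" using ivs_ivs c(2) d(1) by metis
        then show ?thesis using idt[of "ivs G \<alpha>" \<gamma>] c(2) \<gamma> src by (simp add: ivs_Arr tgt_ivs)
      qed
      finally show "coord (conv G (M N 0) ?K \<gamma> \<delta> w) l = coord (if \<gamma> = idt G (src G \<gamma>) then w else 0) l"
        by simp
    qed
  qed
  moreover have "conv G ?K (M N 0) = conv_one G (TP N)"
  proof (rule tp.conv_eq_one[OF K M])
    fix \<gamma> \<delta> w
    assume \<gamma>: "\<gamma> \<in> Arr G" and \<delta>: "\<delta> \<in> loops \<gamma>" and w: "w \<in> TP N (conj_arr G \<gamma> \<delta>)"
    let ?\<beta> = "\<lambda>\<alpha>. cmp G \<gamma> (ivs G \<alpha>)"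
    let ?A = "{\<alpha> \<in> Arr G. src G \<alpha> = src G \<gamma> \<and> V (ivs G \<alpha>) \<noteq> {0}}"
    have finA: "finite ?A"
    proof -
      have "finite {\<alpha> \<in> Arr G. (src G \<alpha> = src G \<gamma> \<or> tgt G \<alpha> = src G \<gamma>) \<and> V \<alpha> \<noteq> {0}}"
        using finite_type src_Ob[OF \<gamma>] by (auto simp: graded_finite_type_def)
      moreover have "?A \<subseteq> ivs G ` {\<alpha> \<in> Arr G. (src G \<alpha> = src G \<gamma> \<or> tgt G \<alpha> = src G \<gamma>) \<and> V \<alpha> \<noteq> {0}}"
      proof
        fix \<alpha> assume "\<alpha> \<in> ?A"
        then show "\<alpha> \<in> ivs G ` {\<alpha> \<in> Arr G. (src G \<alpha> = src G \<gamma> \<or> tgt G \<alpha> = src G \<gamma>) \<and> V \<alpha> \<noteq> {0}}"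
          by (intro rev_image_eqI[of "ivs G \<alpha>"]) (auto simp: ivs_ivs ivs_Arr tgt_ivs)
      qed
      ultimately show ?thesis by (rule finite_surj)
    qed
    have conv: "conv G ?K (M N 0) \<gamma> \<delta> w = (\<Sum>\<alpha>\<in>?A. ?K \<alpha> \<delta> (M N 0 (?\<beta> \<alpha>) (conj_arr G \<alpha> \<delta>) w))"
      by (rule tp.conv_apply_alg[OF K \<gamma> \<delta> finA]) (use translation_inverse_no_basis[OF _ _ N] in auto)
    show "conv G ?K (M N 0) \<gamma> \<delta> w = (if \<gamma> = idt G (src G \<gamma>) then w else 0)"
    proof (rule tensor_eqI)
      show "conv G ?K (M N 0) \<gamma> \<delta> w \<in> TP N \<delta>"
        by (rule tp.lin_map_in[OF tp.alg_lin_map[OF tp.conv_closed[OF K M] \<gamma> \<delta>]])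
      show "(if \<gamma> = idt G (src G \<gamma>) then w else 0) \<in> TP N \<delta>"
        using w conj_arr_idt[OF \<delta>] by (metis TP_zero)
      fix l assume l: "l \<in> basis_paths N \<delta>"
      obtain c l' where l': "l = l' @ [c]" using basis_paths_length[OF l] N by (cases l rule: rev_cases) auto
      have c: "c \<in> basis_arrows" "fst c \<in> Arr G" using l l' by (auto simp: basis_paths_def basis_arrows_def)
      have p: "is_path G (map fst l)" "path_cmp G (map fst l) = \<delta>" using l by (auto simp: basis_paths_def)
      have tgt: "tgt G (fst c) = src G \<gamma>"
        using path_cmp_Arr(3)[OF p(1)] p(2) \<delta> l' by (simp add: hom_set_def)
      have Vc: "V (fst c) \<noteq> {0}" using c basis_props(5)[OF c(2)] by (auto simp: basis_arrows_def)
      define \<alpha> where "\<alpha> = ivs G (fst c)"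
      have \<alpha>: "\<alpha> \<in> Arr G" "src G \<alpha> = src G \<gamma>" "ivs G \<alpha> = fst c"
        using c(2) tgt by (simp_all add: \<alpha>_def ivs_Arr src_ivs ivs_ivs)
      then have A: "\<alpha> \<in> ?A" using Vc by simp
      note d = conj_div[OF \<gamma> \<delta> \<alpha>(1,2)]
      have w': "w \<in> TP N (conj_arr G (?\<beta> \<alpha>) (conj_arr G \<alpha> \<delta>))" using w d(3) by simp
      have coord: "coord (?K \<alpha>' \<delta> (M N 0 (?\<beta> \<alpha>') (conj_arr G \<alpha>' \<delta>) w)) l
        = (if \<alpha>' = \<alpha> then coord (M N 0 (?\<beta> \<alpha>) (conj_arr G \<alpha> \<delta>) w) (c # l') else 0)"
        if A': "\<alpha>' \<in> ?A" for \<alpha>'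
      proof -
        have \<alpha>': "\<alpha>' \<in> Arr G" "src G \<alpha>' = src G \<gamma>" "\<delta> \<in> loops \<alpha>'"
          using A' \<delta> by auto
        note d' = conj_div[OF \<gamma> \<delta> \<alpha>'(1,2)]
        have "fst c = ivs G \<alpha>' \<longleftrightarrow> \<alpha>' = \<alpha>" using ivs_ivs[OF \<alpha>'(1)] \<alpha>(3) by (auto simp: \<alpha>_def)
        then show ?thesis
          unfolding l' coord_translation_inverse[OF \<alpha>'(1,3) tp.lin_map_in[OF tp.alg_lin_map[OF M d'(1,2)]] l[unfolded l']]
          by auto
      qed
      have "coord (conv G ?K (M N 0) \<gamma> \<delta> w) l = (\<Sum>\<alpha>'\<in>?A.
          if \<alpha>' = \<alpha> then coord (M N 0 (?\<beta> \<alpha>) (conj_arr G \<alpha> \<delta>) w) (c # l') else 0)"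
        unfolding conv coord_sum by (rule sum.cong[OF refl coord])
      also have "\<dots> = coord (M N 0 (?\<beta> \<alpha>) (conj_arr G \<alpha> \<delta>) w) (c # l')"
        unfolding sum.delta[OF finA] using A by (rule if_P)
      also have "\<dots> = (if fst c = ?\<beta> \<alpha> then coord w l else 0)"
        unfolding coord_translation[OF d(1,2) w' N c(1)] l' ..
      also have "fst c = ?\<beta> \<alpha> \<longleftrightarrow> \<gamma> = idt G (src G \<gamma>)"
        using idt[OF c(2) \<gamma> tgt] \<alpha>(3) by auto
      finally show "coord (conv G ?K (M N 0) \<gamma> \<delta> w) l = coord (if \<gamma> = idt G (src G \<gamma>) then w else 0) l"
        by simp
    qed
  qed
  ultimately show ?thesis using M K by (simp add: is_conv_inverse_def)
qed

theorem hamiltonian_commutes: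
  assumes N: "N \<ge> 1"
  shows "conv G (hamiltonian G sc V N T) (M N y) = conv G (M N y) (hamiltonian G sc V N T)"
  unfolding hamiltonian_def tp.conv_inverse_eq[OF translation_invertible[OF N]]
  by (rule tp.log_derivative_commutes[OF translation_invertible[OF N] transfer_matrix_deriv_alg[OF N]
        transfer_matrix_alg[OF N] transfer_matrices_commute[OF N] transfer_matrix_deriv_commutes[OF N]])

end


section \<open>Baxterization forces a constant loop weight\<close>

text \<open>A meromorphic function that is constant on an open set is constant. So the open set of generic pairs
  contains one with \<open>f z \<noteq> 0\<close> and \<open>f z' \<noteq> f z\<close>. For this pair the numerators are equal and nonzero, hence so
  are the denominators for \<open>a\<close> and \<open>b\<close>.\<close>

lemma baxterizable_constant:
  assumes G: "groupoid G" and bax: "baxterizable G \<kappa>" and ab: "a \<in> Ob G" "b \<in> Ob G"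
  shows "\<kappa> a = \<kappa> b"
proof -
  interpret groupoid G by (rule G)
  obtain f U where f: "f nicely_meromorphic_on UNIV" "\<not> f constant_on UNIV"
    and U: "open U" "closure U = UNIV"
    and rel: "\<And>z z' a. (z, z') \<in> U \<Longrightarrow> a \<in> Ob G \<Longrightarrow> 1 + \<kappa> a * f z + f z * f z' \<noteq> 0 \<and>
      f (z' - z) = (f z' - f z) / (1 + \<kappa> a * f z + f z * f z')"
  proof -
    from bax obtain f U where f: "f nicely_meromorphic_on UNIV" "\<not> f constant_on UNIV" "open U" "closure U = UNIV"
      and rel: "\<forall>(z, z')\<in>U. \<not> is_pole f z \<and> \<not> is_pole f z' \<and> \<not> is_pole f (z' - z)
          \<and> (let x = f z; x' = f z'; x'' = f (z' - z) in
             \<forall>a\<in>Ob G. \<forall>\<alpha>\<in>Arr G. src G \<alpha> = a \<longrightarrow>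
               1 + \<kappa> a * x + x * x' \<noteq> 0 \<and> x'' = (x' - x) / (1 + \<kappa> a * x + x * x')
             \<and> 1 + \<kappa> (tgt G \<alpha>) * x + x * x' \<noteq> 0
             \<and> x'' = (x' - x) / (1 + \<kappa> (tgt G \<alpha>) * x + x * x'))"
      unfolding baxterizable_def by blast
    have "1 + \<kappa> a * f z + f z * f z' \<noteq> 0 \<and> f (z' - z) = (f z' - f z) / (1 + \<kappa> a * f z + f z * f z')"
      if "(z, z') \<in> U" "a \<in> Ob G" for z z' a
      using bspec[OF rel that(1)] that(2) idt_Arr[OF that(2)] src_idt[OF that(2)] unfolding Let_def by blast
    with f show thesis by (intro that) auto
  qed
  have "U \<noteq> {}" using U by auto
  then obtain z0 z0' where "(z0, z0') \<in> U" by auto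
  then obtain A B where AB: "open A" "open B" "(z0, z0') \<in> A \<times> B" "A \<times> B \<subseteq> U"
    using open_prod_elim[OF U(1)] by metis
  have nonconst: "\<exists>z\<in>S. f z \<noteq> c" if "open S" "S \<noteq> {}" for S c
    using constant_on_extend_nicely_meromorphic_on[OF f(1) _ that(1) open_UNIV connected_UNIV that(2)] f(2)
    by (auto simp: constant_on_def)
  obtain z where z: "z \<in> A" "f z \<noteq> 0" using nonconst[OF AB(1), of 0] AB(3) by auto
  obtain z' where z': "z' \<in> B" "f z' \<noteq> f z" using nonconst[OF AB(2), of "f z"] AB(3) by auto
  have "(z, z') \<in> U" using AB z z' by auto
  note r = rel[OF this ab(1)] rel[OF this ab(2)]
  then have "1 + \<kappa> a * f z + f z * f z' = 1 + \<kappa> b * f z + f z * f z'"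
    using z'(2) by (auto simp: field_simps)
  then show ?thesis using z(2) by simp
qed

theorem proposition2p40:
  fixes G :: "('o, 'a) groupoid_data"
    and sc :: "complex \<Rightarrow> 'v::ab_group_add \<Rightarrow> 'v"
    and V :: "'a \<Rightarrow> 'v set"
    and N :: nat
    and \<kappa> :: "'o \<Rightarrow> complex"
    and T :: "'o \<Rightarrow> 'a \<Rightarrow> ('a, 'v) tensor \<Rightarrow> ('a, 'v) tensor"
  assumes "groupoid G"
    and "graded_finite_type G sc V"
    and "N \<ge> 1"
    and "\<forall>a\<in>Ob G. \<kappa> a \<noteq> 0"
    and "local_dyn_TL G sc V \<kappa> T"
    and "baxterizable G \<kappa>"
  shows "(\<exists>K. is_conv_inverse G tscale (tensor_power G sc V N) (transfer_matrix G sc V N T 0) K)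
    \<and> (\<forall>y. conv G (hamiltonian G sc V N T) (transfer_matrix G sc V N T y)
         = conv G (transfer_matrix G sc V N T y) (hamiltonian G sc V N T))"
proof -
  obtain k where k: "\<And>a. a \<in> Ob G \<Longrightarrow> \<kappa> a = k"
    using baxterizable_constant[OF assms(1,6)] by metis
  interpret groupoid G by (rule assms(1))
  interpret tl_space G sc V T k
  proof unfold_locales
    show "graded_finite_type G sc V" by (rule assms(2))
    show "local_dyn_TL G sc V (\<lambda>_. k) T"
      using assms(5) k unfolding local_dyn_TL_def by simp
  qed
  show ?thesis
    using translation_invertible[OF assms(3)] hamiltonian_commutes[OF assms(3)] by blast
qed

end
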